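(* Let $\epsilon\in\{-1,1\}$ and let $(M,g,J)$ be a connected $\epsilon$-Kähler manifold of dimension $\dim M\geq 4$ admitting a degenerate homogeneous $\epsilon$-Kähler structure of linear type $S$, given by $$S_XY=g(X,Y)\xi-g(\xi,Y)X+\epsilon g(X,JY)J\xi-\epsilon g(\xi,JY)JX-2g(\zeta,JX)JY .$$ Then $\zeta=\lambda\xi$ for some constant $\lambda\in\mathbb{R}$, and the Ricci curvature of $g$ is $$r=-\frac{1}{a}\lambda(\epsilon+2\lambda)\left(\theta\otimes\theta-\epsilon(\theta\circ J)\otimes(\theta\circ J)\right),$$ where $a=1/(\dim M+2)$ and $\theta=\xi^{\flat}=g(\xi,\cdot)$. In particular the scalar curvature of $g$ vanishes.
   Context: Let $\epsilon\in\{-1,1\}$. An $\epsilon$-Kähler manifold $(M,g,J)$ is a pseudo-Riemannian manifold $(M,g)$ of even dimension with a smooth section $J$ of $\mathfrak{so}(TM)$ (i.e. $J$ is $g$-skew-symmetric) such that $J^2=\epsilon\,\mathrm{Id}$ and $\nabla J=0$, $\nabla$ being the Levi-Civita connection (pseudo-Kähler for $\epsilon=-1$, para-Kähler for $\epsilon=1$). A homogeneous $\epsilon$-Kähler structure is a $(1,2)$-tensor field $S$ such that the connection $\widetilde\nabla=\nabla-S$ satisfies $\widetilde\nabla g=0$, $\widetilde\nabla R=0$, $\widetilde\nabla S=0$, $\widetilde\nabla J=0$, where $R$ is the curvature tensor of $g$. It is of linear type if it has the form $$S_XY=g(X,Y)\xi-g(\xi,Y)X+\epsilon g(X,JY)J\xi-\epsilon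 g(\xi,JY)JX-2g(\zeta,JX)JY$$ for some vector fields $\xi,\zeta$ on $M$; such an $S$ is degenerate if $\xi\neq0$ and $g(\xi,\xi)=0$. The Ricci tensor is normalized with the usual sign (positive on round spheres). *)

theory Defs
  imports "HOL-Analysis.Analysis"
begin

section \<open>Smooth manifolds\<close>

text \<open>For open \<open>U\<close>, \<open>Ck_on k f U\<close> says that \<open>f\<close> is of class \<open>C^k\<close> on \<open>U\<close>: all iterated directional
  derivatives up to order \<open>k\<close> exist (as Frechet derivatives) and are continuous.\<close>

primrec Ck_on :: "nat \<Rightarrow> ('b::real_normed_vector \<Rightarrow> 'c::real_normed_vector) \<Rightarrow> 'b set \<Rightarrow> bool" where
  "Ck_on 0 f U \<longleftrightarrow> continuous_on U f"
| "Ck_on (Suc k) f U \<longleftrightarrow> (\<forall>x\<in>U. f differentiable (at x)) \<and>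
     (\<forall>v. Ck_on k (\<lambda>x. frechet_derivative f (at x) v) U)"

definition smooth_on :: "'b::real_normed_vector set \<Rightarrow> ('b \<Rightarrow> 'c::real_normed_vector) \<Rightarrow> bool" where
  "smooth_on U f \<longleftrightarrow> (\<forall>k. Ck_on k f U)"

text \<open>A chart is a pair \<open>(U, \<phi>)\<close>; the values of \<open>\<phi>\<close> outside \<open>U\<close> are irrelevant.\<close>

type_synonym ('a, 'n) chart = "'a set \<times> ('a \<Rightarrow> real^'n)"

definition is_chart :: "'a topology \<Rightarrow> ('a, 'n::finite) chart \<Rightarrow> bool" where
  "is_chart X c \<longleftrightarrow> openin X (fst c) \<and> open (snd c ` fst c) \<and>
     homeomorphic_map (subtopology X (fst c)) (top_of_set (snd c ` fst c)) (snd c)"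

definition chart_image :: "('a, 'n::finite) chart \<Rightarrow> (real^'n) set" where
  "chart_image c = snd c ` fst c"

definition overlap :: "('a, 'n::finite) chart \<Rightarrow> ('a, 'n) chart \<Rightarrow> (real^'n) set" where
  "overlap c d = snd c ` (fst c \<inter> fst d)"

definition transition :: "('a, 'n::finite) chart \<Rightarrow> ('a, 'n) chart \<Rightarrow> real^'n \<Rightarrow> real^'n" where
  "transition c d x = snd d (inv_into (fst c) (snd c) x)"

definition smooth_manifold :: "'a topology \<Rightarrow> ('a, 'n::finite) chart set \<Rightarrow> bool" where
  "smooth_manifold X \<A> \<longleftrightarrow>
     Hausdorff_space X \<and> second_countable X \<and>
     (\<forall>c\<in>\<A>. is_chart X c) \<and> (\<Union>c\<in>\<A>. fst c) = topspace X \<and>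
     (\<forall>c\<in>\<A>. \<forall>d\<in>\<A>. smooth_on (overlap c d) (transition c d))"


section \<open>Tensor fields\<close>

text \<open>A tensor field is given by its coordinate representation in every chart \<open>c\<close> of the atlas, a
  smooth function on \<open>chart_image c\<close> with values in the tensors of the given type over \<open>real^'n\<close>.
  The representations in two charts are related on the overlap by the differential \<open>P\<close> of the
  transition map. Values outside \<open>chart_image c\<close>, or for charts not in the atlas, are irrelevant.\<close>

type_synonym ('a, 'n, 't) field = "('a, 'n) chart \<Rightarrow> real^'n \<Rightarrow> 't"
type_synonym 'n form2 = "real^'n \<Rightarrow> real^'n \<Rightarrow> real"
type_synonym 'n endo = "real^'n \<Rightarrow> real^'n"
type_synonym 'n bil = "real^'n \<Rightarrow> real^'n \<Rightarrow> real^'n"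
type_synonym 'n tril = "real^'n \<Rightarrow> real^'n \<Rightarrow> real^'n \<Rightarrow> real^'n"

definition compatible ::
  "('a, 'n::finite) chart set \<Rightarrow> ('n endo \<Rightarrow> 't \<Rightarrow> 't \<Rightarrow> bool) \<Rightarrow> ('a, 'n, 't) field \<Rightarrow> bool" where
  "compatible \<A> related T \<longleftrightarrow> (\<forall>c\<in>\<A>. \<forall>d\<in>\<A>. \<forall>x\<in>overlap c d.
     related (frechet_derivative (transition c d) (at x)) (T c x) (T d (transition c d x)))"

definition vector_field :: "('a, 'n::finite) chart set \<Rightarrow> ('a, 'n, real^'n) field \<Rightarrow> bool" where
  "vector_field \<A> V \<longleftrightarrow>
     (\<forall>c\<in>\<A>. smooth_on (chart_image c) (V c)) \<and>
     compatible \<A> (\<lambda>P v v'. v' = P v) V"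

definition tensor_field_0_2 :: "('a, 'n::finite) chart set \<Rightarrow> ('a, 'n, 'n form2) field \<Rightarrow> bool" where
  "tensor_field_0_2 \<A> b \<longleftrightarrow>
     (\<forall>c\<in>\<A>. \<forall>x\<in>chart_image c. bilinear (b c x)) \<and>
     (\<forall>c\<in>\<A>. \<forall>u v. smooth_on (chart_image c) (\<lambda>x. b c x u v)) \<and>
     compatible \<A> (\<lambda>P \<beta> \<beta>'. \<forall>u v. \<beta>' (P u) (P v) = \<beta> u v) b"

definition tensor_field_1_1 :: "('a, 'n::finite) chart set \<Rightarrow> ('a, 'n, 'n endo) field \<Rightarrow> bool" where
  "tensor_field_1_1 \<A> F \<longleftrightarrow>
     (\<forall>c\<in>\<A>. \<forall>x\<in>chart_image c. linear (F c x)) \<and>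
     (\<forall>c\<in>\<A>. \<forall>u. smooth_on (chart_image c) (\<lambda>x. F c x u)) \<and>
     compatible \<A> (\<lambda>P \<phi> \<phi>'. \<forall>u. \<phi>' (P u) = P (\<phi> u)) F"

definition tensor_field_1_2 :: "('a, 'n::finite) chart set \<Rightarrow> ('a, 'n, 'n bil) field \<Rightarrow> bool" where
  "tensor_field_1_2 \<A> S \<longleftrightarrow>
     (\<forall>c\<in>\<A>. \<forall>x\<in>chart_image c. bilinear (S c x)) \<and>
     (\<forall>c\<in>\<A>. \<forall>u v. smooth_on (chart_image c) (\<lambda>x. S c x u v)) \<and>
     compatible \<A> (\<lambda>P \<sigma> \<sigma>'. \<forall>u v. \<sigma>' (P u) (P v) = P (\<sigma> u v)) S"


section \<open>Connections in a chart\<close>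

text \<open>In a chart, an affine connection is given by its Christoffel symbols
  \<open>C x u v = (\<nabla>\<^sub>u v)\<^sub>x\<close> for constant (coordinate) vector fields \<open>u\<close>, \<open>v\<close>.
  \<open>cov_p_q C T x u\<close> is the covariant derivative of the \<open>(p,q)\<close>-tensor field \<open>T\<close> at \<open>x\<close> in
  direction \<open>u\<close>.\<close>

definition dir_deriv :: "(real^'n::finite \<Rightarrow> 'c::real_normed_vector) \<Rightarrow> real^'n \<Rightarrow> real^'n \<Rightarrow> 'c" where
  "dir_deriv f x u = frechet_derivative f (at x) u"

definition cov_0_2 :: "(real^'n::finite \<Rightarrow> 'n bil) \<Rightarrow> (real^'n \<Rightarrow> 'n form2) \<Rightarrow>
    real^'n \<Rightarrow> real^'n \<Rightarrow> 'n form2" where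
  "cov_0_2 C b x u v w = dir_deriv (\<lambda>y. b y v w) x u - b x (C x u v) w - b x v (C x u w)"

definition cov_1_1 :: "(real^'n::finite \<Rightarrow> 'n bil) \<Rightarrow> (real^'n \<Rightarrow> 'n endo) \<Rightarrow>
    real^'n \<Rightarrow> real^'n \<Rightarrow> 'n endo" where
  "cov_1_1 C F x u v = dir_deriv (\<lambda>y. F y v) x u + C x u (F x v) - F x (C x u v)"

definition cov_1_2 :: "(real^'n::finite \<Rightarrow> 'n bil) \<Rightarrow> (real^'n \<Rightarrow> 'n bil) \<Rightarrow>
    real^'n \<Rightarrow> real^'n \<Rightarrow> 'n bil" where
  "cov_1_2 C S x u v w =
     dir_deriv (\<lambda>y. S y v w) x u + C x u (S x v w) - S x (C x u v) w - S x v (C x u w)"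

definition cov_1_3 :: "(real^'n::finite \<Rightarrow> 'n bil) \<Rightarrow> (real^'n \<Rightarrow> 'n tril) \<Rightarrow>
    real^'n \<Rightarrow> real^'n \<Rightarrow> 'n tril" where
  "cov_1_3 C R x u v w z =
     dir_deriv (\<lambda>y. R y v w z) x u + C x u (R x v w z)
       - R x (C x u v) w z - R x v (C x u w) z - R x v w (C x u z)"

text \<open>\<open>R(u,v)w = \<nabla>\<^sub>u \<nabla>\<^sub>v w - \<nabla>\<^sub>v \<nabla>\<^sub>u w - \<nabla>\<^bsub>[u,v]\<^esub> w\<close>, evaluated on coordinate fields,
  for which the bracket vanishes.\<close>

definition curvature :: "(real^'n::finite \<Rightarrow> 'n bil) \<Rightarrow> real^'n \<Rightarrow> 'n tril" where
  "curvature C x u v w =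
     dir_deriv (\<lambda>y. C y v w) x u - dir_deriv (\<lambda>y. C y u w) x v
       + C x u (C x v w) - C x v (C x u w)"

text \<open>The Levi-Civita connection is the unique connection which is torsion-free (that is, with
  symmetric Christoffel symbols) and metric.\<close>

definition levi_civita :: "(real^'n::finite \<Rightarrow> 'n form2) \<Rightarrow> real^'n \<Rightarrow> 'n bil" where
  "levi_civita b x = (THE \<Gamma>. bilinear \<Gamma> \<and> (\<forall>u v. \<Gamma> u v = \<Gamma> v u) \<and>
     (\<forall>u v w. cov_0_2 (\<lambda>_. \<Gamma>) b x u v w = 0))"

definition riemann :: "(real^'n::finite \<Rightarrow> 'n form2) \<Rightarrow> real^'n \<Rightarrow> 'n tril" where
  "riemann b = curvature (levi_civita b)"

definition ricci :: "(real^'n::finite \<Rightarrow> 'n form2) \<Rightarrow> real^'n \<Rightarrow> 'n form2" where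
  "ricci b x v w = trace (matrix (\<lambda>u. riemann b x u v w))"

text \<open>The trace of a bilinear form \<open>r\<close> with respect to a nondegenerate form \<open>\<beta>\<close>, i.e. the trace of
  \<open>r\<close> with one index raised.\<close>

definition metric_trace :: "'n::finite form2 \<Rightarrow> 'n form2 \<Rightarrow> real" where
  "metric_trace \<beta> r = trace (matrix (THE F. linear F \<and> (\<forall>v w. \<beta> (F v) w = r v w)))"

definition scalar_curvature :: "(real^'n::finite \<Rightarrow> 'n form2) \<Rightarrow> real^'n \<Rightarrow> real" where
  "scalar_curvature b x = metric_trace (b x) (ricci b x)"


section \<open>Homogeneous \<open>\<epsilon>\<close>-Kaehler structures\<close>

definition nondegenerate :: "'n::finite form2 \<Rightarrow> bool" where
  "nondegenerate \<beta> \<longleftrightarrow> (\<forall>u. (\<forall>v. \<beta> u v = 0) \<longrightarrow> u = 0)"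

text \<open>The index of the metric is automatically locally constant, being that of a continuous
  nondegenerate form.\<close>

definition pseudo_riemannian_metric ::
  "('a, 'n::finite) chart set \<Rightarrow> ('a, 'n, 'n form2) field \<Rightarrow> bool" where
  "pseudo_riemannian_metric \<A> g \<longleftrightarrow> tensor_field_0_2 \<A> g \<and>
     (\<forall>c\<in>\<A>. \<forall>x\<in>chart_image c. (\<forall>u v. g c x u v = g c x v u) \<and> nondegenerate (g c x))"

definition eps_kaehler_manifold ::
  "'a topology \<Rightarrow> ('a, 'n::finite) chart set \<Rightarrow> real \<Rightarrow>
     ('a, 'n, 'n form2) field \<Rightarrow> ('a, 'n, 'n endo) field \<Rightarrow> bool" where
  "eps_kaehler_manifold X \<A> \<epsilon> g J \<longleftrightarrow>
     smooth_manifold X \<A> \<and> even CARD('n) \<and>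
     pseudo_riemannian_metric \<A> g \<and> tensor_field_1_1 \<A> J \<and>
     (\<forall>c\<in>\<A>. \<forall>x\<in>chart_image c.
        (\<forall>u v. g c x (J c x u) v + g c x u (J c x v) = 0) \<and>
        (\<forall>u. J c x (J c x u) = \<epsilon> *\<^sub>R u) \<and>
        (\<forall>u v. cov_1_1 (levi_civita (g c)) (J c) x u v = 0))"

definition tilde_connection ::
  "('a, 'n::finite, 'n form2) field \<Rightarrow> ('a, 'n, 'n bil) field \<Rightarrow> ('a, 'n, 'n bil) field" where
  "tilde_connection g S c x u v = levi_civita (g c) x u v - S c x u v"

definition homogeneous_eps_kaehler_structure ::
  "('a, 'n::finite) chart set \<Rightarrow> ('a, 'n, 'n form2) field \<Rightarrow> ('a, 'n, 'n endo) field \<Rightarrow>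
     ('a, 'n, 'n bil) field \<Rightarrow> bool" where
  "homogeneous_eps_kaehler_structure \<A> g J S \<longleftrightarrow>
     tensor_field_1_2 \<A> S \<and>
     (\<forall>c\<in>\<A>. \<forall>x\<in>chart_image c.
        (\<forall>u v w. cov_0_2 (tilde_connection g S c) (g c) x u v w = 0) \<and>
        (\<forall>u v w z. cov_1_3 (tilde_connection g S c) (riemann (g c)) x u v w z = 0) \<and>
        (\<forall>u v w. cov_1_2 (tilde_connection g S c) (S c) x u v w = 0) \<and>
        (\<forall>u v. cov_1_1 (tilde_connection g S c) (J c) x u v = 0))"

definition linear_type ::
  "('a, 'n::finite) chart set \<Rightarrow> real \<Rightarrow> ('a, 'n, 'n form2) field \<Rightarrow> ('a, 'n, 'n endo) field \<Rightarrow>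
     ('a, 'n, real^'n) field \<Rightarrow> ('a, 'n, real^'n) field \<Rightarrow> ('a, 'n, 'n bil) field \<Rightarrow> bool" where
  "linear_type \<A> \<epsilon> g J \<xi> \<zeta> S \<longleftrightarrow>
     vector_field \<A> \<xi> \<and> vector_field \<A> \<zeta> \<and>
     (\<forall>c\<in>\<A>. \<forall>x\<in>chart_image c. \<forall>u v.
        S c x u v =
          g c x u v *\<^sub>R \<xi> c x - g c x (\<xi> c x) v *\<^sub>R u
          + (\<epsilon> * g c x u (J c x v)) *\<^sub>R J c x (\<xi> c x)
          - (\<epsilon> * g c x (\<xi> c x) (J c x v)) *\<^sub>R J c x u
          - (2 * g c x (\<zeta> c x) (J c x u)) *\<^sub>R J c x v)"

text \<open>The condition \<open>\<xi> \<noteq> 0\<close> means that \<open>\<xi>\<close> does not vanish identically.\<close>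

definition degenerate_direction ::
  "('a, 'n::finite) chart set \<Rightarrow> ('a, 'n, 'n form2) field \<Rightarrow> ('a, 'n, real^'n) field \<Rightarrow> bool" where
  "degenerate_direction \<A> g \<xi> \<longleftrightarrow>
     (\<exists>c\<in>\<A>. \<exists>x\<in>chart_image c. \<xi> c x \<noteq> 0) \<and>
     (\<forall>c\<in>\<A>. \<forall>x\<in>chart_image c. g c x (\<xi> c x) (\<xi> c x) = 0)"

definition flat :: "('a, 'n::finite, 'n form2) field \<Rightarrow> ('a, 'n, real^'n) field \<Rightarrow>
    ('a, 'n, real^'n \<Rightarrow> real) field" where
  "flat g V c x u = g c x (V c x) u"


section \<open>Existence and uniqueness behind the definite descriptions\<close>

text \<open>The descriptions in \<open>levi_civita\<close> and \<open>metric_trace\<close> denote at every point of a chart of a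
  pseudo-Riemannian manifold.\<close>


lemma nondegenerate_represents:
  fixes \<beta> :: "'n::finite form2"
  assumes "bilinear \<beta>" "nondegenerate \<beta>" "linear f"
  shows "\<exists>!w. \<forall>z. \<beta> w z = f z"
proof -
  define T where "T w = (\<chi> i. \<beta> w (axis i 1))" for w
  have lin: "linear (\<lambda>w. \<beta> w z)" "linear (\<beta> w)" for w z
    using assms(1) by (auto simp: bilinear_def)
  have T: "linear T"
    by (rule linearI) (auto simp: T_def vec_eq_iff linear_add[OF lin(1)] linear_scale[OF lin(1)])
  have ext: "(\<forall>z. h z = k z) \<longleftrightarrow> (\<forall>i. h (axis i 1) = k (axis i 1))"
    if "linear h" "linear k" for h k :: "real^'n \<Rightarrow> real"
  proof -
    have "h = k" if "\<forall>i. h (axis i 1) = k (axis i 1)"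
      using linear_eq_stdbasis[OF \<open>linear h\<close> \<open>linear k\<close>] that
      by (auto simp: Basis_vec_def fun_eq_iff)
    then show ?thesis by auto
  qed
  have eq: "(\<forall>z. \<beta> w z = f z) \<longleftrightarrow> T w = (\<chi> i. f (axis i 1))" for w
    by (simp add: ext[OF lin(2) assms(3)] T_def vec_eq_iff)
  have lin0: "linear (\<lambda>z. 0::real)" by (rule linearI) auto
  have "inj T"
    unfolding linear_injective_0[OF T]
  proof (intro allI impI)
    fix w assume "T w = 0"
    then have "\<forall>z. \<beta> w z = 0"
      by (simp add: ext[OF lin(2) lin0] T_def vec_eq_iff)
    with assms(2) show "w = 0" by (auto simp: nondegenerate_def)
  qed
  then have "surj T" using T linear_injective_imp_surjective by blast
  with \<open>inj T\<close> show ?thesis unfolding eq by (metis inj_eq surjD)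
qed

lemma metric_trace_wd:
  fixes \<beta> :: "'n::finite form2"
  assumes "bilinear \<beta>" "nondegenerate \<beta>" "bilinear r"
  shows "\<exists>!F. linear F \<and> (\<forall>v w. \<beta> (F v) w = r v w)"
proof -
  have rl: "linear (r v)" "linear (\<lambda>v. r v w)" and bl: "linear (\<lambda>w. \<beta> w z)" for v w z
    using assms by (auto simp: bilinear_def)
  note ex = nondegenerate_represents[OF assms(1,2) rl(1)]
  then obtain F where F: "\<And>v w. \<beta> (F v) w = r v w" by metis
  have uni: "p = q" if "\<And>w. \<beta> p w = \<beta> q w" for p q
    using assms(2) that linear_diff[OF bl] by (metis eq_iff_diff_eq_0 nondegenerate_def)
  have "linear F"
    by (rule linearI; rule uni)
      (simp_all add: F linear_add[OF bl] linear_scale[OF bl] linear_add[OF rl(2)] linear_scale[OF rl(2)])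
  show ?thesis
    by (rule ex1I[of _ F]) (use \<open>linear F\<close> F uni in \<open>auto simp: fun_eq_iff\<close>)
qed

lemma levi_civita_wd:
  fixes b :: "real^'n::finite \<Rightarrow> 'n form2"
  assumes U: "open U" "x \<in> U"
    and bil: "\<And>y. y \<in> U \<Longrightarrow> bilinear (b y)" and sym: "\<And>y u v. y \<in> U \<Longrightarrow> b y u v = b y v u"
    and nd: "nondegenerate (b x)"
    and diff: "\<And>v w. (\<lambda>y. b y v w) differentiable (at x)"
  shows "\<exists>!\<Gamma>. bilinear \<Gamma> \<and> (\<forall>u v. \<Gamma> u v = \<Gamma> v u) \<and> (\<forall>u v w. cov_0_2 (\<lambda>_. \<Gamma>) b x u v w = 0)"
proof -
  define D where "D u v w = dir_deriv (\<lambda>y. b y v w) x u" for u v w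
  have hd: "((\<lambda>y. b y v w) has_derivative (\<lambda>u. D u v w)) (at x)" for v w
    using diff[of v w] by (simp add: D_def dir_deriv_def frechet_derivative_works)
  have Deq: "D u v w = f' u"
    if "((\<lambda>y. h y) has_derivative f') (at x)" "\<And>y. y \<in> U \<Longrightarrow> h y = b y v w" for h f' u v w
  proof -
    have "((\<lambda>y. b y v w) has_derivative f') (at x)"
      by (rule has_derivative_transform_within_open[OF that(1) U]) (use that in auto)
    then show ?thesis using hd has_derivative_unique by metis
  qed
  have bl: "linear (\<lambda>v. b y v w)" "linear (b y v)" if "y \<in> U" for y v w
    using bil[OF that] by (auto simp: bilinear_def)
  have Dsym: "D u v w = D u w v" for u v w
    by (rule Deq[OF hd[of w v]]) (use sym in auto)
  have D1: "linear (\<lambda>u. D u v w)" for v w using hd has_derivative_linear by blast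
  have D3: "linear (\<lambda>w. D u v w)" for u v
  proof (rule linearI)
    show "D u v (w + w') = D u v w + D u v w'" for w w'
      by (rule Deq[OF has_derivative_add[OF hd hd]]) (simp add: linear_add[OF bl(2)])
    show "D u v (r *\<^sub>R w) = r *\<^sub>R D u v w" for r w
      by (rule Deq[OF has_derivative_scaleR_right[OF hd]]) (simp add: linear_scale[OF bl(2)])
  qed
  have D2: "linear (\<lambda>v. D u v w)" for u w using D3[of u w] Dsym[of u _ w] by simp
  note Ds = linear_add[OF D1] linear_add[OF D2] linear_add[OF D3]
     linear_scale[OF D1] linear_scale[OF D2] linear_scale[OF D3]
  define K where "K u v w = (D u v w + D v u w - D w u v) / 2" for u v w
  have "linear (K u v)" for u v
    by (rule linearI) (simp_all add: K_def Ds field_simps)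
  then have "\<exists>!p. \<forall>w. b x p w = K u v w" for u v
    using nondegenerate_represents[OF bil[OF U(2)] nd] by blast
  then obtain G where G: "\<And>u v w. b x (G u v) w = K u v w" by metis
  note bx = bl[OF U(2)]
  have uni: "p = q" if "\<And>w. b x p w = b x q w" for p q
    using nd that linear_diff[OF bx(1)] by (metis eq_iff_diff_eq_0 nondegenerate_def)
  have Gsym: "G u v = G v u" for u v
    by (rule uni) (simp add: G K_def Dsym[of _ u v])
  have Gl: "linear (G u)" for u
    by (rule linearI; rule uni)
      (simp_all add: G linear_add[OF bx(1)] linear_scale[OF bx(1)] K_def Ds field_simps)
  have Gb: "bilinear G"
    using Gl Gsym[of _] unfolding bilinear_def by (metis (no_types, lifting) ext)
  have Gm: "cov_0_2 (\<lambda>_. G) b x u v w = 0" for u v w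
    unfolding cov_0_2_def D_def[symmetric] sym[OF U(2), of v]
    by (simp add: G K_def Dsym[of _ w v] Dsym[of _ u v] Dsym[of _ u w] field_simps)
  show ?thesis
  proof (rule ex1I[of _ G])
    show "bilinear G \<and> (\<forall>u v. G u v = G v u) \<and> (\<forall>u v w. cov_0_2 (\<lambda>_. G) b x u v w = 0)"
      using Gb Gsym Gm by blast
  next
    fix H assume H: "bilinear H \<and> (\<forall>u v. H u v = H v u) \<and> (\<forall>u v w. cov_0_2 (\<lambda>_. H) b x u v w = 0)"
    have h: "D u v w = b x (H u v) w + b x (H u w) v" for u v w
      using H sym[OF U(2), of v "H u w"] unfolding cov_0_2_def D_def[symmetric]
      by (auto simp: algebra_simps)
    have hs: "H u v = H v u" for u v using H by blast
    have "b x (H u v) w = b x (G u v) w" for u v w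
      by (simp add: G K_def h hs[of v u] hs[of w u] hs[of w v])
    then have "H u v = G u v" for u v by (rule uni)
    then show "H = G" by (simp add: fun_eq_iff)
  qed
qed

end

theory Submission
  imports Defs
begin

text \<open>Since \<open>g\<close>, \<open>J\<close> and \<open>S\<close> are parallel for \<open>C = \<nabla> - S\<close>, so are \<open>\<xi>\<close> and \<open>\<zeta>\<close> (take two traces of
  the derivative of \<open>S\<close>); as \<open>X\<close> is connected, relations between them propagate from one point.
  The curvature of \<open>C\<close> annihilates every parallel tensor, which determines \<open>R(u,v)\<xi>\<close>. Inserting
  \<open>\<nabla>\<^sub>u R = S\<^sub>u \<cdot> R\<close> into the second Bianchi identity and contracting expresses \<open>R(u,v)\<xi>\<close> also by
  the Ricci tensor. If \<open>\<xi>\<close> and \<open>J\<xi>\<close> are independent, comparing the two expressions gives both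
  \<open>\<zeta> = \<lambda>\<xi>\<close> and the Ricci tensor. For \<open>\<epsilon> = 1\<close> it can happen that \<open>J\<xi> = \<plusminus>\<xi>\<close>; then the second Bianchi
  identity alone still allows a component of \<open>\<zeta>\<close> in the other eigenspace of \<open>J\<close> if \<open>\<lambda> = -1\<close>, and it is
  excluded because the curvature of \<open>C\<close> annihilates \<open>R\<close>.\<close>

section \<open>Smooth functions\<close>

text \<open>After differentiation everything is linear algebra at one point. Two facts of analysis
  make this possible: ordinary second derivatives commute, which turns parallelism into algebraic
  conditions on the curvature, and a parallel field with one zero vanishes, which makes
  \<open>\<xi>\<close> nowhere zero and \<open>\<lambda>\<close> constant. The factor dim + 2 = 1/a
  is the coefficient of \<open>g (R v w \<xi>) z\<close> in the trace of the cyclic identity. The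
  factor \<open>l * (\<epsilon> + 2 * l)\<close> comes from the value of \<open>Q\<close>, the part
  of the curvature that is quadratic in \<open>S\<close>, on \<open>\<xi>\<close>. The comparison of
  the two expressions for \<open>R u v \<xi>\<close> needs a vector with \<open>\<theta>\<close>
  equal to 1 and \<open>\<theta> \<circ> J\<close> equal to 0. Such a vector is missing exactly when
  \<open>\<xi>\<close> is an eigenvector of \<open>J\<close>. In that case the tensor in the Ricci
  formula is itself 0, so the claim is Ricci flatness for every \<open>\<lambda>\<close>, and the
  comparison cannot yield it.\<close>

lemma frechet_derivative_eqI:
  "(f has_derivative f') (at x) \<Longrightarrow> frechet_derivative f (at x) = f'"
  using frechet_derivative_at by metis

text \<open>\<open>frechet_derivative\<close> chooses from the set of all derivatives at the point;
  functions that agree near \<open>x\<close> have the same set, also when it is empty.\<close>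

lemma frechet_derivative_cong_open:
  assumes "open U" "x \<in> U" "\<And>y. y \<in> U \<Longrightarrow> f y = g y"
  shows "frechet_derivative f (at x) = frechet_derivative g (at x)"
proof -
  have "(f has_derivative f') (at x) \<longleftrightarrow> (g has_derivative f') (at x)" for f'
    using has_derivative_transform_within_open[OF _ assms(1,2), of f _ UNIV g]
      has_derivative_transform_within_open[OF _ assms(1,2), of g _ UNIV f] assms(3) by auto
  then show ?thesis by (simp add: frechet_derivative_def)
qed

lemma Ck_on_cong:
  assumes "open U" "\<And>x. x \<in> U \<Longrightarrow> f x = g x"
  shows "Ck_on k f U \<longleftrightarrow> Ck_on k g U"
  using assms(2)
proof (induction k arbitrary: f g)
  case 0
  then show ?case by (simp cong: continuous_on_cong)
next
  case (Suc k)
  have "f differentiable (at x) \<longleftrightarrow> g differentiable (at x)" if "x \<in> U" for x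
    unfolding differentiable_def
    using has_derivative_transform_within_open[OF _ assms(1) that, of f _ UNIV g]
      has_derivative_transform_within_open[OF _ assms(1) that, of g _ UNIV f] Suc.prems by auto
  moreover have "Ck_on k (\<lambda>x. frechet_derivative f (at x) v) U \<longleftrightarrow>
      Ck_on k (\<lambda>x. frechet_derivative g (at x) v) U" for v
    by (rule Suc.IH) (use frechet_derivative_cong_open[OF assms(1)] Suc.prems in metis)
  ultimately show ?case by simp
qed

text \<open>Product rules leave one factor undifferentiated; the inductions on the order below need
  that factor at the lower order.\<close>

lemma Ck_on_Suc_imp: "Ck_on (Suc k) f U \<Longrightarrow> Ck_on k f U"
proof (induction k arbitrary: f)
  case 0
  then show ?case
    by (auto intro!: differentiable_imp_continuous_on differentiable_at_imp_differentiable_on)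
next
  case (Suc k)
  show ?case
    unfolding Ck_on.simps(2)
  proof (intro conjI allI)
    show "\<forall>x\<in>U. f differentiable at x" using Suc.prems by simp
    fix v
    show "Ck_on k (\<lambda>x. frechet_derivative f (at x) v) U"
      by (rule Suc.IH) (use Suc.prems in simp)
  qed
qed

lemma Ck_on_const: "Ck_on k (\<lambda>x. c) U"
  by (induction k arbitrary: c) auto

lemma Ck_on_add:
  assumes "open U"
  shows "Ck_on k f U \<Longrightarrow> Ck_on k g U \<Longrightarrow> Ck_on k (\<lambda>x. f x + g x) U"
proof (induction k arbitrary: f g)
  case 0
  then show ?case by (auto intro: continuous_intros)
next
  case (Suc k)
  have "frechet_derivative (\<lambda>x. f x + g x) (at x) v =
      frechet_derivative f (at x) v + frechet_derivative g (at x) v" if "x \<in> U" for x v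
    using Suc.prems that
    by (subst frechet_derivative_eqI[OF has_derivative_add])
      (auto simp: frechet_derivative_works)
  then have "Ck_on k (\<lambda>x. frechet_derivative (\<lambda>x. f x + g x) (at x) v) U" for v
    using Suc by (subst Ck_on_cong[OF assms]) auto
  with Suc show ?case by auto
qed

text \<open>One induction along the product rule serves scaling, real multiplication and the inner
  product.\<close>

lemma Ck_on_bilinear:
  assumes "open U" "bounded_bilinear B"
  shows "Ck_on k f U \<Longrightarrow> Ck_on k g U \<Longrightarrow> Ck_on k (\<lambda>x. B (f x) (g x)) U"
proof (induction k arbitrary: f g)
  case 0
  then show ?case by (auto intro: bounded_bilinear.continuous_on[OF assms(2)])
next
  case (Suc k)
  have hd: "((\<lambda>x. B (f x) (g x)) has_derivative (\<lambda>v. B (f x) (frechet_derivative g (at x) v) +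
      B (frechet_derivative f (at x) v) (g x))) (at x)" if "x \<in> U" for x
    using Suc.prems that
    by (intro bounded_bilinear.FDERIV[OF assms(2)]) (auto simp: frechet_derivative_works)
  have k: "Ck_on k f U" "Ck_on k g U" using Suc.prems Ck_on_Suc_imp by auto
  have "Ck_on k (\<lambda>x. frechet_derivative (\<lambda>x. B (f x) (g x)) (at x) v) U" for v
    by (subst Ck_on_cong[OF assms(1), where g = "\<lambda>x. B (f x) (frechet_derivative g (at x) v) +
      B (frechet_derivative f (at x) v) (g x)"])
      (use Suc k in \<open>auto simp: frechet_derivative_eqI[OF hd] intro!: Ck_on_add[OF assms(1)]\<close>)
  with hd show ?case by (auto simp: differentiable_def)
qed

text \<open>The derivative of the inverse contains the inverse again, at one order less, so the
  product lemma closes the induction.\<close>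

lemma Ck_on_inverse:
  fixes f :: "_ \<Rightarrow> real"
  assumes "open U" "\<And>x. x \<in> U \<Longrightarrow> f x \<noteq> 0"
  shows "Ck_on k f U \<Longrightarrow> Ck_on k (\<lambda>x. inverse (f x)) U"
proof (induction k)
  case 0
  then show ?case using assms by (auto intro: continuous_intros)
next
  case (Suc k)
  note mult = Ck_on_bilinear[OF assms(1) bounded_bilinear_mult]
  have hd: "((\<lambda>x. inverse (f x)) has_derivative
      (\<lambda>v. - (inverse (f x) * frechet_derivative f (at x) v * inverse (f x)))) (at x)"
    if "x \<in> U" for x
    using Suc.prems that assms(2) by (intro Deriv.has_derivative_inverse) (auto simp: frechet_derivative_works)
  have k: "Ck_on k (\<lambda>x. inverse (f x)) U" using Suc Ck_on_Suc_imp by auto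
  have df: "Ck_on k (\<lambda>x. frechet_derivative f (at x) v) U" for v using Suc.prems by simp
  have "Ck_on k (\<lambda>x. frechet_derivative (\<lambda>x. inverse (f x)) (at x) v) U" for v
    using mult[OF Ck_on_const[of k "-1"] mult[OF mult[OF k df] k]]
    by (subst Ck_on_cong[OF assms(1), where
        g = "\<lambda>x. -1 * (inverse (f x) * frechet_derivative f (at x) v * inverse (f x))"])
      (simp_all add: frechet_derivative_eqI[OF hd])
  with hd show ?case by (auto simp: differentiable_def)
qed

lemma smooth_onD:
  assumes "smooth_on U f"
  shows smooth_on_continuous: "continuous_on U f"
    and smooth_on_differentiable: "x \<in> U \<Longrightarrow> f differentiable (at x)"
    and smooth_on_frechet_derivative: "smooth_on U (\<lambda>x. frechet_derivative f (at x) v)"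
proof -
  have s: "Ck_on k f U" for k using assms by (simp add: smooth_on_def)
  show "continuous_on U f" using s[of 0] by simp
  show "x \<in> U \<Longrightarrow> f differentiable (at x)" using s[of 1] by simp
  show "smooth_on U (\<lambda>x. frechet_derivative f (at x) v)"
    unfolding smooth_on_def using s[of "Suc _"] by simp
qed

lemma smooth_on_dir_deriv: "smooth_on U f \<Longrightarrow> smooth_on U (\<lambda>x. dir_deriv f x v)"
  unfolding dir_deriv_def by (rule smooth_on_frechet_derivative)

lemma smooth_on_cong:
  "open U \<Longrightarrow> (\<And>x. x \<in> U \<Longrightarrow> f x = g x) \<Longrightarrow> smooth_on U f \<longleftrightarrow> smooth_on U g"
  unfolding smooth_on_def using Ck_on_cong[of U f g] by blast

lemma smooth_on_const: "smooth_on U (\<lambda>x. c)"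
  by (simp add: smooth_on_def Ck_on_const)

lemma smooth_on_add:
  "open U \<Longrightarrow> smooth_on U f \<Longrightarrow> smooth_on U g \<Longrightarrow> smooth_on U (\<lambda>x. f x + g x)"
  by (simp add: smooth_on_def Ck_on_add)

lemma smooth_on_scaleR:
  "open U \<Longrightarrow> smooth_on U f \<Longrightarrow> smooth_on U g \<Longrightarrow> smooth_on U (\<lambda>x. f x *\<^sub>R g x)"
  by (simp add: smooth_on_def Ck_on_bilinear bounded_bilinear_scaleR)

lemma smooth_on_mult:
  fixes f g :: "_ \<Rightarrow> real"
  shows "open U \<Longrightarrow> smooth_on U f \<Longrightarrow> smooth_on U g \<Longrightarrow> smooth_on U (\<lambda>x. f x * g x)"
  by (simp add: smooth_on_def Ck_on_bilinear bounded_bilinear_mult)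

lemma smooth_on_inner:
  "open U \<Longrightarrow> smooth_on U f \<Longrightarrow> smooth_on U g \<Longrightarrow> smooth_on U (\<lambda>x. f x \<bullet> g x)"
  by (simp add: smooth_on_def Ck_on_bilinear bounded_bilinear_inner)

lemma smooth_on_divide:
  fixes f g :: "_ \<Rightarrow> real"
  assumes "open U" "smooth_on U f" "smooth_on U g" "\<And>x. x \<in> U \<Longrightarrow> g x \<noteq> 0"
  shows "smooth_on U (\<lambda>x. f x / g x)"
  unfolding divide_inverse
  by (rule smooth_on_mult) (use assms Ck_on_inverse[of U g] in \<open>auto simp: smooth_on_def\<close>)

lemma smooth_on_diff:
  assumes "open U" "smooth_on U f" "smooth_on U g"
  shows "smooth_on U (\<lambda>x. f x - g x)"
  using smooth_on_add[OF assms(1,2) smooth_on_scaleR[OF assms(1) smooth_on_const[of _ "-1"] assms(3)]]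
  by simp

lemma smooth_on_sum:
  assumes "open U" "\<And>i. i \<in> I \<Longrightarrow> smooth_on U (f i)"
  shows "smooth_on U (\<lambda>x. \<Sum>i\<in>I. f i x)"
  using assms(2)
  by (induction I rule: infinite_finite_induct) (auto intro!: smooth_on_const smooth_on_add assms(1))

lemma smooth_on_prod:
  fixes f :: "'i \<Rightarrow> _ \<Rightarrow> real"
  assumes "open U" "\<And>i. i \<in> I \<Longrightarrow> smooth_on U (f i)"
  shows "smooth_on U (\<lambda>x. \<Prod>i\<in>I. f i x)"
  using assms(2)
  by (induction I rule: infinite_finite_induct) (auto intro!: smooth_on_const smooth_on_mult assms(1))

lemma linear_sum_axis:
  assumes "linear f"
  shows "f x = (\<Sum>i\<in>UNIV. (x $ i) *\<^sub>R f (axis i 1))"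
proof -
  have "f x = f (\<Sum>i\<in>UNIV. (x $ i) *\<^sub>R axis i 1)"
    by (simp add: basis_expansion flip: scalar_mult_eq_scaleR)
  then show ?thesis by (simp add: linear_sum[OF assms] linear_scale[OF assms])
qed

lemma smooth_on_component:
  fixes h :: "_ \<Rightarrow> real^'n::finite"
  assumes "open U" "smooth_on U h"
  shows "smooth_on U (\<lambda>x. h x $ i)"
  using smooth_on_inner[OF assms smooth_on_const[of _ "axis i 1"]] by (simp add: cart_eq_inner_axis)

lemma smooth_on_vec:
  fixes h :: "_ \<Rightarrow> real^'n::finite"
  assumes "open U" "\<And>i. smooth_on U (\<lambda>x. h x $ i)"
  shows "smooth_on U h"
proof -
  have "h = (\<lambda>x. \<Sum>i\<in>UNIV. (h x $ i) *\<^sub>R axis i 1)"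
    using linear_sum_axis[of "\<lambda>x. x"] by (auto simp: fun_eq_iff linear_iff)
  moreover have "smooth_on U (\<lambda>x. \<Sum>i\<in>UNIV. (h x $ i) *\<^sub>R axis i (1::real))"
    using assms by (intro smooth_on_sum smooth_on_scaleR smooth_on_const)
  ultimately show ?thesis by simp
qed

text \<open>Tensor fields are smooth by definition on constant arguments. Expanding a moving
  argument in the standard basis gives a finite sum of smooth products.\<close>

lemma smooth_on_apply:
  fixes T :: "_ \<Rightarrow> real^'n::finite \<Rightarrow> _"
  assumes "open U" "\<And>y. y \<in> U \<Longrightarrow> linear (T y)" "\<And>a. smooth_on U (\<lambda>y. T y a)" "smooth_on U h"
  shows "smooth_on U (\<lambda>y. T y (h y))"
proof -
  have "smooth_on U (\<lambda>y. \<Sum>i\<in>UNIV. (h y $ i) *\<^sub>R T y (axis i 1))"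
    using assms by (intro smooth_on_sum smooth_on_scaleR smooth_on_component)
  moreover have "T y (h y) = (\<Sum>i\<in>UNIV. (h y $ i) *\<^sub>R T y (axis i 1))" if "y \<in> U" for y
    by (rule linear_sum_axis[OF assms(2)[OF that]])
  ultimately show ?thesis by (subst smooth_on_cong[OF assms(1)])
qed

section \<open>Rules for directional derivatives\<close>

lemma dir_deriv_apply:
  fixes T :: "real^'m::finite \<Rightarrow> real^'n::finite \<Rightarrow> 'c::real_normed_vector"
  assumes "open U" "x \<in> U" "\<And>y. y \<in> U \<Longrightarrow> linear (T y)"
    and "\<And>a. (\<lambda>y. T y a) differentiable (at x)" "h differentiable (at x)"
  shows "dir_deriv (\<lambda>y. T y (h y)) x u = dir_deriv (\<lambda>y. T y (h x)) x u + T x (dir_deriv h x u)"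
proof -
  let ?h' = "\<lambda>u. frechet_derivative h (at x) u"
  let ?T' = "\<lambda>a u. frechet_derivative (\<lambda>y. T y a) (at x) u"
  have h: "(h has_derivative ?h') (at x)" and T: "((\<lambda>y. T y a) has_derivative ?T' a) (at x)" for a
    using assms(4,5) by (auto simp: frechet_derivative_works)
  have hi: "((\<lambda>y. h y $ i) has_derivative (\<lambda>u. ?h' u $ i)) (at x)" for i
    using bounded_linear.has_derivative[OF bounded_linear_vec_nth h] .
  have s: "((\<lambda>y. \<Sum>i\<in>UNIV. (w y $ i) *\<^sub>R T y (axis i 1)) has_derivative
     (\<lambda>u. \<Sum>i\<in>UNIV. (w x $ i) *\<^sub>R ?T' (axis i 1) u + (w' u $ i) *\<^sub>R T x (axis i 1))) (at x)"
    if "\<And>i. ((\<lambda>y. w y $ i) has_derivative (\<lambda>u. w' u $ i)) (at x)" for w w'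
    by (intro has_derivative_sum has_derivative_scaleR that T)
  have e: "frechet_derivative (\<lambda>y. T y (w y)) (at x) u =
      (\<Sum>i\<in>UNIV. (w x $ i) *\<^sub>R ?T' (axis i 1) u + (w' u $ i) *\<^sub>R T x (axis i 1))"
    if "\<And>i. ((\<lambda>y. w y $ i) has_derivative (\<lambda>u. w' u $ i)) (at x)" for w w'
  proof -
    have "((\<lambda>y. T y (w y)) has_derivative
      (\<lambda>u. \<Sum>i\<in>UNIV. (w x $ i) *\<^sub>R ?T' (axis i 1) u + (w' u $ i) *\<^sub>R T x (axis i 1))) (at x)"
      by (rule has_derivative_transform_within_open[OF s[OF that] assms(1,2)])
        (simp add: linear_sum_axis[OF assms(3)])
    then show ?thesis by (simp add: frechet_derivative_eqI)
  qed
  show ?thesis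
    \<comment> \<open>\<open>e\<close> is used twice: for the moving argument \<open>h\<close>, and
      for the constant argument \<open>h x\<close> with derivative 0. The two sums differ by
      \<open>T x\<close> applied to the derivative of \<open>h\<close>.\<close>
    unfolding dir_deriv_def e[OF hi] e[of "\<lambda>_. h x" "\<lambda>_. 0", simplified]
    by (simp add: sum.distrib linear_sum_axis[OF assms(3)[OF assms(2)], of "?h' u"])
qed

lemma dir_deriv_cong:
  "open U \<Longrightarrow> x \<in> U \<Longrightarrow> (\<And>y. y \<in> U \<Longrightarrow> f y = h y) \<Longrightarrow> dir_deriv f x u = dir_deriv h x u"
  unfolding dir_deriv_def by (subst frechet_derivative_cong_open[of U x f h]) auto

lemma linear_dir_deriv: "f differentiable (at x) \<Longrightarrow> linear (dir_deriv f x)"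
  using linear_frechet_derivative[of f "at x"] by (simp add: dir_deriv_def[abs_def])

lemma dir_deriv_add:
  "f differentiable (at x) \<Longrightarrow> h differentiable (at x) \<Longrightarrow>
   dir_deriv (\<lambda>y. f y + h y) x u = dir_deriv f x u + dir_deriv h x u"
  unfolding dir_deriv_def frechet_derivative_works
  by (subst frechet_derivative_eqI[OF has_derivative_add]) auto

lemma dir_deriv_diff:
  "f differentiable (at x) \<Longrightarrow> h differentiable (at x) \<Longrightarrow>
   dir_deriv (\<lambda>y. f y - h y) x u = dir_deriv f x u - dir_deriv h x u"
  unfolding dir_deriv_def frechet_derivative_works
  by (subst frechet_derivative_eqI[OF has_derivative_diff]) auto

lemma dir_deriv_cmul:
  "f differentiable (at x) \<Longrightarrow> dir_deriv (\<lambda>y. c *\<^sub>R f y) x u = c *\<^sub>R dir_deriv f x u"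
  unfolding dir_deriv_def frechet_derivative_works
  by (subst frechet_derivative_eqI[OF has_derivative_scaleR_right]) auto

lemma dir_deriv_scaleR:
  "f differentiable (at x) \<Longrightarrow> h differentiable (at x) \<Longrightarrow>
   dir_deriv (\<lambda>y. f y *\<^sub>R h y) x u = f x *\<^sub>R dir_deriv h x u + dir_deriv f x u *\<^sub>R h x"
  unfolding dir_deriv_def frechet_derivative_works
  by (subst frechet_derivative_eqI[OF has_derivative_scaleR]) auto

section \<open>Symmetry of second derivatives\<close>

lemma mixed_difference_mean_value:
  fixes f :: "'b::real_normed_vector \<Rightarrow> real"
  assumes "open U" "Ck_on 2 f U" and h: "h > 0"
    and U: "\<And>s t. 0 \<le> s \<Longrightarrow> s \<le> h \<Longrightarrow> 0 \<le> t \<Longrightarrow> t \<le> h \<Longrightarrow> x + s *\<^sub>R u + t *\<^sub>R v \<in> U"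
  obtains s t where "0 < s" "s < h" "0 < t" "t < h"
    "f (x + h *\<^sub>R u + h *\<^sub>R v) - f (x + h *\<^sub>R u) - f (x + h *\<^sub>R v) + f x =
      h\<^sup>2 * frechet_derivative (\<lambda>y. frechet_derivative f (at y) u) (at (x + s *\<^sub>R u + t *\<^sub>R v)) v"
proof -
  have f1: "f differentiable (at y)" and
    f2: "(\<lambda>y. frechet_derivative f (at y) u) differentiable (at y)" if "y \<in> U" for y
    using assms(2) that by (auto simp: numeral_2_eq_2)
  have line: "((\<lambda>s. q (y + s *\<^sub>R w)) has_real_derivative frechet_derivative q (at (y + s *\<^sub>R w)) w) (at s)"
    if "q differentiable (at (y + s *\<^sub>R w))" for q :: "'b \<Rightarrow> real" and y s w
  proof -
    have "(q has_derivative frechet_derivative q (at (y + s *\<^sub>R w))) (at (y + s *\<^sub>R w))"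
      using that by (simp add: frechet_derivative_works)
    moreover have "((\<lambda>s. y + s *\<^sub>R w) has_derivative (\<lambda>r. r *\<^sub>R w)) (at s)"
      by (auto intro!: derivative_eq_intros)
    ultimately have "((\<lambda>s. q (y + s *\<^sub>R w)) has_derivative
        (\<lambda>r. frechet_derivative q (at (y + s *\<^sub>R w)) (r *\<^sub>R w))) (at s)"
      using diff_chain_at[of "\<lambda>s. y + s *\<^sub>R w"] by (simp add: o_def)
    then show ?thesis
      by (simp add: has_field_derivative_def linear_scale[OF linear_frechet_derivative[OF that]]
          mult.commute[of _ "frechet_derivative q _ w"])
  qed
  \<comment> \<open>The second difference is the increment of \<open>G\<close> over [0, h]. The mean
    value theorem is applied to \<open>G\<close> and then, along \<open>v\<close>, to the derivative
    of \<open>f\<close> in direction \<open>u\<close>.\<close>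
  define G where "G s = f (x + h *\<^sub>R v + s *\<^sub>R u) - f (x + s *\<^sub>R u)" for s
  have "DERIV G s :> frechet_derivative f (at (x + h *\<^sub>R v + s *\<^sub>R u)) u -
      frechet_derivative f (at (x + s *\<^sub>R u)) u" if "0 \<le> s" "s \<le> h" for s
    unfolding G_def
    by (intro derivative_intros line f1) (use U[OF that, of h] U[OF that, of 0] h in \<open>auto simp: ac_simps\<close>)
  from MVT2[OF h this] obtain s where s: "0 < s" "s < h" "G h - G 0 =
      h * (frechet_derivative f (at (x + h *\<^sub>R v + s *\<^sub>R u)) u - frechet_derivative f (at (x + s *\<^sub>R u)) u)"
    by auto
  have "((\<lambda>t. frechet_derivative f (at (x + s *\<^sub>R u + t *\<^sub>R v)) u) has_real_derivative
      frechet_derivative (\<lambda>y. frechet_derivative f (at y) u) (at (x + s *\<^sub>R u + t *\<^sub>R v)) v) (at t)"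
    if "0 \<le> t" "t \<le> h" for t
    by (rule line, rule f2) (use U that s in auto)
  from MVT2[OF h this] obtain t where t: "0 < t" "t < h"
     "frechet_derivative f (at (x + s *\<^sub>R u + h *\<^sub>R v)) u - frechet_derivative f (at (x + s *\<^sub>R u)) u =
      h * frechet_derivative (\<lambda>y. frechet_derivative f (at y) u) (at (x + s *\<^sub>R u + t *\<^sub>R v)) v"
    by auto
  show thesis
    by (rule that[OF s(1,2) t(1,2)])
      (use s(3) t(3) in \<open>simp add: G_def algebra_simps power2_eq_square\<close>)
qed

lemma frechet_derivative_commute_real:
  fixes f :: "'b::real_normed_vector \<Rightarrow> real"
  assumes "open U" "Ck_on 2 f U" "x \<in> U"
  shows "frechet_derivative (\<lambda>y. frechet_derivative f (at y) u) (at x) v =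
    frechet_derivative (\<lambda>y. frechet_derivative f (at y) v) (at x) u" (is "?A x = ?B x")
proof (rule ccontr)
  assume ne: "?A x \<noteq> ?B x"
  \<comment> \<open>Half the gap: values within \<open>e\<close> of \<open>?A x\<close> and of
    \<open>?B x\<close> cannot be equal.\<close>
  define e where "e = \<bar>?A x - ?B x\<bar> / 2"
  have e: "e > 0" using ne by (simp add: e_def)
  have "continuous_on U ?A" "continuous_on U ?B" using assms(2) by (auto simp: numeral_2_eq_2)
  then have c: "isCont ?A x" "isCont ?B x"
    using assms by (auto simp: continuous_on_eq_continuous_at)
  obtain d1 where d1: "d1 > 0" "ball x d1 \<subseteq> U" using assms open_contains_ball by blast
  obtain d2 where d2: "d2 > 0" "\<And>y. dist y x < d2 \<Longrightarrow> \<bar>?A y - ?A x\<bar> < e"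
    using c(1) e unfolding continuous_at_eps_delta dist_real_def by meson
  obtain d3 where d3: "d3 > 0" "\<And>y. dist y x < d3 \<Longrightarrow> \<bar>?B y - ?B x\<bar> < e"
    using c(2) e unfolding continuous_at_eps_delta dist_real_def by meson
  define d where "d = min d1 (min d2 d3)"
  \<comment> \<open>The parallelogram spanned by \<open>h *\<^sub>R u\<close> and
    \<open>h *\<^sub>R v\<close> then stays within distance \<open>d\<close> of \<open>x\<close>;
    the summand 1 covers \<open>u = v = 0\<close>.\<close>
  define h where "h = d / (2 * (norm u + norm v + 1))"
  have d: "d > 0" using d1 d2 d3 by (simp add: d_def)
  have p: "norm u + norm v + 1 > 0" by (simp add: add_nonneg_pos)
  have h: "h > 0" using d p by (simp add: h_def)
  have near: "dist (x + s *\<^sub>R u + t *\<^sub>R v) x < d" if "0 \<le> s" "s \<le> h" "0 \<le> t" "t \<le> h" for s t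
  proof -
    have "dist (x + s *\<^sub>R u + t *\<^sub>R v) x = norm (s *\<^sub>R u + t *\<^sub>R v)"
      by (simp add: dist_norm algebra_simps)
    also have "\<dots> \<le> s * norm u + t * norm v"
      by (rule order_trans[OF norm_triangle_ineq]) (use that in simp)
    also have "\<dots> \<le> h * norm u + h * norm v"
      by (intro add_mono mult_right_mono) (use that in auto)
    also have "\<dots> < h * (2 * (norm u + norm v + 1))"
      using h by (simp add: algebra_simps add_nonneg_pos)
    also have "\<dots> = d" using p by (simp add: h_def)
    finally show ?thesis .
  qed
  have U: "x + s *\<^sub>R u + t *\<^sub>R v \<in> U" if "0 \<le> s" "s \<le> h" "0 \<le> t" "t \<le> h" for s t
    using near[OF that] d1 by (auto simp: d_def dist_commute)
  have U': "x + s *\<^sub>R v + t *\<^sub>R u \<in> U" if "0 \<le> s" "s \<le> h" "0 \<le> t" "t \<le> h" for s t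
    using U[OF that(3,4,1,2)] by (simp add: ac_simps)
  obtain s t where st: "0 < s" "s < h" "0 < t" "t < h"
    "f (x + h *\<^sub>R u + h *\<^sub>R v) - f (x + h *\<^sub>R u) - f (x + h *\<^sub>R v) + f x = h\<^sup>2 * ?A (x + s *\<^sub>R u + t *\<^sub>R v)"
    by (rule mixed_difference_mean_value[OF assms(1,2) h U])
  obtain s' t' where st': "0 < s'" "s' < h" "0 < t'" "t' < h"
    "f (x + h *\<^sub>R v + h *\<^sub>R u) - f (x + h *\<^sub>R v) - f (x + h *\<^sub>R u) + f x = h\<^sup>2 * ?B (x + s' *\<^sub>R v + t' *\<^sub>R u)"
    by (rule mixed_difference_mean_value[OF assms(1,2) h U'])
  \<comment> \<open>Both orders of differentiation start from the same second difference.\<close>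
  have comm: "x + h *\<^sub>R v + h *\<^sub>R u = x + h *\<^sub>R u + h *\<^sub>R v" by simp
  have "h\<^sup>2 * ?A (x + s *\<^sub>R u + t *\<^sub>R v) = h\<^sup>2 * ?B (x + s' *\<^sub>R v + t' *\<^sub>R u)"
    using st(5) st'(5)[unfolded comm] by linarith
  then have "?A (x + s *\<^sub>R u + t *\<^sub>R v) = ?B (x + s' *\<^sub>R v + t' *\<^sub>R u)"
    using h by simp
  moreover have "\<bar>?A (x + s *\<^sub>R u + t *\<^sub>R v) - ?A x\<bar> < e"
    by (rule d2(2)) (use near[of s t] st in \<open>simp add: d_def\<close>)
  moreover have "\<bar>?B (x + s' *\<^sub>R v + t' *\<^sub>R u) - ?B x\<bar> < e"
    by (rule d3(2)) (use near[of t' s'] st' in \<open>simp add: d_def ac_simps\<close>)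
  ultimately show False unfolding e_def by argo
qed

lemma dir_deriv_inner:
  assumes "f differentiable (at x)"
  shows "dir_deriv (\<lambda>y. f y \<bullet> c) x u = dir_deriv f x u \<bullet> c"
  using assms unfolding dir_deriv_def frechet_derivative_works
  by (subst frechet_derivative_eqI[OF has_derivative_inner_left]) auto

text \<open>The inner product with a fixed \<open>c\<close> commutes with directional derivatives,
  which reduces the claim to real functions.\<close>

lemma dir_deriv_commute:
  fixes f :: "real^'n::finite \<Rightarrow> 'c::real_inner"
  assumes "open U" "smooth_on U f" "x \<in> U"
  shows "dir_deriv (\<lambda>y. dir_deriv f y u) x v = dir_deriv (\<lambda>y. dir_deriv f y v) x u"
proof (rule vector_eq_rdot[THEN iffD1], rule allI)
  fix c
  have s: "smooth_on U (\<lambda>y. f y \<bullet> c)" by (intro smooth_on_inner assms smooth_on_const)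
  have i: "dir_deriv (\<lambda>y. dir_deriv (\<lambda>y. f y \<bullet> c) y w) x w' = dir_deriv (\<lambda>y. dir_deriv f y w) x w' \<bullet> c"
    for w w'
    unfolding dir_deriv_inner[OF smooth_on_differentiable[OF smooth_on_dir_deriv[OF assms(2)] assms(3)], symmetric]
    by (rule dir_deriv_cong[OF assms(1,3)])
      (rule dir_deriv_inner[OF smooth_on_differentiable[OF assms(2)]])
  show "dir_deriv (\<lambda>y. dir_deriv f y u) x v \<bullet> c = dir_deriv (\<lambda>y. dir_deriv f y v) x u \<bullet> c"
    unfolding i[symmetric] unfolding dir_deriv_def
    by (rule frechet_derivative_commute_real[OF assms(1) _ assms(3)]) (use s in \<open>simp add: smooth_on_def\<close>)
qed

section \<open>Traces and curvature tensors of Kaehler type\<close>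

abbreviation tr :: "(real^'n \<Rightarrow> real^'n) \<Rightarrow> real" where
  "tr F \<equiv> trace (matrix F)"

lemma tr_eq_sum: "tr F = (\<Sum>i\<in>UNIV. F (axis i 1) $ i)"
  by (simp add: trace_def matrix_def)

lemma tr_add: "tr (\<lambda>u. F u + G u) = tr F + tr G"
  and tr_diff: "tr (\<lambda>u. F u - G u) = tr F - tr G"
  and tr_minus: "tr (\<lambda>u. - F u) = - tr F"
  and tr_scaleR: "tr (\<lambda>u. c *\<^sub>R F u) = c * tr F"
  by (simp_all add: tr_eq_sum sum.distrib sum_subtractf sum_negf sum_distrib_left)

lemma tr_zero: "tr (\<lambda>u. 0) = 0"
  by (simp add: tr_eq_sum)

lemma tr_ident: "tr (\<lambda>u. u :: real^'n::finite) = real CARD('n)"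
  by (simp add: tr_eq_sum axis_def)

lemma tr_rank_one:
  assumes "linear f"
  shows "tr (\<lambda>u. f u *\<^sub>R v) = f v"
  using linear_sum_axis[OF assms, of v] by (simp add: tr_eq_sum mult.commute)

lemma tr_comp_commute:
  assumes "linear F" "linear G"
  shows "tr (\<lambda>u. F (G u)) = tr (\<lambda>u. G (F u))"
  using trace_mul_sym[of "matrix F" "matrix G"] matrix_compose[OF assms] matrix_compose[OF assms(2,1)]
  by (simp add: o_def)

text \<open>\<open>d\<close> is the basis dual to the standard one with respect to
  \<open>\<beta>\<close>. Its coefficient matrix is symmetric, so the double sum can be read from
  either side; this works for indefinite forms too.\<close>

lemma tr_adjoint:
  assumes "bilinear \<beta>" "nondegenerate \<beta>" "\<And>u v. \<beta> u v = \<beta> v u"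
    and "linear F" "linear G" and adj: "\<And>u v. \<beta> (F u) v = \<beta> u (G v)"
  shows "tr F = tr G"
proof -
  have lin: "linear (\<lambda>w. \<beta> w z)" "linear (\<beta> w)" for w z
    using assms(1) by (auto simp: bilinear_def)
  have "linear (\<lambda>v::real^'n. v $ i)" for i by (simp add: linear_iff)
  then have "\<exists>d. \<forall>v. \<beta> d v = v $ i" for i
    using nondegenerate_represents[OF assms(1,2)] by blast
  then obtain d where d: "\<And>i v. \<beta> (d i) v = v $ i" by metis
  have dd: "d i $ j = d j $ i" for i j using d assms(3) by metis
  have "tr F = (\<Sum>i\<in>UNIV. \<beta> (axis i 1) (G (d i)))"
    by (simp add: tr_eq_sum assms(3)[of "d _" "F _"] adj flip: d)
  also have "\<dots> = (\<Sum>i\<in>UNIV. \<Sum>j\<in>UNIV. d i $ j * \<beta> (axis i 1) (G (axis j 1)))"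
    by (subst linear_sum_axis[OF linear_compose[OF assms(5) lin(2), unfolded o_def]]) simp
  also have "\<dots> = (\<Sum>j\<in>UNIV. \<Sum>i\<in>UNIV. d j $ i * \<beta> (axis i 1) (G (axis j 1)))"
    by (subst sum.swap) (simp add: dd)
  also have "\<dots> = (\<Sum>j\<in>UNIV. \<beta> (d j) (G (axis j 1)))"
    by (intro sum.cong refl, subst (2) linear_sum_axis[OF lin(1)]) simp
  finally show ?thesis by (simp add: d tr_eq_sum)
qed

section \<open>Linear algebra of hermitian and para-hermitian spaces\<close>

locale hermitian_space =
  fixes \<epsilon> :: real and g :: "'n::finite form2" and J :: "'n endo"
  assumes eps: "\<epsilon> \<in> {-1, 1}"
    and bilinear_g: "bilinear g" and g_commute: "g u v = g v u" and nondegenerate_g: "nondegenerate g"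
    and linear_J: "linear J" and J_skew: "g (J u) v = - g u (J v)" and J_J: "J (J u) = \<epsilon> *\<^sub>R u"
begin

lemma eps_sq [simp]: "\<epsilon> * \<epsilon> = 1" "\<epsilon> * (\<epsilon> * c) = c"
  using eps by auto

lemma linear_g: "linear (g u)" "linear (\<lambda>u. g u v)"
  using bilinear_g by (auto simp: bilinear_def)

lemmas g_simps = linear_add[OF linear_g(1)] linear_add[OF linear_g(2)]
  linear_diff[OF linear_g(1)] linear_diff[OF linear_g(2)]
  linear_scale[OF linear_g(1)] linear_scale[OF linear_g(2)]
  linear_neg[OF linear_g(1)] linear_neg[OF linear_g(2)] linear_0[OF linear_g(1)] linear_0[OF linear_g(2)]

lemmas J_simps = linear_add[OF linear_J] linear_diff[OF linear_J] linear_scale[OF linear_J]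
  linear_neg[OF linear_J] linear_0[OF linear_J] J_J

lemma g_eqI: "(\<And>z. g x z = g y z) \<Longrightarrow> x = y"
  using nondegenerate_g by (metis eq_iff_diff_eq_0 linear_diff[OF linear_g(2)] nondegenerate_def)

lemma tr_J: "tr J = 0"
proof -
  have "tr J = tr (\<lambda>u. - J u)"
    by (rule tr_adjoint[OF bilinear_g nondegenerate_g g_commute linear_J linear_compose_neg[OF linear_J]])
      (simp add: J_skew g_simps)
  then show ?thesis using tr_minus[of J] by linarith
qed

text \<open>Covariant differentiation of the structure tensor differentiates only \<open>\<xi>\<close> and \<open>\<zeta>\<close>, hence they are
  arguments here.\<close>

definition lin_type :: "real^'n \<Rightarrow> real^'n \<Rightarrow> 'n bil" where
  "lin_type \<xi> \<zeta> u v = g u v *\<^sub>R \<xi> - g \<xi> v *\<^sub>R u + (\<epsilon> * g u (J v)) *\<^sub>R J \<xi>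
     - (\<epsilon> * g \<xi> (J v)) *\<^sub>R J u - (2 * g \<zeta> (J u)) *\<^sub>R J v"

text \<open>The trace over \<open>u\<close>, and the trace over \<open>v\<close> after replacing
  \<open>v\<close> by \<open>J v\<close>, give the system
  \<open>n \<xi> + 2 \<epsilon> \<zeta> = 0\<close>,
  \<open>2 \<xi> + \<epsilon> n \<zeta> = 0\<close>, where n is the dimension. Its determinant
  \<open>\<epsilon> (n^2 - 4)\<close> is nonzero for n > 2.\<close>

lemma lin_type_eq_0D:
  assumes "CARD('n) > 2" and z: "\<And>u v. lin_type \<xi> \<zeta> u v = 0"
  shows "\<xi> = 0" "\<zeta> = 0"
proof -
  let ?n = "real CARD('n)"
  have lin: "linear (\<lambda>u. g u a)" "linear (\<lambda>u. g a u)" "linear (\<lambda>u. g a (J u))" "linear (\<lambda>u. c * g a (J u))"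
    "linear (\<lambda>u. c * g u (J a))" for a c
    by (simp_all add: linear_iff g_simps J_simps algebra_simps)
  have "g (?n *\<^sub>R \<xi> + (2 * \<epsilon>) *\<^sub>R \<zeta>) v = 0" for v
  proof -
    have "tr (\<lambda>u. lin_type \<xi> \<zeta> u v) = 0" by (simp add: z tr_zero)
    then show ?thesis
      unfolding lin_type_def
      by (simp add: tr_add tr_diff tr_scaleR tr_rank_one[OF lin(1)] tr_rank_one[OF lin(4)]
          tr_rank_one[OF lin(5)] tr_ident tr_J J_skew J_simps g_simps algebra_simps)
  qed
  then have a: "?n *\<^sub>R \<xi> + (2 * \<epsilon>) *\<^sub>R \<zeta> = 0"
    using g_eqI[of _ 0] by (simp add: g_simps)
  have "g (2 *\<^sub>R \<xi> + (\<epsilon> * ?n) *\<^sub>R \<zeta>) (J u) = 0" for u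
  proof -
    have "tr (\<lambda>v. lin_type \<xi> \<zeta> u (J v)) = 0" by (simp add: z tr_zero)
    then show ?thesis
      unfolding lin_type_def J_J
      by (simp add: tr_add tr_diff tr_scaleR tr_rank_one[OF lin(2)] tr_rank_one[OF lin(3)]
          tr_ident J_skew J_simps g_simps algebra_simps flip: g_commute[of \<xi> u])
         (use J_skew[of u \<xi>] g_commute[of \<xi> "J u"] in \<open>simp add: algebra_simps\<close>)
  qed
  from this[of "J _"] have "g (2 *\<^sub>R \<xi> + (\<epsilon> * ?n) *\<^sub>R \<zeta>) u = 0" for u
    using eps by (auto simp: J_J g_simps)
  then have b: "2 *\<^sub>R \<xi> + (\<epsilon> * ?n) *\<^sub>R \<zeta> = 0"
    using g_eqI[of _ 0] by (simp add: g_simps)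
  have "\<epsilon> *\<^sub>R (?n *\<^sub>R (?n *\<^sub>R \<xi> + (2 * \<epsilon>) *\<^sub>R \<zeta>) - 2 *\<^sub>R (2 *\<^sub>R \<xi> + (\<epsilon> * ?n) *\<^sub>R \<zeta>)) =
      (\<epsilon> * (?n * ?n - 4)) *\<^sub>R \<xi>"
    by (simp add: algebra_simps)
  moreover have "?n * ?n > 2 * 2" using assms(1) by (intro mult_strict_mono) auto
  ultimately show "\<xi> = 0" using eps by (auto simp: a b)
  then show "\<zeta> = 0" using a eps by auto
qed

end

section \<open>Curvature tensors of Kaehler type at a point\<close>

locale kaehler_curvature = hermitian_space \<epsilon> g J
  for \<epsilon> :: real and g :: "'n::finite form2" and J :: "'n endo" +
  fixes R :: "'n tril"
  assumes R_linear: "linear (\<lambda>u. R u v w)" "linear (\<lambda>v. R u v w)" "linear (\<lambda>w. R u v w)"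
    and R_anti: "R u v w = - R v u w"
    and bianchi: "R u v w + R v w u + R w u v = 0"
    and R_skew: "g (R u v w) z = - g (R u v z) w"
    and R_J: "R u v (J w) = J (R u v w)"
begin

lemmas R_simps = linear_add[OF R_linear(1)] linear_add[OF R_linear(2)] linear_add[OF R_linear(3)]
  linear_diff[OF R_linear(1)] linear_diff[OF R_linear(2)] linear_diff[OF R_linear(3)]
  linear_scale[OF R_linear(1)] linear_scale[OF R_linear(2)] linear_scale[OF R_linear(3)]
  linear_neg[OF R_linear(1)] linear_neg[OF R_linear(2)] linear_neg[OF R_linear(3)]
  linear_0[OF R_linear(1)] linear_0[OF R_linear(2)] linear_0[OF R_linear(3)]

text \<open>The classical octahedron argument: four instances of the first Bianchi identity are
  added up and reduced by the two skew symmetries.\<close>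

lemma R_pair: "g (R u v w) z = g (R w z u) v"
proof -
  define K where "K a b c d = g (R a b c) d" for a b c d
  have 1: "K a b c d = - K b a c d" for a b c d
    using R_anti[of a b c] by (simp add: K_def g_simps)
  have 2: "K a b c d = - K a b d c" for a b c d
    unfolding K_def by (rule R_skew)
  have 3: "K a b c d + K b c a d + K c a b d = 0" for a b c d
    using arg_cong[OF bianchi[of a b c], of "\<lambda>x. g x d"] by (simp add: K_def g_simps)
  have "K u v w z = K w z u v"
    using 3[of u v w z] 3[of v w z u] 3[of w z u v] 3[of z u v w]
      2[of v w z u] 2[of w z v u] 1[of z v w u] 1[of z u w v] 2[of u z w v] 1[of u w z v] 2[of w u z v]
      1[of z u v w] 2[of u v z w] 2[of v z u w]
    by linarith
  then show ?thesis by (simp add: K_def)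
qed

text \<open>Pair symmetry carries the commutation of \<open>R u v\<close> with \<open>J\<close> over
  to the first two arguments.\<close>

lemma R_J_left: "R (J u) v w = - R u (J v) w"
proof (rule g_eqI)
  fix z
  have "g (R (J u) v w) z = g (R w z (J u)) v" by (rule R_pair)
  also have "\<dots> = - g (R w z u) (J v)" by (simp add: R_J J_skew)
  also have "\<dots> = - g (R u (J v) w) z" by (simp add: R_pair[of u])
  finally show "g (R (J u) v w) z = g (- R u (J v) w) z" by (simp add: g_simps)
qed

definition ric :: "'n form2" where
  "ric v w = tr (\<lambda>u. R u v w)"

lemma bilinear_ric: "linear (ric v)" "linear (\<lambda>v. ric v w)"
  by (auto simp: linear_iff ric_def R_simps tr_add tr_scaleR)

lemmas ric_simps = linear_add[OF bilinear_ric(1)] linear_add[OF bilinear_ric(2)]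
  linear_diff[OF bilinear_ric(1)] linear_diff[OF bilinear_ric(2)]
  linear_scale[OF bilinear_ric(1)] linear_scale[OF bilinear_ric(2)]
  linear_neg[OF bilinear_ric(1)] linear_neg[OF bilinear_ric(2)]
  linear_0[OF bilinear_ric(1)] linear_0[OF bilinear_ric(2)]

text \<open>By pair symmetry the maps \<open>\<lambda>u. R u v w\<close> and
  \<open>\<lambda>u. R u w v\<close> are adjoint to each other, so their traces agree.\<close>

lemma ric_commute: "ric v w = ric w v"
  unfolding ric_def
proof (rule tr_adjoint[OF bilinear_g nondegenerate_g g_commute R_linear(1) R_linear(1)])
  fix a b
  have "g (R a v w) b = g (R w b a) v" by (rule R_pair)
  also have "\<dots> = g (R b w v) a" using R_anti[of w b a] R_skew[of b w a v] by (simp add: g_simps)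
  finally show "g (R a v w) b = g a (R b w v)" by (simp add: g_commute)
qed

lemma ric_J_left: "ric (J v) w = - ric v (J w)"
proof -
  have "ric v (J w) = tr (\<lambda>u. J (R u v w))" by (simp add: ric_def R_J)
  also have "\<dots> = tr (\<lambda>u. R (J u) v w)" by (rule tr_comp_commute[OF linear_J R_linear(1)])
  also have "\<dots> = - ric (J v) w" by (simp add: ric_def R_J_left tr_minus)
  finally show ?thesis by simp
qed

lemma tr_R2: "tr (\<lambda>u. R v u w) = - ric v w"
  by (subst R_anti) (simp add: ric_def tr_minus)

end

section \<open>Degenerate structures at a point\<close>

text \<open>The arithmetic simprocs collect \<open>v + v\<close> to \<open>2 * v\<close> in the componentwise ring structure of vectors.\<close>

lemma numeral_times_vec [simp]:
  "numeral k * v = numeral k *\<^sub>R v" "v * numeral k = numeral k *\<^sub>R v" for v :: "real^'n"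
  by (simp_all add: vec_eq_iff numeral_index)

text \<open>\<open>second_bianchi\<close> contains no derivative: the derivative of \<open>R\<close>
  along \<open>u\<close> has been replaced by the action of \<open>S u\<close> on \<open>R\<close>
  as a derivation.\<close>

locale degenerate_structure = kaehler_curvature \<epsilon> g J R
  for \<epsilon> :: real and g :: "'n::finite form2" and J :: "'n endo" and R :: "'n tril" +
  fixes \<xi> \<zeta> :: "real^'n"
  assumes xi_null: "g \<xi> \<xi> = 0" and xi_nonzero: "\<xi> \<noteq> 0" and dim: "CARD('n) \<ge> 4"
    and second_bianchi:
      "(lin_type \<xi> \<zeta> u (R v w z) - R (lin_type \<xi> \<zeta> u v) w z
          - R v (lin_type \<xi> \<zeta> u w) z - R v w (lin_type \<xi> \<zeta> u z))
       + (lin_type \<xi> \<zeta> v (R w u z) - R (lin_type \<xi> \<zeta> v w) u z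
          - R w (lin_type \<xi> \<zeta> v u) z - R w u (lin_type \<xi> \<zeta> v z))
       + (lin_type \<xi> \<zeta> w (R u v z) - R (lin_type \<xi> \<zeta> w u) v z
          - R u (lin_type \<xi> \<zeta> w v) z - R u v (lin_type \<xi> \<zeta> w z)) = 0"
begin

abbreviation "S \<equiv> lin_type \<xi> \<zeta>"

text \<open>The commutator of \<open>S u\<close> and \<open>S v\<close> minus \<open>S\<close> of
  the bracket. Because \<open>S\<close> is parallel for \<open>\<nabla> - S\<close>, the curvature
  of that connection is \<open>R - Q\<close>.\<close>

definition Q :: "'n tril" where
  "Q u v w = S u (S v w) - S v (S u w) - S (S u v - S v u) w"

abbreviation "\<theta> \<equiv> g \<xi>"
abbreviation "\<eta> \<equiv> g \<zeta>"

lemma g_xi: "g u \<xi> = \<theta> u" "g u (J \<xi>) = - \<theta> (J u)" "g (J \<xi>) u = - \<theta> (J u)"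
  using g_commute[of u \<xi>] J_skew[of \<xi> u] g_commute[of u "J \<xi>"] by auto

lemma g_zeta: "g u \<zeta> = \<eta> u" "g u (J \<zeta>) = - \<eta> (J u)" "g (J \<zeta>) u = - \<eta> (J u)"
  using g_commute[of u \<zeta>] J_skew[of \<zeta> u] g_commute[of u "J \<zeta>"] by auto

lemma xi_J_xi [simp]: "\<theta> (J \<xi>) = 0"
  using J_skew[of \<xi> \<xi>] g_commute[of \<xi> "J \<xi>"] by auto

lemma S_xi: "S v \<xi> = \<theta> v *\<^sub>R \<xi> - (\<epsilon> * \<theta> (J v) + 2 * \<eta> (J v)) *\<^sub>R J \<xi>"
  by (simp add: lin_type_def g_xi(1,2)[of v] xi_null algebra_simps)

lemma S_J: "S u (J v) = J (S u v)"
  by (simp add: lin_type_def J_simps g_simps algebra_simps)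

lemma S_simps:
  "S (u + v) w = S u w + S v w" "S (u - v) w = S u w - S v w" "S (c *\<^sub>R u) w = c *\<^sub>R S u w"
  "S (- u) w = - S u w" "S 0 w = 0" "S u (- w) = - S u w" "S u 0 = 0"
  "S u (v + w) = S u v + S u w" "S u (v - w) = S u v - S u w" "S u (c *\<^sub>R v) = c *\<^sub>R S u v"
  by (simp_all add: lin_type_def J_simps g_simps algebra_simps)

lemma g_J_swap: "g v (J u) = - g u (J v)"
  using J_skew[of u v] g_commute[of v "J u"] by simp

lemma S_bracket:
  "\<theta> (S u v - S v u) = 2 * (\<eta> (J v) * \<theta> (J u) - \<eta> (J u) * \<theta> (J v))"
  "\<theta> (J (S u v - S v u)) = 2 * \<epsilon> * (\<eta> (J v) * \<theta> u - \<eta> (J u) * \<theta> v)"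
  by (simp_all add: lin_type_def J_simps g_simps xi_null g_J_swap[of v u] g_commute[of v u] algebra_simps)

text \<open>On the span of \<open>\<xi>\<close> and \<open>J \<xi>\<close> every \<open>S u\<close>
  acts as a linear polynomial in \<open>J\<close>. These operators commute there, so only the
  bracket term of \<open>Q\<close> contributes.\<close>

lemma Q_xi: "Q u v \<xi> = (2 * (\<eta> (J u) * \<theta> (J v) - \<eta> (J v) * \<theta> (J u))) *\<^sub>R \<xi>
    + (2 * (\<eta> (J v) * \<theta> u - \<eta> (J u) * \<theta> v) + 2 * \<eta> (J (S u v - S v u))) *\<^sub>R J \<xi>"
proof -
  have "S u (S v \<xi>) = S v (S u \<xi>)"
    unfolding S_xi by (simp add: S_simps S_xi S_J J_simps algebra_simps)
  then have "Q u v \<xi> = - S (S u v - S v u) \<xi>" by (simp add: Q_def)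
  also have "\<dots> = - \<theta> (S u v - S v u) *\<^sub>R \<xi>
      + (\<epsilon> * \<theta> (J (S u v - S v u)) + 2 * \<eta> (J (S u v - S v u))) *\<^sub>R J \<xi>"
    by (simp add: S_xi)
  finally show ?thesis unfolding S_bracket by (simp add: algebra_simps)
qed

text \<open>In the cyclic sum of \<open>S\<^sub>u \<cdot> R\<close> the terms with \<open>\<zeta>\<close> cancel because \<open>R\<close> is
  \<open>J\<close>-invariant; the first Bianchi identity removes most of the others.\<close>

lemma cyclic_identity:
  "2 *\<^sub>R (\<theta> u *\<^sub>R R v w z + \<theta> v *\<^sub>R R w u z + \<theta> w *\<^sub>R R u v z)
   + (2 * \<epsilon>) *\<^sub>R (g u (J v) *\<^sub>R R (J \<xi>) w z + g v (J w) *\<^sub>R R (J \<xi>) u z + g w (J u) *\<^sub>R R (J \<xi>) v z)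
   + (g u z *\<^sub>R R v w \<xi> + g v z *\<^sub>R R w u \<xi> + g w z *\<^sub>R R u v \<xi>)
   - (g (R v w \<xi>) z *\<^sub>R u + g (R w u \<xi>) z *\<^sub>R v + g (R u v \<xi>) z *\<^sub>R w)
   + \<epsilon> *\<^sub>R (g u (J z) *\<^sub>R J (R v w \<xi>) + g v (J z) *\<^sub>R J (R w u \<xi>) + g w (J z) *\<^sub>R J (R u v \<xi>))
   - \<epsilon> *\<^sub>R (g (R v w \<xi>) (J z) *\<^sub>R J u + g (R w u \<xi>) (J z) *\<^sub>R J v + g (R u v \<xi>) (J z) *\<^sub>R J w) = 0"
proof -
  define D where "D u v w z = S u (R v w z) - R (S u v) w z - R v (S u w) z - R v w (S u z)" for u v w z
  have D: "D u v w z =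
      g u (R v w z) *\<^sub>R \<xi> + (\<epsilon> * g u (J (R v w z))) *\<^sub>R J \<xi>
      + g (R v w \<xi>) z *\<^sub>R u + (\<epsilon> * g (R v w \<xi>) (J z)) *\<^sub>R J u
      - g u v *\<^sub>R R \<xi> w z + \<theta> v *\<^sub>R R u w z - (\<epsilon> * g u (J v)) *\<^sub>R R (J \<xi>) w z + (\<epsilon> * \<theta> (J v)) *\<^sub>R R (J u) w z
      + g u w *\<^sub>R R \<xi> v z + \<theta> w *\<^sub>R R v u z + (\<epsilon> * g u (J w)) *\<^sub>R R (J \<xi>) v z + (\<epsilon> * \<theta> (J w)) *\<^sub>R R v (J u) z
      - g u z *\<^sub>R R v w \<xi> + \<theta> z *\<^sub>R R v w u - (\<epsilon> * g u (J z)) *\<^sub>R J (R v w \<xi>) + (\<epsilon> * \<theta> (J z)) *\<^sub>R J (R v w u)"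
    for u v w z
  proof -
    have 1: "\<theta> (R v w z) = - g (R v w \<xi>) z" using R_skew[of v w z \<xi>] g_commute by metis
    have 2: "\<theta> (J (R v w z)) = - g (R v w \<xi>) (J z)"
      using R_skew[of v w "J z" \<xi>] g_commute[of \<xi>] by (simp add: R_J)
    show ?thesis
      unfolding D_def lin_type_def R_simps R_J 1 2
      unfolding R_J_left[of v w] R_anti[of v \<xi>] R_anti[of v "J \<xi>"]
      by (simp add: algebra_simps)
  qed
  have c1: "g u (R v w z) + g v (R w u z) + g w (R u v z) = 0"
  proof -
    have "g a (R b c z) = - g (R b c a) z" for a b c using R_skew[of b c z a] g_commute by metis
    then show ?thesis using arg_cong[OF bianchi[of u v w], of "\<lambda>x. g x z"] by (simp add: g_simps)
  qed
  have c2: "g u (J (R v w z)) + g v (J (R w u z)) + g w (J (R u v z)) = 0"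
  proof -
    have "g a (J (R b c z)) = - g (R b c a) (J z)" for a b c
      using R_skew[of b c "J z" a] g_commute by (metis R_J)
    then show ?thesis using arg_cong[OF bianchi[of u v w], of "\<lambda>x. g x (J z)"] by (simp add: g_simps)
  qed
  have "D u v w z + D v w u z + D w u v z = 0"
    using second_bianchi[of u v w z] by (simp add: D_def)
  \<comment> \<open>All that lies outside the asserted expression is collected into multiples of the
    left sides of \<open>c1\<close> and \<open>c2\<close> and of the first Bianchi sum.\<close>
  moreover have "D u v w z + D v w u z + D w u v z =
    - (2 *\<^sub>R (\<theta> u *\<^sub>R R v w z + \<theta> v *\<^sub>R R w u z + \<theta> w *\<^sub>R R u v z)
   + (2 * \<epsilon>) *\<^sub>R (g u (J v) *\<^sub>R R (J \<xi>) w z + g v (J w) *\<^sub>R R (J \<xi>) u z + g w (J u) *\<^sub>R R (J \<xi>) v z)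
   + (g u z *\<^sub>R R v w \<xi> + g v z *\<^sub>R R w u \<xi> + g w z *\<^sub>R R u v \<xi>)
   - (g (R v w \<xi>) z *\<^sub>R u + g (R w u \<xi>) z *\<^sub>R v + g (R u v \<xi>) z *\<^sub>R w)
   + \<epsilon> *\<^sub>R (g u (J z) *\<^sub>R J (R v w \<xi>) + g v (J z) *\<^sub>R J (R w u \<xi>) + g w (J z) *\<^sub>R J (R u v \<xi>))
   - \<epsilon> *\<^sub>R (g (R v w \<xi>) (J z) *\<^sub>R J u + g (R w u \<xi>) (J z) *\<^sub>R J v + g (R u v \<xi>) (J z) *\<^sub>R J w))
   + (g u (R v w z) + g v (R w u z) + g w (R u v z)) *\<^sub>R \<xi>
   + (\<epsilon> * (g u (J (R v w z)) + g v (J (R w u z)) + g w (J (R u v z)))) *\<^sub>R J \<xi>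
   + \<theta> z *\<^sub>R (R u v w + R v w u + R w u v) + (\<epsilon> * \<theta> (J z)) *\<^sub>R J (R u v w + R v w u + R w u v)"
    unfolding D J_simps
      R_J_left[of u w] R_J_left[of v u] R_J_left[of w v]
      R_J_left[of u v] R_J_left[of v w] R_J_left[of w u]
      g_J_swap[of w v] g_J_swap[of u w] g_J_swap[of v u] g_commute[of v u] g_commute[of w u] g_commute[of w v]
      R_anti[of w v z] R_anti[of v u z] R_anti[of u w z]
      R_anti[of w "J v" z] R_anti[of v "J u" z] R_anti[of u "J w" z]
    by (simp add: algebra_simps R_J_left)
  ultimately show ?thesis unfolding c1 c2 bianchi by (simp add: J_simps)
qed

text \<open>The trace of \<open>cyclic_identity\<close> over \<open>u\<close>. The multiples of
  \<open>g (R v w \<xi>) z\<close> that arise add up to the factor -(dim + 2); this is the origin of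
  1/a.\<close>

lemma contracted_bianchi:
  "(real CARD('n) + 2) * g (R v w \<xi>) z =
     2 * \<theta> w * ric v z - 2 * \<theta> v * ric w z - 2 * \<epsilon> * g v (J w) * ric (J \<xi>) z
     + g w z * ric v \<xi> - g v z * ric w \<xi> + \<epsilon> * g w (J z) * ric v (J \<xi>) - \<epsilon> * g v (J z) * ric w (J \<xi>)"
proof -
  have r: "tr (\<lambda>u. g a u *\<^sub>R V) = g a V" "tr (\<lambda>u. g u a *\<^sub>R V) = g V a"
    "tr (\<lambda>u. g a (J u) *\<^sub>R V) = g a (J V)" "tr (\<lambda>u. g (R a u b) c *\<^sub>R V) = g (R a V b) c"
    "tr (\<lambda>u. g (R u a b) c *\<^sub>R V) = g (R V a b) c" for a b c V
    by (rule tr_rank_one; simp add: linear_iff g_simps J_simps R_simps)+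
  have t: "tr (\<lambda>u. J (R u a b)) = ric a (J b)" "tr (\<lambda>u. J (R a u b)) = - ric a (J b)"
    "tr (\<lambda>u. J u) = 0" for a b
    using tr_R2[of a "J b"] by (simp_all add: ric_def R_J tr_J)
  have JJ: "g (J a) (J b) = - \<epsilon> * g a b" for a b
    by (simp add: J_skew J_J g_simps)
  have k1: "\<theta> (R v w z) = - g (R v w \<xi>) z"
    using R_skew[of v w z \<xi>] g_commute[of \<xi> "R v w z"] by simp
  \<comment> \<open>Pair symmetry turns the two terms into members of the first Bianchi sum for
    \<open>J z\<close>, \<open>v\<close>, \<open>w\<close>; the third member is a multiple of
    \<open>g (R v w \<xi>) z\<close>.\<close>
  have k2: "g (R (J \<xi>) w z) (J v) + g w (J (R (J \<xi>) v z)) = - \<epsilon> * g (R v w \<xi>) z"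
  proof -
    have "g (R (J \<xi>) w z) (J v) = - g (R (J \<xi>) w (J z)) v" by (simp add: R_J J_skew)
    also have "\<dots> = - g (R (J z) v (J \<xi>)) w" by (subst R_pair) simp
    also have "\<dots> = g (R (J z) v w) (J \<xi>)" using R_skew[of "J z" v "J \<xi>" w] by simp
    finally have 1: "g (R (J \<xi>) w z) (J v) = g (R (J z) v w) (J \<xi>)" .
    have "g w (J (R (J \<xi>) v z)) = g (R (J \<xi>) v (J z)) w" by (simp add: R_J g_commute)
    also have "\<dots> = g (R (J z) w (J \<xi>)) v" by (rule R_pair)
    also have "\<dots> = g (R w (J z) v) (J \<xi>)"
      using R_skew[of "J z" w "J \<xi>" v] R_anti[of w "J z" v] by (simp add: g_simps)
    finally have 2: "g w (J (R (J \<xi>) v z)) = g (R w (J z) v) (J \<xi>)" .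
    have "g (R v w (J z)) (J \<xi>) = \<epsilon> * g (R v w \<xi>) z"
      using R_skew[of v w \<xi> z] by (simp add: R_J JJ)
    then show ?thesis
      using arg_cong[OF bianchi[of "J z" v w], of "\<lambda>x. g x (J \<xi>)"] by (simp add: 1 2 g_simps)
  qed
  have k3: "g (R w (J v) \<xi>) (J z) + g (R (J w) v \<xi>) (J z) = 0"
    by (simp add: R_J_left g_simps)
  have k4: "g (R w v \<xi>) z = - g (R v w \<xi>) z"
    using R_anti[of w v \<xi>] by (simp add: g_simps)
  have c: "tr (\<lambda>u. 2 *\<^sub>R (\<theta> u *\<^sub>R R v w z + \<theta> v *\<^sub>R R w u z + \<theta> w *\<^sub>R R u v z)
   + (2 * \<epsilon>) *\<^sub>R (g u (J v) *\<^sub>R R (J \<xi>) w z + g v (J w) *\<^sub>R R (J \<xi>) u z + g w (J u) *\<^sub>R R (J \<xi>) v z)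
   + (g u z *\<^sub>R R v w \<xi> + g v z *\<^sub>R R w u \<xi> + g w z *\<^sub>R R u v \<xi>)
   - (g (R v w \<xi>) z *\<^sub>R u + g (R w u \<xi>) z *\<^sub>R v + g (R u v \<xi>) z *\<^sub>R w)
   + \<epsilon> *\<^sub>R (g u (J z) *\<^sub>R J (R v w \<xi>) + g v (J z) *\<^sub>R J (R w u \<xi>) + g w (J z) *\<^sub>R J (R u v \<xi>))
   - \<epsilon> *\<^sub>R (g (R v w \<xi>) (J z) *\<^sub>R J u + g (R w u \<xi>) (J z) *\<^sub>R J v + g (R u v \<xi>) (J z) *\<^sub>R J w)) = 0"
    by (simp only: cyclic_identity tr_zero)
  have "0 = 2 * (\<theta> (R v w z) - \<theta> v * ric w z + \<theta> w * ric v z)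
     + 2 * \<epsilon> * (g (R (J \<xi>) w z) (J v) - g v (J w) * ric (J \<xi>) z + g w (J (R (J \<xi>) v z)))
     + (g (R v w \<xi>) z - g v z * ric w \<xi> + g w z * ric v \<xi>)
     - (real CARD('n) * g (R v w \<xi>) z + g (R w v \<xi>) z + g (R w v \<xi>) z)
     + \<epsilon> * (g (J (R v w \<xi>)) (J z) - g v (J z) * ric w (J \<xi>) + g w (J z) * ric v (J \<xi>))
     - \<epsilon> * (g (R w (J v) \<xi>) (J z) + g (R (J w) v \<xi>) (J z))"
    using c
    by (simp only: tr_add tr_diff tr_scaleR tr_ident tr_zero r t tr_R2 ric_def[symmetric])
      (simp add: algebra_simps)
  \<comment> \<open>Regrouped so that the left side of \<open>k2\<close> occurs literally.\<close>
  then have "0 = 2 * (\<theta> (R v w z) - \<theta> v * ric w z + \<theta> w * ric v z)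
     + 2 * \<epsilon> * ((g (R (J \<xi>) w z) (J v) + g w (J (R (J \<xi>) v z))) - g v (J w) * ric (J \<xi>) z)
     + (g (R v w \<xi>) z - g v z * ric w \<xi> + g w z * ric v \<xi>)
     - (real CARD('n) * g (R v w \<xi>) z + g (R w v \<xi>) z + g (R w v \<xi>) z)
     + \<epsilon> * (g (J (R v w \<xi>)) (J z) - g v (J z) * ric w (J \<xi>) + g w (J z) * ric v (J \<xi>))
     - \<epsilon> * (g (R w (J v) \<xi>) (J z) + g (R (J w) v \<xi>) (J z))"
    by (simp add: algebra_simps)
  then show ?thesis unfolding k1 k2 k3 k4 JJ by (simp add: algebra_simps)
qed

lemma ric_J_right: "ric v (J w) = - ric (J v) w"
  by (simp add: ric_J_left)

lemma obtain_unit: obtains f where "\<theta> f = 1"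
proof -
  obtain u where "\<theta> u \<noteq> 0"
    using nondegenerate_g xi_nonzero unfolding nondegenerate_def by blast
  then have "\<theta> ((1 / \<theta> u) *\<^sub>R u) = 1" by (simp add: g_simps)
  then show thesis by (rule that)
qed

text \<open>At \<open>z = \<xi>\<close> the left side of \<open>contracted_bianchi\<close> vanishes
  by skewness. Let X be \<open>\<theta> v * ric w \<xi> - \<theta> w * ric v \<xi>\<close> and Y the
  same expression at \<open>J v\<close>, \<open>J w\<close>. Then
  \<open>3 X + \<epsilon> Y = 0\<close> and \<open>3 Y + \<epsilon> X = 0\<close>, hence X =
  0.\<close>

lemma ric_xi: obtains \<sigma> where "\<And>v. ric v \<xi> = \<sigma> * \<theta> v"
proof -
  obtain f where f: "\<theta> f = 1" by (rule obtain_unit)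
  have 0: "ric (J \<xi>) \<xi> = 0"
    using ric_J_left[of \<xi> \<xi>] ric_commute[of \<xi> "J \<xi>"] by simp
  have E: "3 * (\<theta> v * ric w \<xi> - \<theta> w * ric v \<xi>) + \<epsilon> * (\<theta> (J v) * ric (J w) \<xi> - \<theta> (J w) * ric (J v) \<xi>) = 0"
    for v w
  proof -
    have "g (R v w \<xi>) \<xi> = 0" using R_skew[of v w \<xi> \<xi>] by linarith
    then show ?thesis
      using contracted_bianchi[of v w \<xi>]
      unfolding g_xi(1,2)[of v] g_xi(1,2)[of w] ric_J_right 0 by (simp add: algebra_simps)
  qed
  have comm: "\<theta> v * ric w \<xi> = \<theta> w * ric v \<xi>" for v w
  proof -
    have "3 * (\<theta> (J v) * ric (J w) \<xi> - \<theta> (J w) * ric (J v) \<xi>) + \<epsilon> * (\<theta> v * ric w \<xi> - \<theta> w * ric v \<xi>) = 0"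
      using E[of "J v" "J w"] by (simp add: J_J g_simps ric_simps algebra_simps)
    with E[of v w] show ?thesis using eps by auto
  qed
  show thesis
  proof (rule that)
    show "ric v \<xi> = ric f \<xi> * \<theta> v" for v using comm[of f v] by (simp add: f mult.commute)
  qed
qed

end

text \<open>The axioms say that \<open>R - Q\<close>, the curvature of \<open>\<nabla> - S\<close>,
  annihilates \<open>\<xi>\<close>, \<open>\<zeta>\<close> and \<open>R\<close>.\<close>

locale homogeneous_model = degenerate_structure \<epsilon> g J R \<xi> \<zeta>
  for \<epsilon> :: real and g :: "'n::finite form2" and J R \<xi> \<zeta> +
  assumes R_xi: "R u v \<xi> = Q u v \<xi>" and R_zeta: "R u v \<zeta> = Q u v \<zeta>"
    and R_parallel: "(R u v (R a b c) - Q u v (R a b c)) - R (R u v a - Q u v a) b c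
       - R a (R u v b - Q u v b) c - R a b (R u v c - Q u v c) = 0"
begin

text \<open>The vectors \<open>f\<close> and \<open>J f\<close> separate \<open>\<theta>\<close>
  from \<open>\<theta> \<circ> J\<close>: these forms take the values 1, 0 at \<open>f\<close> and
  0, \<open>\<epsilon>\<close> at \<open>J f\<close>. Coefficients can therefore be read off by
  evaluation.\<close>

lemma ricci_formula_independent:
  assumes f: "\<theta> f = 1" "\<theta> (J f) = 0"
  shows "\<exists>l. \<zeta> = l *\<^sub>R \<xi> \<and> (\<forall>v w. ric v w =
    - (real CARD('n) + 2) * l * (\<epsilon> + 2 * l) * (\<theta> v * \<theta> w - \<epsilon> * (\<theta> (J v) * \<theta> (J w))))"
proof -
  let ?n = "real CARD('n)"
  have JJ: "g (J a) (J b) = - \<epsilon> * g a b" for a b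
    by (simp add: J_skew J_J g_simps)
  define A B where "A v w = 2 * (\<eta> (J v) * \<theta> (J w) - \<eta> (J w) * \<theta> (J v))"
    and "B v w = 2 * (\<eta> (J w) * \<theta> v - \<eta> (J v) * \<theta> w) + 2 * \<eta> (J (S v w - S w v))" for v w
  have Rx: "R v w \<xi> = A v w *\<^sub>R \<xi> + B v w *\<^sub>R J \<xi>" for v w
    by (simp add: R_xi Q_xi A_def B_def)
  obtain \<sigma> where s: "\<And>v. ric v \<xi> = \<sigma> * \<theta> v" using ric_xi by blast
  have sJ: "ric v (J \<xi>) = - \<sigma> * \<theta> (J v)" for v by (simp add: ric_J_right s)
  \<comment> \<open>\<open>R f (J f) \<xi>\<close> lies in the isotropic span of
    \<open>\<xi>\<close> and \<open>J \<xi>\<close>, so at \<open>z = J \<xi>\<close> the contracted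
    identity reduces to \<open>2 * \<epsilon> * \<sigma> = 0\<close>.\<close>
  have "\<sigma> = 0"
  proof -
    have "g (R f (J f) \<xi>) (J \<xi>) = 0" by (simp add: Rx g_simps JJ xi_null)
    then show ?thesis
      using contracted_bianchi[of f "J f" "J \<xi>"] eps
      by (auto simp: JJ J_J g_simps ric_simps sJ s f xi_null g_xi(1,2)[of f] g_xi(1,2)[of "J f"]
        algebra_simps)
  qed
  then have C: "(?n + 2) * g (R v w \<xi>) z = 2 * \<theta> w * ric v z - 2 * \<theta> v * ric w z" for v w z
    using contracted_bianchi[of v w z] s sJ ric_commute[of "J \<xi>" z] by simp
  \<comment> \<open>Since \<open>R (J f) (J w) = - \<epsilon> R f w\<close>, the instances of
    \<open>C\<close> for \<open>f\<close>, \<open>w\<close> and for \<open>J f\<close>,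
    \<open>J w\<close> have proportional left sides. Equating them expresses the Ricci form by its
    values at \<open>f\<close> and \<open>J f\<close>.\<close>
  have span: "ric w z = \<theta> w * ric f z + \<epsilon> * \<theta> (J w) * ric (J f) z" for w z
  proof -
    have "g (R (J f) (J w) \<xi>) z = - \<epsilon> * g (R f w \<xi>) z"
      by (simp add: R_J_left J_J R_simps g_simps)
    then have "2 * \<theta> (J w) * ric (J f) z = - \<epsilon> * ((?n + 2) * g (R f w \<xi>) z)"
      using C[of "J f" "J w" z] by (simp add: f ac_simps)
    also have "\<dots> = - \<epsilon> * (2 * \<theta> w * ric f z - 2 * ric w z)"
      unfolding C f by simp
    finally have "2 * \<theta> (J w) * ric (J f) z = - \<epsilon> * (2 * \<theta> w * ric f z - 2 * ric w z)" .
    then show ?thesis using eps by auto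
  qed
  have 0: "ric f (J f) = 0" "ric (J f) f = 0"
    using ric_J_left[of f f] ric_commute[of f "J f"] by auto
  define c where "c = ric f f"
  have f1: "ric f z = \<theta> z * c" for z
    using span[of z f] by (simp add: 0 c_def ric_commute[of f z])
  have f2: "ric (J f) z = - \<theta> (J z) * c" for z
    using ric_J_left[of f z] f1[of "J z"] by simp
  have ric: "ric v w = c * (\<theta> v * \<theta> w - \<epsilon> * (\<theta> (J v) * \<theta> (J w)))" for v w
    by (subst span) (simp add: f1 f2 algebra_simps)
  \<comment> \<open>The two expressions for \<open>R v w \<xi>\<close> meet here. At
    \<open>z = f\<close> the result is \<open>A v w = 0\<close>, which makes \<open>\<eta>\<close> a
    multiple of \<open>\<theta>\<close>; at \<open>z = J f\<close> it determines
    \<open>c\<close>.\<close>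
  have AB: "(?n + 2) * (A v w * \<theta> z - B v w * \<theta> (J z)) =
      - 2 * \<epsilon> * c * (\<theta> w * \<theta> (J v) - \<theta> v * \<theta> (J w)) * \<theta> (J z)" for v w z
    using C[of v w z] by (simp add: Rx g_simps g_xi(3) ric algebra_simps)
  have "A v w = 0" for v w
    using AB[of v w f] f by (simp add: add_nonneg_eq_0_iff)
  then have comm: "\<eta> (J v) * \<theta> (J w) = \<eta> (J w) * \<theta> (J v)" for v w
    by (simp add: A_def)
  have "\<eta> v = \<eta> f * \<theta> v" for v
    using eps comm[of "J v" "J f"] unfolding J_J g_simps f real_scaleR_def
    by (elim insertE emptyE; hypsubst; linarith)
  then obtain l where eta: "\<And>v. \<eta> v = l * \<theta> v" by blast
  have zeta: "\<zeta> = l *\<^sub>R \<xi>"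
    by (rule g_eqI) (simp add: eta g_simps)
  have "B f (J f) = 2 * l * \<epsilon> + 4 * l * l"
    unfolding B_def eta S_bracket by (simp add: J_J g_simps f eta algebra_simps)
  then have "c = - (?n + 2) * l * (\<epsilon> + 2 * l)"
    using AB[of f "J f" "J f"] eps \<open>A f (J f) = 0\<close>
    by (auto simp: f J_J g_simps algebra_simps)
  with ric zeta show ?thesis by blast
qed

end

text \<open>The remaining case: \<open>\<epsilon> = 1\<close> and \<open>\<xi>\<close> is an eigenvector of \<open>J\<close>. The eigenspaces of
  \<open>J\<close> are isotropic and \<open>R u v = 0\<close> for \<open>u\<close>, \<open>v\<close> in the same one.\<close>

locale eigenvector_model = homogeneous_model 1 g J R \<xi> \<zeta>
  for g :: "'n::finite form2" and J R \<xi> \<zeta> +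
  assumes J_xi: "J \<xi> = \<xi>"
begin

definition E_plus :: "(real^'n) set" where "E_plus = {u. J u = u}"
definition E_minus :: "(real^'n) set" where "E_minus = {u. J u = - u}"

lemma J_plus: "u \<in> E_plus \<Longrightarrow> J u = u" and J_minus: "u \<in> E_minus \<Longrightarrow> J u = - u"
  by (simp_all add: E_plus_def E_minus_def)

lemma eigen_split: "(1/2) *\<^sub>R (u + J u) \<in> E_plus" "(1/2) *\<^sub>R (u - J u) \<in> E_minus"
  by (simp_all add: E_plus_def E_minus_def J_simps algebra_simps)

lemma eigen_decomp: obtains p m where "p \<in> E_plus" "m \<in> E_minus" "u = p + m"
proof (rule that[OF eigen_split[of u]])
  show "u = (1/2) *\<^sub>R (u + J u) + (1/2) *\<^sub>R (u - J u)"
    by (simp add: algebra_simps flip: scaleR_add_left)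
qed

lemma xi_plus: "\<xi> \<in> E_plus" by (simp add: E_plus_def J_xi)

lemma theta_J: "\<theta> (J u) = - \<theta> u"
  using J_skew[of \<xi> u] by (simp add: J_xi)

lemma theta_plus: "u \<in> E_plus \<Longrightarrow> \<theta> u = 0"
  using theta_J[of u] by (simp add: J_plus)

lemma g_plus: "u \<in> E_plus \<Longrightarrow> v \<in> E_plus \<Longrightarrow> g u v = 0"
  using J_skew[of u v] by (simp add: J_plus)

lemma g_minus: "u \<in> E_minus \<Longrightarrow> v \<in> E_minus \<Longrightarrow> g u v = 0"
  using J_skew[of u v] by (simp add: J_minus g_simps)

lemma R_minus: "u \<in> E_minus \<Longrightarrow> v \<in> E_minus \<Longrightarrow> R u v w = 0"
  using R_J_left[of u v w] by (simp add: J_minus R_simps)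

lemma R_plus: "u \<in> E_plus \<Longrightarrow> v \<in> E_plus \<Longrightarrow> R u v w = 0"
  using R_J_left[of u v w] by (simp add: J_plus)

text \<open>In the first Bianchi identity for \<open>x\<close>, \<open>a\<close>, \<open>b\<close>
  the term \<open>R a b x\<close> vanishes.\<close>

lemma R_swap_plus: "a \<in> E_plus \<Longrightarrow> b \<in> E_plus \<Longrightarrow> R x a b = R x b a"
proof -
  assume "a \<in> E_plus" "b \<in> E_plus"
  then have "R x a b = - R b x a" using bianchi[of x a b] by (simp add: R_plus eq_neg_iff_add_eq_0)
  then show ?thesis using R_anti[of x b a] by simp
qed

lemma R_in_plus: "a \<in> E_plus \<Longrightarrow> R u v a \<in> E_plus"
  using R_J[of u v a] by (simp add: E_plus_def)

text \<open>\<open>E_plus\<close> is isotropic, so its vectors are already separated by pairing with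
  \<open>E_minus\<close>.\<close>

lemma g_minus_eqI:
  assumes "a \<in> E_plus" "b \<in> E_plus" "\<And>u. u \<in> E_minus \<Longrightarrow> g a u = g b u"
  shows "a = b"
proof (rule g_eqI)
  fix z obtain p m where "p \<in> E_plus" "m \<in> E_minus" "z = p + m" by (rule eigen_decomp)
  then show "g a z = g b z" using assms by (simp add: g_simps g_plus)
qed

lemma Q_J: "Q u v (J w) = J (Q u v w)"
  by (simp add: Q_def S_J linear_diff[OF linear_J])

lemma obtain_f: obtains f where "f \<in> E_minus" "\<theta> f = 1"
proof -
  obtain u where "\<theta> u = 1" by (rule obtain_unit)
  then have "\<theta> ((1/2) *\<^sub>R (u - J u)) = 1" by (simp add: g_simps theta_J)
  then show thesis using that eigen_split(2) by blast
qed

text \<open>Dimension at least 4 is used here. If \<open>\<theta>\<close> were injective on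
  \<open>E_minus\<close>, that space would be the line of \<open>f\<close> and its dual
  \<open>E_plus\<close> the line of \<open>\<xi>\<close>, so the dimension would be at most
  2.\<close>

lemma obtain_y: obtains y where "y \<in> E_minus" "\<theta> y = 0" "y \<noteq> 0"
proof -
  have False if zero: "\<And>y. y \<in> E_minus \<Longrightarrow> \<theta> y = 0 \<Longrightarrow> y = 0"
  proof -
  obtain f where f: "f \<in> E_minus" "\<theta> f = 1" by (rule obtain_f)
  have m: "m = \<theta> m *\<^sub>R f" if "m \<in> E_minus" for m
  proof -
    have "m - \<theta> m *\<^sub>R f \<in> E_minus" using that f by (simp add: E_minus_def J_simps)
    from zero[OF this] show ?thesis by (simp add: g_simps f)
  qed
  have p: "p = g f p *\<^sub>R \<xi>" if "p \<in> E_plus" for p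
  proof (rule g_minus_eqI[OF that])
    show "g f p *\<^sub>R \<xi> \<in> E_plus" by (simp add: E_plus_def J_simps J_xi)
    show "g p u = g (g f p *\<^sub>R \<xi>) u" if "u \<in> E_minus" for u
      by (subst (1) m[OF that]) (simp add: g_simps g_commute[of f p])
  qed
  have "UNIV \<subseteq> span {f, \<xi>}"
  proof
    fix u obtain p m where pm: "p \<in> E_plus" "m \<in> E_minus" "u = p + m" by (rule eigen_decomp)
    have "p \<in> span {f, \<xi>}" by (subst p[OF pm(1)]) (simp add: span_base span_scale)
    moreover have "m \<in> span {f, \<xi>}" by (subst m[OF pm(2)]) (simp add: span_base span_scale)
    ultimately show "u \<in> span {f, \<xi>}" by (simp add: pm span_add)
  qed
  then have "dim (UNIV :: (real^'n) set) \<le> card {f, \<xi>}" by (intro dim_le_card) auto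
  also have "\<dots> \<le> 2" by (simp add: card_insert_if)
  finally show False using dim by simp
  qed
  then show thesis using that by blast
qed

lemma S_minus_minus: "u \<in> E_minus \<Longrightarrow> v \<in> E_minus \<Longrightarrow> S u v = - (2 * \<theta> v) *\<^sub>R u - (2 * \<eta> u) *\<^sub>R v"
  by (simp add: lin_type_def J_minus J_xi g_simps g_minus algebra_simps)

lemma S_minus_plus: "u \<in> E_minus \<Longrightarrow> a \<in> E_plus \<Longrightarrow> S u a = (2 * g u a) *\<^sub>R \<xi> + (2 * \<eta> u) *\<^sub>R a"
  by (simp add: lin_type_def J_minus J_plus J_xi g_simps theta_plus algebra_simps)

lemma S_plus_minus: "a \<in> E_plus \<Longrightarrow> u \<in> E_minus \<Longrightarrow> S a u = (2 * \<eta> a) *\<^sub>R u"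
  by (simp add: lin_type_def J_minus J_plus J_xi g_simps theta_plus algebra_simps)

text \<open>\<open>R u v\<close> vanishes on \<open>E_minus\<close>, hence so does
  \<open>Q u v \<xi>\<close>, which is a nonzero multiple of the asserted difference times
  \<open>\<xi>\<close>.\<close>

lemma eta_minus:
  assumes "u \<in> E_minus" "v \<in> E_minus"
  shows "\<eta> u * \<theta> v = \<eta> v * \<theta> u"
proof -
  have "Q u v \<xi> = (8 * (\<eta> u * \<theta> v - \<eta> v * \<theta> u)) *\<^sub>R \<xi>"
    using assms by (simp add: Q_xi S_minus_minus J_xi J_minus J_simps g_simps algebra_simps flip: scaleR_add_left scaleR_diff_left)
  then show ?thesis using R_xi[of u v] R_minus[OF assms] xi_nonzero by simp
qed

text \<open>The hard part is that \<open>\<eta>\<close> vanishes on \<open>E_plus\<close>, that is,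
  that \<open>\<zeta>\<close> has no component in \<open>E_minus\<close>. On \<open>E_minus\<close>
  the proportionality of \<open>\<eta>\<close> and \<open>\<theta>\<close> is
  \<open>eta_minus\<close>.\<close>

lemma zeta_multiple_ricci_flat:
  "\<exists>l. \<zeta> = l *\<^sub>R \<xi> \<and> (\<forall>v w. tr (\<lambda>u. R u v w) = 0)"
proof -
  obtain f where f: "f \<in> E_minus" "\<theta> f = 1" by (rule obtain_f)
  define l where "l = \<eta> f"
  define p where "p = \<eta> \<xi>"
  have eta: "\<eta> u = l * \<theta> u" if "u \<in> E_minus" for u
    using eta_minus[OF that f(1)] f(2) by (simp add: l_def)
  have Rx0: "R u a \<xi> = (4 * p * g u a + (4 + 8 * l) * (\<theta> u * \<eta> a)) *\<^sub>R \<xi>"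
    if "u \<in> E_minus" "a \<in> E_plus" for u a
    unfolding R_xi Q_xi using that
    by (simp add: S_minus_plus S_plus_minus J_xi J_minus J_plus J_simps g_simps theta_plus eta
        p_def[symmetric] algebra_simps flip: scaleR_add_left scaleR_diff_left)
  \<comment> \<open>For \<open>y\<close> in the kernel of \<open>\<theta>\<close>, pair symmetry and
    \<open>R \<xi> f y = R \<xi> y f\<close> equate \<open>g (R y a \<xi>) f\<close>, which is
    \<open>4 * p * g y a\<close>, with \<open>g (R f a \<xi>) y\<close>, which has the factor
    \<open>\<theta> y = 0\<close>.\<close>
  have "p = 0"
  proof -
    obtain y where y: "y \<in> E_minus" "\<theta> y = 0" "y \<noteq> 0" by (rule obtain_y)
    have "g 0 z = 0" for z by (simp add: g_simps)
    with y(3) obtain z where z: "g y z \<noteq> 0" using g_eqI[of y 0] by metis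
    obtain a m where a: "a \<in> E_plus" "m \<in> E_minus" "z = a + m" by (rule eigen_decomp)
    have ya: "g y a \<noteq> 0" using z a y by (simp add: g_simps g_minus)
    have *: "g (R u a \<xi>) x = g (R \<xi> x u) a" for u x
      using R_pair[of u a \<xi> x] by simp
    have "R \<xi> f y = R \<xi> y f"
      using bianchi[of \<xi> f y] R_anti[of y \<xi> f] by (simp add: R_minus[OF f(1) y(1)])
    then have "g (R y a \<xi>) f = g (R f a \<xi>) y" by (simp add: *)
    then show ?thesis using ya f y a by (simp add: Rx0 g_simps)
  qed
  define F where "F = 4 + 8 * l"
  have Rx: "R u a \<xi> = (F * \<theta> u * \<eta> a) *\<^sub>R \<xi>" if "u \<in> E_minus" "a \<in> E_plus" for u a
    using Rx0[OF that] \<open>p = 0\<close> by (simp add: F_def algebra_simps)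
  \<comment> \<open>The cyclic identity at \<open>f\<close>, \<open>y\<close>, \<open>a\<close>,
    \<open>b\<close>: as \<open>\<theta>\<close> is 1 at \<open>f\<close> and 0 at the others, it
    can be solved for \<open>R y a b\<close>.\<close>
  have Ry: "R y a b = (F * (g y a * \<eta> b + g y b * \<eta> a)) *\<^sub>R \<xi>"
    if y: "y \<in> E_minus" "\<theta> y = 0" and a: "a \<in> E_plus" and b: "b \<in> E_plus" for y a b
  proof -
    have 1: "R y a \<xi> = 0" using Rx[OF y(1) a] y by simp
    have 2: "R a f \<xi> = - (F * \<eta> a) *\<^sub>R \<xi>" using Rx[OF f(1) a] f R_anti[of a f \<xi>] by simp
    have 3: "R \<xi> f b = - (F * \<eta> b) *\<^sub>R \<xi>"
      using Rx[OF f(1) b] f R_anti[of \<xi> f b] R_swap_plus[OF xi_plus b, of f] by simp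
    have 4: "R \<xi> y b = 0"
      using Rx[OF y(1) b] y R_anti[of \<xi> y b] R_swap_plus[OF xi_plus b, of y] by simp
    have "g f y = 0" "g a b = 0" by (rule g_minus[OF f(1) y(1)]) (rule g_plus[OF a b])
    then have "2 *\<^sub>R R y a b = 2 *\<^sub>R ((F * (g y a * \<eta> b + g y b * \<eta> a)) *\<^sub>R \<xi>)"
      using cyclic_identity[of f y a b] y f theta_plus[OF a] theta_plus[OF b]
      by (simp add: J_minus J_plus a b J_xi J_simps g_simps 1 2 3 4 R_simps R_minus algebra_simps
        flip: scaleR_add_left scaleR_diff_left)
    then show ?thesis by (rule scaleR_left_imp_eq[rotated]) simp
  qed
  \<comment> \<open>Twice the component of \<open>\<zeta>\<close> in \<open>E_minus\<close>.\<close>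
  define z where "z = \<zeta> - J \<zeta>"
  have z: "z \<in> E_minus" "\<theta> z = 0" "\<And>a. a \<in> E_plus \<Longrightarrow> g z a = 2 * \<eta> a"
    using \<open>p = 0\<close> g_commute[of \<xi> \<zeta>]
    by (simp_all add: z_def E_minus_def p_def J_simps g_simps theta_J g_zeta(3) J_plus)
  have ez: "\<eta> z = 0" using eta[OF z(1)] z(2) by simp
  have ex: "\<eta> \<xi> = 0" using \<open>p = 0\<close> by (simp add: p_def)
  have zero: "\<eta> a = 0" if a: "a \<in> E_plus" for a
  proof (rule ccontr)
    assume na: "\<eta> a \<noteq> 0"
    \<comment> \<open>\<open>R\<close> and \<open>Q\<close> commute with \<open>J\<close>, so
      \<open>R_zeta\<close> also gives \<open>R f a z = Q f a z\<close>. Every \<open>S x\<close>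
      maps \<open>z\<close> to a multiple of \<open>z\<close>, hence the commutator part of
      \<open>Q\<close> drops out.\<close>
    have Rz: "R f a z = - (8 * l * \<eta> a) *\<^sub>R z"
    proof -
      have Sz: "S x z = (2 * \<eta> (J x)) *\<^sub>R z" for x
        using z by (simp add: lin_type_def J_minus J_xi g_simps)
      have "R f a z = Q f a \<zeta> - Q f a (J \<zeta>)"
        by (simp add: z_def R_simps R_J R_zeta Q_J)
      also have "\<dots> = Q f a z" by (simp add: z_def Q_def S_simps)
      also have "\<dots> = - (2 * \<eta> (J (S f a - S a f))) *\<^sub>R z"
        unfolding Q_def Sz S_simps by (simp add: Sz)
      also have "\<eta> (J (S f a - S a f)) = 4 * l * \<eta> a"
        by (simp add: S_minus_plus[OF f(1) a] S_plus_minus[OF a f(1)] J_simps J_xi J_plus[OF a]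
            J_minus[OF f(1)] g_simps ex l_def)
      finally show ?thesis by simp
    qed
    have Ra: "R z a a = (4 * F * \<eta> a * \<eta> a) *\<^sub>R \<xi>"
      by (simp add: Ry[OF z(1,2) a a] z(3)[OF a] algebra_simps)
    \<comment> \<open>One curvature component evaluated in two ways: \<open>16 * l = 4 * F\<close>
      with \<open>F = 4 + 8 * l\<close> leaves only \<open>l = -1\<close>.\<close>
    have "g (R f a z) a = g (R z a f) a" by (rule R_pair)
    also have "\<dots> = - g (R z a a) f" by (rule R_skew)
    finally have "16 * l * \<eta> a * \<eta> a = 4 * F * \<eta> a * \<eta> a"
      by (simp add: Rz Ra g_simps z(3)[OF a] f)
    then have l: "l = -1" using na by (simp add: F_def)
    have Szf: "S z f = - 2 *\<^sub>R z" "S f z = 2 *\<^sub>R z" "S f f = 0"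
      using f z by (simp_all add: S_minus_minus ez l flip: l_def)
    have q: "Q z f c = (8 * \<eta> c) *\<^sub>R \<xi>" if c: "c \<in> E_plus" for c
    proof -
      have F: "S z c = (4 * \<eta> c) *\<^sub>R \<xi>" "S f c = (2 * g f c) *\<^sub>R \<xi> - 2 *\<^sub>R c" "S f \<xi> = 0" "S z \<xi> = 0"
        using f z(2) g_commute[of f \<xi>] g_commute[of z \<xi>]
        by (simp_all add: S_minus_plus z(1) z(3)[OF c] c ez l xi_plus flip: l_def scaleR_diff_left)
      show ?thesis by (simp add: Q_def Szf S_simps F algebra_simps flip: scaleR_add_left scaleR_diff_left)
    qed
    have qf: "Q z f f = - 4 *\<^sub>R z"
      by (simp add: Q_def Szf S_simps algebra_simps flip: scaleR_add_left scaleR_diff_left)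
    have Rzf: "R z f c = 0" for c by (rule R_minus[OF z(1) f(1)])
    have rf: "R a f a \<in> E_plus" by (rule R_in_plus[OF a])
    have "g z (R a f a) = - g (R a f z) a" using R_skew[of a f a z] g_commute[of z] by simp
    also have "\<dots> = 16 * \<eta> a * \<eta> a"
      using R_anti[of a f z] by (simp add: Rz g_simps z(3)[OF a] l)
    finally have e: "\<eta> (R a f a) = 8 * \<eta> a * \<eta> a" using z(3)[OF rf] by simp
    have 1: "R \<xi> f a = (4 * \<eta> a) *\<^sub>R \<xi>"
      using Rx[OF f(1) a] R_anti[of \<xi> f a] R_swap_plus[OF xi_plus a, of f] by (simp add: F_def l f)
    have 2: "R a f \<xi> = (4 * \<eta> a) *\<^sub>R \<xi>"
      using Rx[OF f(1) a] R_anti[of a f \<xi>] by (simp add: F_def l f)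
    have 3: "R a z a = (16 * \<eta> a * \<eta> a) *\<^sub>R \<xi>"
      using Ra R_anti[of a z a] by (simp add: F_def l)
    \<comment> \<open>As \<open>R z f = 0\<close>, the instance says that \<open>Q z f\<close>
      annihilates \<open>R\<close>. Its four terms contribute -64, 32, -64 and 32 times
      \<open>(\<eta> a * \<eta> a) *\<^sub>R \<xi>\<close>.\<close>
    have "(64 * \<eta> a * \<eta> a) *\<^sub>R \<xi> = 0"
      using R_parallel[of z f a f a]
      by (simp add: Rzf q[OF rf] q[OF a] qf e R_simps 1 2 3 algebra_simps
        flip: scaleR_add_left scaleR_diff_left)
    then show False using na xi_nonzero by simp
  qed
  have zeta: "\<zeta> = l *\<^sub>R \<xi>"
  proof (rule g_eqI)
    fix u obtain a m where "a \<in> E_plus" "m \<in> E_minus" "u = a + m" by (rule eigen_decomp)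
    then show "\<eta> u = g (l *\<^sub>R \<xi>) u" by (simp add: g_simps zero eta theta_plus)
  qed
  have Rxi: "R v w \<xi> = 0" for v w
  proof -
    obtain a m where v: "a \<in> E_plus" "m \<in> E_minus" "v = a + m" by (rule eigen_decomp)
    obtain b k where w: "b \<in> E_plus" "k \<in> E_minus" "w = b + k" by (rule eigen_decomp)
    show ?thesis
      using v w R_anti[of a k \<xi>] by (simp add: R_simps R_plus R_minus Rx zero)
  qed
  obtain \<sigma> where s: "\<And>v. ric v \<xi> = \<sigma> * \<theta> v" using ric_xi by blast
  \<comment> \<open>The left side of \<open>contracted_bianchi\<close> is now 0. With
    \<open>\<theta> f = 1\<close> and \<open>\<theta> a = 0\<close> the right side can be solved for
    \<open>ric a x\<close>.\<close>
  have ra: "ric a x = - \<sigma> * g f a * \<theta> x" if a: "a \<in> E_plus" for a x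
    using contracted_bianchi[of f a x] f a J_skew[of a x] J_skew[of f x] ric_commute[of \<xi> x]
    by (simp add: Rxi g_simps J_plus J_minus J_xi theta_plus s algebra_simps)
  \<comment> \<open>For \<open>ric \<xi> f\<close> the formula \<open>ra\<close> gives
    \<open>- \<sigma>\<close>, whereas \<open>s\<close> and symmetry give
    \<open>\<sigma>\<close>.\<close>
  have "\<sigma> = 0"
    using ra[OF xi_plus, of f] s[of f] ric_commute[of \<xi> f] f g_commute[of f \<xi>] by simp
  have "ric v w = 0" for v w
  proof -
    obtain a m where v: "a \<in> E_plus" "m \<in> E_minus" "v = a + m" by (rule eigen_decomp)
    obtain b k where w: "b \<in> E_plus" "k \<in> E_minus" "w = b + k" by (rule eigen_decomp)
    have "ric m k = 0" using ric_J_left[of m k] v w by (simp add: J_minus ric_simps)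
    then show ?thesis
      using v w ra[OF v(1)] ra[OF w(1)] ric_commute[of m b] by (simp add: ric_simps \<open>\<sigma> = 0\<close>)
  qed
  with zeta show ?thesis by (auto simp: ric_def)
qed

end

section \<open>The two cases for \<open>\<xi>\<close> and \<open>J \<xi>\<close>\<close>

context homogeneous_model
begin

text \<open>If no such \<open>f\<close> exists, the kernel of \<open>\<theta> \<circ> J\<close> lies
  in that of \<open>\<theta>\<close>. Then \<open>\<theta>\<close> is \<open>k\<close> times
  \<open>\<theta> \<circ> J\<close>, so \<open>\<xi>\<close> is an eigenvector, and applying
  \<open>J\<close> twice gives \<open>k * k * \<epsilon> = 1\<close>, which excludes
  \<open>\<epsilon> = -1\<close>.\<close>

lemma obtain_independent_or_eigenvector:
  obtains f where "\<theta> f = 1" "\<theta> (J f) = 0"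
  | k where "\<epsilon> = 1" "k \<in> {-1, 1}" "J \<xi> = k *\<^sub>R \<xi>"
proof (cases "\<exists>f. \<theta> f = 1 \<and> \<theta> (J f) = 0")
  case True
  then show thesis using that(1) by blast
next
  case False
  have ker: "\<theta> u = 0" if "\<theta> (J u) = 0" for u
  proof (rule ccontr)
    assume "\<theta> u \<noteq> 0"
    then have "\<theta> ((1 / \<theta> u) *\<^sub>R u) = 1 \<and> \<theta> (J ((1 / \<theta> u) *\<^sub>R u)) = 0"
      using that by (simp add: g_simps J_simps)
    with False show False by blast
  qed
  obtain f where f: "\<theta> f = 1" by (rule obtain_unit)
  then have nz: "\<theta> (J f) \<noteq> 0" using False by blast
  define k where "k = 1 / \<theta> (J f)"
  have k: "\<theta> u = k * \<theta> (J u)" for u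
  proof -
    have "\<theta> (u - (k * \<theta> (J u)) *\<^sub>R f) = 0"
      by (rule ker) (use nz in \<open>simp add: k_def g_simps J_simps\<close>)
    then show ?thesis by (simp add: g_simps f)
  qed
  have xi: "\<xi> = - k *\<^sub>R J \<xi>"
    by (rule g_eqI) (simp add: g_simps g_xi(3) flip: k)
  have "J \<xi> = - (k * \<epsilon>) *\<^sub>R \<xi>"
    by (subst xi) (simp add: J_simps)
  moreover from this xi have "\<xi> = (k * k * \<epsilon>) *\<^sub>R \<xi>" by (metis minus_mult_minus mult.assoc mult_minus_left scaleR_scaleR)
  then have "(k * k * \<epsilon> - 1) *\<^sub>R \<xi> = 0" by (simp add: scaleR_diff_left)
  then have kk: "k * k * \<epsilon> = 1" using xi_nonzero by simp
  have "\<epsilon> \<noteq> -1"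
  proof
    assume "\<epsilon> = -1"
    with kk have "k * k = -1" by simp
    with zero_le_square[of k] show False by linarith
  qed
  then have e: "\<epsilon> = 1" using eps by simp
  with kk have "k = 1 \<or> k = -1" by (simp add: square_eq_1_iff)
  ultimately show thesis using that(2)[of "-k"] e by auto
qed

lemma eigenvector_case:
  assumes "\<epsilon> = 1" "J \<xi> = \<xi>"
  shows "\<exists>l. \<zeta> = l *\<^sub>R \<xi> \<and> (\<forall>v w. tr (\<lambda>u. R u v w) = 0)"
proof -
  have "homogeneous_model 1 g J R \<xi> \<zeta>" using homogeneous_model_axioms assms(1) by simp
  then interpret e: eigenvector_model g J R \<xi> \<zeta>
    by (rule eigenvector_model.intro) (rule eigenvector_model_axioms.intro, rule assms(2))
  show ?thesis by (rule e.zeta_multiple_ricci_flat)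
qed

text \<open>\<open>J\<close> enters \<open>lin_type\<close> only in pairs, so \<open>S\<close> and
  \<open>Q\<close> are the same for \<open>- J\<close>. The eigenvalue -1 of \<open>\<xi>\<close>
  thereby becomes 1.\<close>

lemma minus_J_model:
  assumes "\<epsilon> = 1"
  shows "homogeneous_model \<epsilon> g (\<lambda>u. - J u) R \<xi> \<zeta>"
proof -
  have h: "hermitian_space \<epsilon> g (\<lambda>u. - J u)"
    by unfold_locales
      (fact eps bilinear_g g_commute nondegenerate_g linear_compose_neg[OF linear_J]
       | simp add: g_simps J_simps J_skew)+
  have k: "kaehler_curvature \<epsilon> g (\<lambda>u. - J u) R"
  proof (intro kaehler_curvature.intro[OF h] kaehler_curvature_axioms.intro)
    show "R u v (- J w) = - J (R u v w)" for u v w by (simp add: R_simps R_J)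
  qed (fact R_linear R_anti bianchi R_skew)+
  have lt: "hermitian_space.lin_type \<epsilon> g (\<lambda>u. - J u) = lin_type"
    by (intro ext) (simp add: hermitian_space.lin_type_def[OF h] lin_type_def g_simps)
  have d: "degenerate_structure \<epsilon> g (\<lambda>u. - J u) R \<xi> \<zeta>"
    by (intro degenerate_structure.intro[OF k] degenerate_structure_axioms.intro, unfold lt)
      (fact xi_null xi_nonzero dim second_bianchi)+
  have q: "degenerate_structure.Q \<epsilon> g (\<lambda>u. - J u) \<xi> \<zeta> = Q"
    by (intro ext) (simp add: degenerate_structure.Q_def[OF d] Q_def lt)
  show ?thesis
    by (intro homogeneous_model.intro[OF d] homogeneous_model_axioms.intro, unfold q)
      (fact R_xi R_zeta R_parallel)+
qed

lemma ricci_formula: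
  "\<exists>l. \<zeta> = l *\<^sub>R \<xi> \<and> (\<forall>v w. tr (\<lambda>u. R u v w) =
    - (real CARD('n) + 2) * l * (\<epsilon> + 2 * l) * (\<theta> v * \<theta> w - \<epsilon> * (\<theta> (J v) * \<theta> (J w))))"
proof (rule obtain_independent_or_eigenvector)
  fix f assume "\<theta> f = 1" "\<theta> (J f) = 0"
  from ricci_formula_independent[OF this] show ?thesis by (simp add: ric_def)
next
  fix k assume k: "\<epsilon> = 1" "k \<in> {-1, 1}" "J \<xi> = k *\<^sub>R \<xi>"
  have "\<exists>l. \<zeta> = l *\<^sub>R \<xi> \<and> (\<forall>v w. tr (\<lambda>u. R u v w) = 0)"
  proof (cases "k = 1")
    case True
    with k show ?thesis by (intro eigenvector_case) auto
  next
    case False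
    interpret m: homogeneous_model \<epsilon> g "\<lambda>u. - J u" R \<xi> \<zeta> by (rule minus_J_model[OF k(1)])
    from False k show ?thesis by (intro m.eigenvector_case) auto
  qed
  moreover have "\<theta> (J v) * \<theta> (J w) = \<theta> v * \<theta> w" for v w
  proof -
    have "\<theta> (J v) = - k * \<theta> v" for v using J_skew[of \<xi> v] k(3) by (simp add: g_simps)
    then show ?thesis using k(2) by auto
  qed
  ultimately show ?thesis by (simp add: k(1))
qed

end

section \<open>Connections in a chart\<close>

lemma dir_deriv_bilinear:
  fixes \<beta> :: "real^'m::finite \<Rightarrow> real^'n::finite \<Rightarrow> real^'n \<Rightarrow> 'c::real_normed_vector"
  assumes U: "open U" "x \<in> U" and bil: "\<And>y. y \<in> U \<Longrightarrow> bilinear (\<beta> y)"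
    and sm: "\<And>a c. smooth_on U (\<lambda>y. \<beta> y a c)" "smooth_on U p" "smooth_on U q"
  shows "dir_deriv (\<lambda>y. \<beta> y (p y) (q y)) x u = dir_deriv (\<lambda>y. \<beta> y (p x) (q x)) x u
    + \<beta> x (dir_deriv p x u) (q x) + \<beta> x (p x) (dir_deriv q x u)"
proof -
  have l: "linear (\<beta> y a)" "linear (\<lambda>c. \<beta> y c a)" if "y \<in> U" for y a
    using bil[OF that] by (auto simp: bilinear_def)
  have s: "smooth_on U (\<lambda>y. \<beta> y a (q y))" for a
    by (rule smooth_on_apply[OF U(1) l(1) sm(1) sm(3)])
  have "dir_deriv (\<lambda>y. \<beta> y (p y) (q y)) x u = dir_deriv (\<lambda>y. \<beta> y (p x) (q y)) x u + \<beta> x (dir_deriv p x u) (q x)"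
    by (rule dir_deriv_apply[where T = "\<lambda>y a. \<beta> y a (q y)", OF U l(2)])
      (use s sm U in \<open>auto intro: smooth_on_differentiable\<close>)
  also have "dir_deriv (\<lambda>y. \<beta> y (p x) (q y)) x u =
      dir_deriv (\<lambda>y. \<beta> y (p x) (q x)) x u + \<beta> x (p x) (dir_deriv q x u)"
    by (rule dir_deriv_apply[where T = "\<lambda>y. \<beta> y (p x)", OF U l(1)])
      (use sm U in \<open>auto intro: smooth_on_differentiable\<close>)
  finally show ?thesis by simp
qed

lemma linear_dir_deriv_param:
  fixes T :: "real^'m::finite \<Rightarrow> 'b::real_vector \<Rightarrow> 'c::real_normed_vector"
  assumes U: "open U" "x \<in> U" and "\<And>y. y \<in> U \<Longrightarrow> linear (T y)" "\<And>a. smooth_on U (\<lambda>y. T y a)"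
  shows "linear (\<lambda>a. dir_deriv (\<lambda>y. T y a) x u)"
proof (rule linearI)
  have d: "(\<lambda>y. T y a) differentiable (at x)" for a
    using assms(4) U(2) by (rule smooth_on_differentiable)
  show "dir_deriv (\<lambda>y. T y (a + c)) x u = dir_deriv (\<lambda>y. T y a) x u + dir_deriv (\<lambda>y. T y c) x u" for a c
    unfolding dir_deriv_add[OF d d, symmetric]
    by (rule dir_deriv_cong[OF U]) (simp add: linear_add[OF assms(3)])
  show "dir_deriv (\<lambda>y. T y (r *\<^sub>R a)) x u = r *\<^sub>R dir_deriv (\<lambda>y. T y a) x u" for r a
    unfolding dir_deriv_cmul[OF d, symmetric]
    by (rule dir_deriv_cong[OF U]) (simp add: linear_scale[OF assms(3)])
qed

text \<open>Meant for the Levi-Civita symbols, which are known only through their pairing with the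
  metric. Cramer's rule writes such a vector as a quotient of determinants with smooth
  entries.\<close>

lemma smooth_on_solution:
  fixes \<beta> :: "real^'m::finite \<Rightarrow> 'n::finite form2"
  assumes U: "open U" and bil: "\<And>y. y \<in> U \<Longrightarrow> bilinear (\<beta> y)"
    and nd: "\<And>y. y \<in> U \<Longrightarrow> nondegenerate (\<beta> y)"
    and sm: "\<And>a c. smooth_on U (\<lambda>y. \<beta> y a c)" "\<And>w. smooth_on U (\<lambda>y. K y w)"
    and h: "\<And>y w. y \<in> U \<Longrightarrow> \<beta> y (h y) w = K y w"
  shows "smooth_on U h"
proof -
  define A where "A y = (\<chi> i j. \<beta> y (axis j 1) (axis i 1))" for y
  have lin: "linear (\<beta> y a)" "linear (\<lambda>c. \<beta> y c a)" if "y \<in> U" for y a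
    using bil[OF that] by (auto simp: bilinear_def)
  have mult: "A y *v v = (\<chi> i. \<beta> y v (axis i 1))" if "y \<in> U" for y v
    using linear_sum_axis[OF lin(2)[OF that], of v]
    by (simp add: A_def matrix_vector_mult_def vec_eq_iff mult.commute)
  have det: "det (A y) \<noteq> 0" if y: "y \<in> U" for y
  proof -
    have "v = 0" if "A y *v v = 0" for v
    proof -
      have "\<beta> y v (axis i 1) = 0" for i using that by (simp add: mult[OF y] vec_eq_iff)
      then have "\<beta> y v w = 0" for w using linear_sum_axis[OF lin(1)[OF y], of v w] by simp
      then show ?thesis using nd[OF y] by (simp add: nondegenerate_def)
    qed
    then show ?thesis
      by (metis invertible_det_nz invertible_left_inverse matrix_left_invertible_ker)
  qed
  define B where "B y k = (\<chi> i j. if j = k then K y (axis i 1) else A y $ i $ j)" for y k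
  have eq: "h y $ k = det (B y k) / det (A y)" if "y \<in> U" for y k
  proof -
    have "A y *v h y = (\<chi> i. K y (axis i 1))" by (simp add: mult[OF that] h[OF that])
    then show ?thesis using cramer[OF det[OF that]] by (simp add: B_def cong: if_cong)
  qed
  have smA: "smooth_on U (\<lambda>y. det (A y))"
    unfolding det_def A_def
    by (intro smooth_on_sum smooth_on_mult smooth_on_prod smooth_on_const U) (simp add: sm)
  have "smooth_on U (\<lambda>y. if j = k then K y (axis i 1) else A y $ i $ j)" for i j k
    by (cases "j = k") (simp_all add: A_def sm)
  then have smB: "smooth_on U (\<lambda>y. det (B y k))" for k
    unfolding det_def B_def
    by (intro smooth_on_sum smooth_on_mult smooth_on_prod smooth_on_const U) simp
  show ?thesis
  proof (rule smooth_on_vec[OF U])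
    show "smooth_on U (\<lambda>y. h y $ k)" for k
      using smooth_on_divide[OF U smB smA det] by (subst smooth_on_cong[OF U eq])
  qed
qed

text \<open>Serves both the Levi-Civita connection and \<open>\<nabla> - S\<close>, which may have
  torsion; symmetry of \<open>C\<close> is assumed only in the second Bianchi identity.\<close>

locale connection_chart =
  fixes U :: "(real^'n::finite) set" and C :: "real^'n \<Rightarrow> 'n bil"
  assumes open_U: "open U" and bilinear_C: "y \<in> U \<Longrightarrow> bilinear (C y)"
    and smooth_C: "smooth_on U (\<lambda>y. C y u v)"
begin

lemma linear_C: "y \<in> U \<Longrightarrow> linear (C y u)" "y \<in> U \<Longrightarrow> linear (\<lambda>u. C y u v)"
  using bilinear_C by (auto simp: bilinear_def)

abbreviation dC :: "real^'n \<Rightarrow> 'n tril" where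
  "dC x u v w \<equiv> dir_deriv (\<lambda>y. C y v w) x u"

lemmas C_simps = linear_add[OF linear_C(1)] linear_add[OF linear_C(2)]
  linear_diff[OF linear_C(1)] linear_diff[OF linear_C(2)]
  linear_neg[OF linear_C(1)] linear_neg[OF linear_C(2)]
  linear_scale[OF linear_C(1)] linear_scale[OF linear_C(2)]

lemma linear_dC:
  assumes "x \<in> U"
  shows "linear (\<lambda>u. dC x u v w)" "linear (\<lambda>v. dC x u v w)" "linear (\<lambda>w. dC x u v w)"
proof -
  show "linear (\<lambda>u. dC x u v w)"
    by (rule linear_dir_deriv) (rule smooth_on_differentiable[OF smooth_C assms])
  show "linear (\<lambda>v. dC x u v w)"
    by (rule linear_dir_deriv_param[where T = "\<lambda>y v. C y v w", OF open_U assms linear_C(2) smooth_C])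
  show "linear (\<lambda>w. dC x u v w)"
    by (rule linear_dir_deriv_param[where T = "\<lambda>y. C y v", OF open_U assms linear_C(1) smooth_C])
qed

lemmas dC_simps = linear_add[OF linear_dC(1)] linear_add[OF linear_dC(2)] linear_add[OF linear_dC(3)]
  linear_scale[OF linear_dC(1)] linear_scale[OF linear_dC(2)] linear_scale[OF linear_dC(3)]

lemma linear_curvature:
  assumes "x \<in> U"
  shows "linear (\<lambda>u. curvature C x u v w)" "linear (\<lambda>v. curvature C x u v w)"
    "linear (\<lambda>w. curvature C x u v w)"
  by (auto simp: linear_iff curvature_def C_simps dC_simps assms algebra_simps)

lemma smooth_apply_C: "smooth_on U h \<Longrightarrow> smooth_on U (\<lambda>y. C y u (h y))"
  by (rule smooth_on_apply[OF open_U linear_C(1) smooth_C])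

lemma dir_deriv_apply_C:
  assumes "x \<in> U" "smooth_on U h"
  shows "dir_deriv (\<lambda>y. C y v (h y)) x u = dC x u v (h x) + C x v (dir_deriv h x u)"
  by (rule dir_deriv_apply[OF open_U assms(1) linear_C(1)])
    (use assms smooth_C in \<open>auto intro: smooth_on_differentiable\<close>)

lemma smooth_dC: "smooth_on U (\<lambda>y. dC y u v w)"
  by (rule smooth_on_dir_deriv[OF smooth_C])

lemma smooth_curvature: "smooth_on U (\<lambda>y. curvature C y u v w)"
  unfolding curvature_def
  by (intro smooth_on_add smooth_on_diff open_U smooth_dC smooth_apply_C smooth_C)

lemma curvature_anti: "curvature C x u v w = - curvature C x v u w"
  by (simp add: curvature_def)

text \<open>The equation of parallelism is differentiated once more and antisymmetrized: ordinary
  second derivatives commute, and what remains is the curvature. The lemmas on endomorphisms, forms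
  and (1,3) tensors follow the same scheme.\<close>

lemma curvature_parallel_vector:
  assumes V: "smooth_on U V" and par: "\<And>y u. y \<in> U \<Longrightarrow> dir_deriv V y u = - C y u (V y)" and x: "x \<in> U"
  shows "curvature C x u v (V x) = 0"
proof -
  have DD: "dir_deriv (\<lambda>y. dir_deriv V y v) x u = - dC x u v (V x) + C x v (C x u (V x))" for u v
  proof -
    have "dir_deriv (\<lambda>y. dir_deriv V y v) x u = dir_deriv (\<lambda>y. (-1) *\<^sub>R C y v (V y)) x u"
      by (rule dir_deriv_cong[OF open_U x]) (simp add: par)
    also have "\<dots> = - (dC x u v (V x) + C x v (dir_deriv V x u))"
      by (subst dir_deriv_cmul)
        (simp_all add: dir_deriv_apply_C[OF x V] smooth_on_differentiable[OF smooth_apply_C[OF V] x])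
    finally show ?thesis by (simp add: par x C_simps)
  qed
  have "curvature C x u v (V x) = dir_deriv (\<lambda>y. dir_deriv V y u) x v - dir_deriv (\<lambda>y. dir_deriv V y v) x u"
    by (simp add: DD curvature_def algebra_simps)
  then show ?thesis by (simp add: dir_deriv_commute[OF open_U V x, of u v])
qed

lemma curvature_parallel_endomorphism:
  assumes lin: "\<And>y. y \<in> U \<Longrightarrow> linear (F y)" and F: "\<And>a. smooth_on U (\<lambda>y. F y a)"
    and par: "\<And>y u a. y \<in> U \<Longrightarrow> cov_1_1 C F y u a = 0" and x: "x \<in> U"
  shows "curvature C x u v (F x a) = F x (curvature C x u v a)"
proof -
  have D: "dir_deriv (\<lambda>y. F y a) y u = F y (C y u a) - C y u (F y a)" if "y \<in> U" for y u a
    using par[OF that, of u a] by (simp add: cov_1_1_def algebra_simps)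
  have sFC: "smooth_on U (\<lambda>y. F y (C y v a))" for v
    by (rule smooth_on_apply[OF open_U lin F smooth_C])
  have DD: "dir_deriv (\<lambda>y. dir_deriv (\<lambda>y. F y a) y v) x u =
      F x (C x u (C x v a)) - C x u (F x (C x v a)) + F x (dC x u v a)
      - dC x u v (F x a) - C x v (F x (C x u a) - C x u (F x a))" for u v
  proof -
    have "dir_deriv (\<lambda>y. dir_deriv (\<lambda>y. F y a) y v) x u = dir_deriv (\<lambda>y. F y (C y v a) - C y v (F y a)) x u"
      by (rule dir_deriv_cong[OF open_U x]) (simp add: D)
    also have "\<dots> = dir_deriv (\<lambda>y. F y (C y v a)) x u - dir_deriv (\<lambda>y. C y v (F y a)) x u"
      by (intro dir_deriv_diff smooth_on_differentiable[OF _ x] sFC smooth_apply_C F)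
    also have "dir_deriv (\<lambda>y. F y (C y v a)) x u =
        dir_deriv (\<lambda>y. F y (C x v a)) x u + F x (dC x u v a)"
      by (rule dir_deriv_apply[OF open_U x lin])
        (auto intro: smooth_on_differentiable[OF _ x] F smooth_C)
    finally show ?thesis by (simp add: D x dir_deriv_apply_C[OF x F])
  qed
  have "curvature C x u v (F x a) - F x (curvature C x u v a) =
      dir_deriv (\<lambda>y. dir_deriv (\<lambda>y. F y a) y u) x v - dir_deriv (\<lambda>y. dir_deriv (\<lambda>y. F y a) y v) x u"
    by (simp add: DD curvature_def C_simps x linear_add[OF lin] linear_diff[OF lin] algebra_simps)
  then show ?thesis by (simp add: dir_deriv_commute[OF open_U F x, of a u v])
qed

lemma curvature_parallel_form:
  assumes bil: "\<And>y. y \<in> U \<Longrightarrow> bilinear (\<beta> y)" and sm: "\<And>a c. smooth_on U (\<lambda>y. \<beta> y a c)"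
    and par: "\<And>y u a c. y \<in> U \<Longrightarrow> cov_0_2 C \<beta> y u a c = 0" and x: "x \<in> U"
  shows "\<beta> x (curvature C x u v a) c = - \<beta> x a (curvature C x u v c)"
proof -
  have lin: "linear (\<beta> y a)" "linear (\<lambda>c. \<beta> y c a)" if "y \<in> U" for y a
    using bil[OF that] by (auto simp: bilinear_def)
  note l = linear_add[OF lin(1)] linear_add[OF lin(2)] linear_diff[OF lin(1)] linear_diff[OF lin(2)]
  have D: "dir_deriv (\<lambda>y. \<beta> y a c) y u = \<beta> y (C y u a) c + \<beta> y a (C y u c)" if "y \<in> U" for y u a c
    using par[OF that, of u a c] by (simp add: cov_0_2_def algebra_simps)
  have s: "smooth_on U (\<lambda>y. \<beta> y (C y v a) c)" "smooth_on U (\<lambda>y. \<beta> y a (C y v c))" for v a c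
    using smooth_on_apply[OF open_U lin(2) sm smooth_C] smooth_on_apply[OF open_U lin(1) sm smooth_C] by auto
  have "dir_deriv (\<lambda>y. dir_deriv (\<lambda>y. \<beta> y a c) y v) x u =
      \<beta> x (C x u (C x v a)) c + \<beta> x (C x v a) (C x u c) + \<beta> x (dC x u v a) c
      + \<beta> x (C x u a) (C x v c) + \<beta> x a (C x u (C x v c)) + \<beta> x a (dC x u v c)" for u v
  proof -
    have "dir_deriv (\<lambda>y. dir_deriv (\<lambda>y. \<beta> y a c) y v) x u = dir_deriv (\<lambda>y. \<beta> y (C y v a) c + \<beta> y a (C y v c)) x u"
      by (rule dir_deriv_cong[OF open_U x]) (simp add: D)
    also have "\<dots> = dir_deriv (\<lambda>y. \<beta> y (C y v a) c) x u + dir_deriv (\<lambda>y. \<beta> y a (C y v c)) x u"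
      by (intro dir_deriv_add smooth_on_differentiable[OF _ x] s)
    also have "dir_deriv (\<lambda>y. \<beta> y (C y v a) c) x u =
        dir_deriv (\<lambda>y. \<beta> y (C x v a) c) x u + \<beta> x (dC x u v a) c"
      by (rule dir_deriv_apply[where T = "\<lambda>y p. \<beta> y p c", OF open_U x lin(2)])
        (auto intro: smooth_on_differentiable[OF _ x] sm smooth_C)
    also have "dir_deriv (\<lambda>y. \<beta> y a (C y v c)) x u =
        dir_deriv (\<lambda>y. \<beta> y a (C x v c)) x u + \<beta> x a (dC x u v c)"
      by (rule dir_deriv_apply[OF open_U x lin(1)])
        (auto intro: smooth_on_differentiable[OF _ x] sm smooth_C)
    finally show ?thesis by (simp add: D x)
  qed
  from this[of v u] this[of u v] show ?thesis
    using dir_deriv_commute[OF open_U sm x, of a c u v]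
    by (simp add: curvature_def x l algebra_simps)
qed

lemma curvature_parallel_tensor_1_3:
  assumes lin: "\<And>y a c. y \<in> U \<Longrightarrow> linear (\<lambda>p. T y p a c)" "\<And>y a c. y \<in> U \<Longrightarrow> linear (\<lambda>p. T y a p c)"
      "\<And>y a c. y \<in> U \<Longrightarrow> linear (\<lambda>p. T y a c p)"
    and sm: "\<And>a b c. smooth_on U (\<lambda>y. T y a b c)"
    and par: "\<And>y u a b c. y \<in> U \<Longrightarrow> cov_1_3 C T y u a b c = 0" and x: "x \<in> U"
  shows "curvature C x u v (T x a b c) - T x (curvature C x u v a) b c
    - T x a (curvature C x u v b) c - T x a b (curvature C x u v c) = 0"
proof -
  note l = linear_add[OF lin(1)] linear_add[OF lin(2)] linear_add[OF lin(3)]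
    linear_diff[OF lin(1)] linear_diff[OF lin(2)] linear_diff[OF lin(3)]
  have D: "dir_deriv (\<lambda>y. T y a b c) y u =
      T y (C y u a) b c + T y a (C y u b) c + T y a b (C y u c) - C y u (T y a b c)" if "y \<in> U" for y u a b c
    using par[OF that, of u a b c] by (simp add: cov_1_3_def algebra_simps)
  have s: "smooth_on U (\<lambda>y. T y (C y v a) b c)" "smooth_on U (\<lambda>y. T y a (C y v b) c)"
    "smooth_on U (\<lambda>y. T y a b (C y v c))" for v a b c
    using smooth_on_apply[OF open_U lin(1) sm smooth_C] smooth_on_apply[OF open_U lin(2) sm smooth_C]
      smooth_on_apply[OF open_U lin(3) sm smooth_C] by auto
  have DD: "dir_deriv (\<lambda>y. dir_deriv (\<lambda>y. T y a b c) y v) x u =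
      (T x (C x u (C x v a)) b c + T x (C x v a) (C x u b) c + T x (C x v a) b (C x u c)
        - C x u (T x (C x v a) b c)) + T x (dC x u v a) b c
      + (T x (C x u a) (C x v b) c + T x a (C x u (C x v b)) c + T x a (C x v b) (C x u c)
        - C x u (T x a (C x v b) c)) + T x a (dC x u v b) c
      + (T x (C x u a) b (C x v c) + T x a (C x u b) (C x v c) + T x a b (C x u (C x v c))
        - C x u (T x a b (C x v c))) + T x a b (dC x u v c)
      - dC x u v (T x a b c)
      - C x v (T x (C x u a) b c + T x a (C x u b) c + T x a b (C x u c) - C x u (T x a b c))" for u v
  proof -
    have "dir_deriv (\<lambda>y. dir_deriv (\<lambda>y. T y a b c) y v) x u =
        dir_deriv (\<lambda>y. T y (C y v a) b c + T y a (C y v b) c + T y a b (C y v c) - C y v (T y a b c)) x u"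
      by (rule dir_deriv_cong[OF open_U x]) (simp add: D)
    also have "\<dots> = dir_deriv (\<lambda>y. T y (C y v a) b c) x u + dir_deriv (\<lambda>y. T y a (C y v b) c) x u
        + dir_deriv (\<lambda>y. T y a b (C y v c)) x u - dir_deriv (\<lambda>y. C y v (T y a b c)) x u"
      by (subst dir_deriv_diff; (subst dir_deriv_add)?; (subst dir_deriv_add)?)
        (auto intro!: smooth_on_differentiable[OF _ x] smooth_on_add open_U s smooth_apply_C sm)
    also have "dir_deriv (\<lambda>y. T y (C y v a) b c) x u =
        dir_deriv (\<lambda>y. T y (C x v a) b c) x u + T x (dC x u v a) b c"
      by (rule dir_deriv_apply[where T = "\<lambda>y p. T y p b c", OF open_U x lin(1)])
        (auto intro: smooth_on_differentiable[OF _ x] sm smooth_C)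
    also have "dir_deriv (\<lambda>y. T y a (C y v b) c) x u =
        dir_deriv (\<lambda>y. T y a (C x v b) c) x u + T x a (dC x u v b) c"
      by (rule dir_deriv_apply[where T = "\<lambda>y p. T y a p c", OF open_U x lin(2)])
        (auto intro: smooth_on_differentiable[OF _ x] sm smooth_C)
    also have "dir_deriv (\<lambda>y. T y a b (C y v c)) x u =
        dir_deriv (\<lambda>y. T y a b (C x v c)) x u + T x a b (dC x u v c)"
      by (rule dir_deriv_apply[where T = "\<lambda>y p. T y a b p", OF open_U x lin(3)])
        (auto intro: smooth_on_differentiable[OF _ x] sm smooth_C)
    finally show ?thesis by (simp add: D x dir_deriv_apply_C[OF x sm] algebra_simps)
  qed
  have "curvature C x u v (T x a b c) - T x (curvature C x u v a) b c
      - T x a (curvature C x u v b) c - T x a b (curvature C x u v c) =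
      dir_deriv (\<lambda>y. dir_deriv (\<lambda>y. T y a b c) y u) x v - dir_deriv (\<lambda>y. dir_deriv (\<lambda>y. T y a b c) y v) x u"
    by (simp add: DD curvature_def x l C_simps algebra_simps)
  then show ?thesis by (simp add: dir_deriv_commute[OF open_U sm x, of a b c u v])
qed

text \<open>In the cyclic sum the second derivatives of \<open>C\<close> cancel because they
  commute. The terms with \<open>C x u v\<close> inside the curvature cancel in pairs by symmetry of
  \<open>C\<close>.\<close>

lemma second_bianchi_identity:
  assumes tf: "\<And>u v. C x u v = C x v u" and x: "x \<in> U"
  shows "cov_1_3 C (curvature C) x u v w z + cov_1_3 C (curvature C) x v w u z
    + cov_1_3 C (curvature C) x w u v z = 0"
proof -
  have sd: "dir_deriv (\<lambda>y. curvature C y v w z) x u =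
      dir_deriv (\<lambda>y. dC y v w z) x u - dir_deriv (\<lambda>y. dC y w v z) x u
      + (dC x u v (C x w z) + C x v (dC x u w z)) - (dC x u w (C x v z) + C x w (dC x u v z))" for u v w
    unfolding curvature_def
    by (simp add: dir_deriv_diff dir_deriv_add dir_deriv_apply_C x smooth_C
        smooth_on_differentiable[OF _ x] smooth_on_add smooth_on_diff open_U smooth_dC smooth_apply_C)
  have cm: "dir_deriv (\<lambda>y. dC y v w z) x u = dir_deriv (\<lambda>y. dC y u w z) x v" for u v w
    by (rule dir_deriv_commute[OF open_U smooth_C x])
  have a: "curvature C x w (C x u v) z = - curvature C x (C x u v) w z" for u v w
    by (rule curvature_anti)
  have e: "C x u (curvature C x v w z) = C x u (dC x v w z) - C x u (dC x w v z)
      + C x u (C x v (C x w z)) - C x u (C x w (C x v z))" for u v w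
    by (simp add: curvature_def C_simps x)
  have e': "curvature C x v w (C x u z) = dC x v w (C x u z) - dC x w v (C x u z)
      + C x v (C x w (C x u z)) - C x w (C x v (C x u z))" for u v w
    by (simp add: curvature_def)
  show ?thesis
    unfolding cov_1_3_def sd a e e'
    unfolding cm[where v = v and u = u] cm[where v = w and u = v] cm[where v = w and u = u]
      tf[of v u] tf[of w u] tf[of w v]
    by simp
qed

end

section \<open>Homogeneous structures in a chart\<close>

locale metric_chart =
  fixes U :: "(real^'n::finite) set" and b :: "real^'n \<Rightarrow> 'n form2"
  assumes open_U: "open U" and bilinear_b: "y \<in> U \<Longrightarrow> bilinear (b y)"
    and b_commute: "y \<in> U \<Longrightarrow> b y u v = b y v u" and nondegenerate_b: "y \<in> U \<Longrightarrow> nondegenerate (b y)"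
    and smooth_b: "smooth_on U (\<lambda>y. b y u v)"
begin

abbreviation "\<Gamma> \<equiv> levi_civita b"

lemma linear_b: "y \<in> U \<Longrightarrow> linear (b y u)" "y \<in> U \<Longrightarrow> linear (\<lambda>u. b y u v)"
  using bilinear_b by (auto simp: bilinear_def)

lemma levi_civita:
  assumes "y \<in> U"
  shows "bilinear (\<Gamma> y)" "\<Gamma> y u v = \<Gamma> y v u" "cov_0_2 \<Gamma> b y u v w = 0"
proof -
  have "\<exists>!\<Gamma>. bilinear \<Gamma> \<and> (\<forall>u v. \<Gamma> u v = \<Gamma> v u) \<and> (\<forall>u v w. cov_0_2 (\<lambda>_. \<Gamma>) b y u v w = 0)"
    by (rule levi_civita_wd[OF open_U assms])
      (use assms in \<open>auto intro: bilinear_b b_commute nondegenerate_b smooth_on_differentiable[OF smooth_b]\<close>)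
  from theI'[OF this, folded levi_civita_def[of b y]]
  show "bilinear (\<Gamma> y)" "\<Gamma> y u v = \<Gamma> y v u" "cov_0_2 \<Gamma> b y u v w = 0"
    unfolding cov_0_2_def by blast+
qed

lemma koszul:
  assumes "y \<in> U"
  shows "b y (\<Gamma> y u v) w = (1/2) * (dir_deriv (\<lambda>y. b y v w) y u + dir_deriv (\<lambda>y. b y u w) y v
    - dir_deriv (\<lambda>y. b y u v) y w)"
proof -
  have "dir_deriv (\<lambda>y. b y v w) y u = b y (\<Gamma> y u v) w + b y (\<Gamma> y u w) v" for u v w
    using levi_civita(3)[OF assms, of u v w] b_commute[OF assms, of v "\<Gamma> y u w"]
    by (simp add: cov_0_2_def)
  then show ?thesis
    using levi_civita(2)[OF assms, of v u] levi_civita(2)[OF assms, of w u] levi_civita(2)[OF assms, of w v]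
    by simp
qed

lemma smooth_levi_civita: "smooth_on U (\<lambda>y. \<Gamma> y u v)"
proof (rule smooth_on_solution[OF open_U bilinear_b nondegenerate_b smooth_b])
  show "smooth_on U (\<lambda>y. (1/2) * (dir_deriv (\<lambda>y. b y v w) y u + dir_deriv (\<lambda>y. b y u w) y v
    - dir_deriv (\<lambda>y. b y u v) y w))" for w
    by (intro smooth_on_mult smooth_on_add smooth_on_diff smooth_on_const open_U smooth_on_dir_deriv smooth_b)
qed (simp_all add: koszul)

sublocale levi_civita: connection_chart U \<Gamma>
  by unfold_locales (rule open_U levi_civita smooth_levi_civita | assumption)+

lemma first_bianchi:
  assumes "x \<in> U"
  shows "riemann b x u v w + riemann b x v w u + riemann b x w u v = 0"
proof -
  have "levi_civita.dC x u v w = levi_civita.dC x u w v" for u v w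
    by (rule dir_deriv_cong[OF open_U assms]) (rule levi_civita(2))
  then show ?thesis
    unfolding riemann_def curvature_def
    using levi_civita(2)[OF assms, of v u] levi_civita(2)[OF assms, of w u] levi_civita(2)[OF assms, of w v]
    by simp
qed

end

text \<open>\<open>C\<close> is a parameter tied to \<open>S\<close> by \<open>C_def\<close>, so
  that the locale can be instantiated directly with \<open>tilde_connection\<close>.\<close>

locale homogeneous_chart = metric_chart U b
  for U :: "(real^'n::finite) set" and b :: "real^'n \<Rightarrow> 'n form2" +
  fixes \<epsilon> :: real and J :: "real^'n \<Rightarrow> 'n endo" and S :: "real^'n \<Rightarrow> 'n bil" and \<xi> \<zeta> :: "real^'n \<Rightarrow> real^'n"
    and C :: "real^'n \<Rightarrow> 'n bil"
  assumes C_def: "C = (\<lambda>y u v. levi_civita b y u v - S y u v)"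
    and eps: "\<epsilon> \<in> {-1, 1}" and dim: "CARD('n) \<ge> 4"
    and linear_J: "y \<in> U \<Longrightarrow> linear (J y)" and smooth_J: "smooth_on U (\<lambda>y. J y u)"
    and J_skew: "y \<in> U \<Longrightarrow> b y (J y u) v + b y u (J y v) = 0"
    and J_J: "y \<in> U \<Longrightarrow> J y (J y u) = \<epsilon> *\<^sub>R u"
    and J_parallel: "y \<in> U \<Longrightarrow> cov_1_1 (levi_civita b) J y u v = 0"
    and bilinear_S: "y \<in> U \<Longrightarrow> bilinear (S y)" and smooth_S: "smooth_on U (\<lambda>y. S y u v)"
    and b_parallel: "y \<in> U \<Longrightarrow> cov_0_2 C b y u v w = 0"
    and R_parallel: "y \<in> U \<Longrightarrow> cov_1_3 C (riemann b) y u v w z = 0"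
    and S_parallel: "y \<in> U \<Longrightarrow> cov_1_2 C S y u v w = 0"
    and J_parallel': "y \<in> U \<Longrightarrow> cov_1_1 C J y u v = 0"
    and smooth_xi: "smooth_on U \<xi>" and smooth_zeta: "smooth_on U \<zeta>"
    and S_eq: "y \<in> U \<Longrightarrow> S y u v =
          b y u v *\<^sub>R \<xi> y - b y (\<xi> y) v *\<^sub>R u
          + (\<epsilon> * b y u (J y v)) *\<^sub>R J y (\<xi> y)
          - (\<epsilon> * b y (\<xi> y) (J y v)) *\<^sub>R J y u
          - (2 * b y (\<zeta> y) (J y u)) *\<^sub>R J y v"
begin

lemma linear_S: "y \<in> U \<Longrightarrow> linear (S y u)" "y \<in> U \<Longrightarrow> linear (\<lambda>u. S y u v)"
  using bilinear_S by (auto simp: bilinear_def)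

lemmas S_simps = linear_add[OF linear_S(1)] linear_add[OF linear_S(2)]
  linear_diff[OF linear_S(1)] linear_diff[OF linear_S(2)]

sublocale tilde: connection_chart U C
  by unfold_locales
    (auto simp: C_def open_U bilinear_def levi_civita.linear_C linear_S
      intro!: linear_compose_sub smooth_on_diff smooth_levi_civita smooth_S)

lemma hermitian:
  assumes "y \<in> U"
  shows "hermitian_space \<epsilon> (b y) (J y)"
proof (rule hermitian_space.intro)
  show "b y (J y u) v = - b y u (J y v)" for u v using J_skew[OF assms, of u v] by linarith
qed (fact eps bilinear_b[OF assms] b_commute[OF assms] nondegenerate_b[OF assms] linear_J[OF assms] J_J[OF assms])+

lemma S_lin_type: "y \<in> U \<Longrightarrow> S y = hermitian_space.lin_type \<epsilon> (b y) (J y) (\<xi> y) (\<zeta> y)"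
  by (intro ext) (simp add: S_eq hermitian_space.lin_type_def[OF hermitian])

text \<open>As \<open>b\<close> and \<open>J\<close> are parallel for \<open>C\<close>, the
  derivative of \<open>S\<close> is again of linear type, with \<open>\<xi>\<close> and
  \<open>\<zeta>\<close> replaced by their covariant derivatives. It is 0, so
  \<open>lin_type_eq_0D\<close> applies.\<close>

lemma xi_zeta_parallel:
  assumes x: "x \<in> U"
  shows "dir_deriv \<xi> x u = - C x u (\<xi> x)" "dir_deriv \<zeta> x u = - C x u (\<zeta> x)"
proof -
  interpret h: hermitian_space \<epsilon> "b x" "J x" by (rule hermitian[OF x])
  have db: "dir_deriv (\<lambda>y. b y v w) x u = b x (C x u v) w + b x v (C x u w)" for v w
    using b_parallel[OF x, of u v w] by (simp add: cov_0_2_def)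
  have dJ: "dir_deriv (\<lambda>y. J y v) x u = J x (C x u v) - C x u (J x v)" for v
    using J_parallel'[OF x, of u v] by (simp add: cov_1_1_def algebra_simps)
  have sJ: "smooth_on U (\<lambda>y. J y (p y))" if "smooth_on U p" for p
    by (rule smooth_on_apply[OF open_U linear_J smooth_J that])
  have sb: "smooth_on U (\<lambda>y. b y (p y) (q y))" if "smooth_on U p" "smooth_on U q" for p q
    by (rule smooth_on_apply[OF open_U linear_b(1) _ that(2)])
      (assumption, rule smooth_on_apply[OF open_U linear_b(2) smooth_b that(1)])
  have db2: "dir_deriv (\<lambda>y. b y (p y) (q y)) x u = b x (C x u (p x)) (q x) + b x (p x) (C x u (q x))
      + b x (dir_deriv p x u) (q x) + b x (p x) (dir_deriv q x u)"
    if "smooth_on U p" "smooth_on U q" for p q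
    using dir_deriv_bilinear[where u = u, OF open_U x bilinear_b smooth_b that] by (simp add: db)
  have dJ2: "dir_deriv (\<lambda>y. J y (p y)) x u = J x (C x u (p x)) - C x u (J x (p x)) + J x (dir_deriv p x u)"
    if "smooth_on U p" for p
    using dir_deriv_apply[where u = u, OF open_U x linear_J smooth_on_differentiable[OF smooth_J x]
        smooth_on_differentiable[OF that x]] by (simp add: dJ)
  define \<xi>' \<zeta>' where "\<xi>' = dir_deriv \<xi> x u + C x u (\<xi> x)" and "\<zeta>' = dir_deriv \<zeta> x u + C x u (\<zeta> x)"
  have dxi: "dir_deriv \<xi> x u = \<xi>' - C x u (\<xi> x)" "dir_deriv \<zeta> x u = \<zeta>' - C x u (\<zeta> x)"
    by (simp_all add: \<xi>'_def \<zeta>'_def)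
  have const: "dir_deriv (\<lambda>y. v) x u = 0" for v :: "real^'n"
    by (simp add: dir_deriv_def)
  note sm = smooth_on_const smooth_xi smooth_zeta sJ sb
  have "h.lin_type \<xi>' \<zeta>' v w = 0" for v w
  proof -
    note d = smooth_on_differentiable[OF _ x]
    have "dir_deriv (\<lambda>y. S y v w) x u =
       dir_deriv (\<lambda>y. b y v w *\<^sub>R \<xi> y - b y (\<xi> y) w *\<^sub>R v
          + (\<epsilon> * b y v (J y w)) *\<^sub>R J y (\<xi> y)
          - (\<epsilon> * b y (\<xi> y) (J y w)) *\<^sub>R J y v
          - (2 * b y (\<zeta> y) (J y v)) *\<^sub>R J y w) x u"
      by (rule dir_deriv_cong[OF open_U x]) (rule S_eq)
    also have "\<dots> =
       dir_deriv (\<lambda>y. b y v w *\<^sub>R \<xi> y) x u - dir_deriv (\<lambda>y. b y (\<xi> y) w *\<^sub>R v) x u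
       + \<epsilon> *\<^sub>R dir_deriv (\<lambda>y. b y v (J y w) *\<^sub>R J y (\<xi> y)) x u
       - \<epsilon> *\<^sub>R dir_deriv (\<lambda>y. b y (\<xi> y) (J y w) *\<^sub>R J y v) x u
       - 2 *\<^sub>R dir_deriv (\<lambda>y. b y (\<zeta> y) (J y v) *\<^sub>R J y w) x u"
      by (simp only: scaleR_scaleR[symmetric] dir_deriv_add dir_deriv_diff dir_deriv_cmul d
          smooth_on_add smooth_on_diff smooth_on_scaleR sm open_U)
    also have "\<dots> =
       (b x v w *\<^sub>R dir_deriv \<xi> x u + dir_deriv (\<lambda>y. b y v w) x u *\<^sub>R \<xi> x)
       - (dir_deriv (\<lambda>y. b y (\<xi> y) w) x u *\<^sub>R v)
       + \<epsilon> *\<^sub>R (b x v (J x w) *\<^sub>R dir_deriv (\<lambda>y. J y (\<xi> y)) x u + dir_deriv (\<lambda>y. b y v (J y w)) x u *\<^sub>R J x (\<xi> x))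
       - \<epsilon> *\<^sub>R (b x (\<xi> x) (J x w) *\<^sub>R dir_deriv (\<lambda>y. J y v) x u + dir_deriv (\<lambda>y. b y (\<xi> y) (J y w)) x u *\<^sub>R J x v)
       - 2 *\<^sub>R (b x (\<zeta> x) (J x v) *\<^sub>R dir_deriv (\<lambda>y. J y w) x u + dir_deriv (\<lambda>y. b y (\<zeta> y) (J y v)) x u *\<^sub>R J x w)"
      by (simp add: dir_deriv_scaleR d sm const)
    finally have DS: "dir_deriv (\<lambda>y. S y v w) x u = \<dots>" .
    have "0 = cov_1_2 C S x u v w" by (simp add: S_parallel[OF x])
    also have "\<dots> = h.lin_type \<xi>' \<zeta>' v w"
      unfolding cov_1_2_def DS S_eq[OF x] h.lin_type_def
      by (simp add: db2 dJ2 db dJ sm dxi const h.g_simps h.J_simps tilde.C_simps x algebra_simps)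
    finally show ?thesis by simp
  qed
  then have "\<xi>' = 0" "\<zeta>' = 0" using h.lin_type_eq_0D[of \<xi>' \<zeta>'] dim by auto
  then show "dir_deriv \<xi> x u = - C x u (\<xi> x)" "dir_deriv \<zeta> x u = - C x u (\<zeta> x)"
    by (simp_all add: dxi)
qed

text \<open>Parallelism of \<open>S\<close> replaces its derivatives by algebraic terms in
  \<open>C\<close>. After cancellation the symmetry of the Levi-Civita symbols leaves only the
  commutator and bracket of \<open>S\<close>.\<close>

lemma curvature_tilde:
  assumes x: "x \<in> U"
  shows "curvature C x u v w = riemann b x u v w
    - (S x u (S x v w) - S x v (S x u w) - S x (S x u v - S x v u) w)"
proof -
  have dS: "dir_deriv (\<lambda>y. S y v w) x u = S x (C x u v) w + S x v (C x u w) - C x u (S x v w)" for u v w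
    using S_parallel[OF x, of u v w] by (simp add: cov_1_2_def algebra_simps)
  have dC: "tilde.dC x u v w = levi_civita.dC x u v w - dir_deriv (\<lambda>y. S y v w) x u" for u v w
    unfolding C_def
    by (intro dir_deriv_diff smooth_on_differentiable[OF _ x] smooth_levi_civita smooth_S)
  show ?thesis
    unfolding curvature_def riemann_def dC dS
    using levi_civita(2)[OF x, of v u]
    by (simp add: C_def S_simps levi_civita.C_simps x algebra_simps)
qed

lemma pointwise_model:
  assumes x: "x \<in> U" and "b x (\<xi> x) (\<xi> x) = 0" "\<xi> x \<noteq> 0"
  shows "homogeneous_model \<epsilon> (b x) (J x) (riemann b x) (\<xi> x) (\<zeta> x)"
proof -
  interpret h: hermitian_space \<epsilon> "b x" "J x" by (rule hermitian[OF x])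
  note lt = S_lin_type[OF x, symmetric]
  interpret k: kaehler_curvature \<epsilon> "b x" "J x" "riemann b x"
  proof (intro kaehler_curvature.intro[OF hermitian[OF x]] kaehler_curvature_axioms.intro)
    show "linear (\<lambda>u. riemann b x u v w)" for v w
      unfolding riemann_def by (rule levi_civita.linear_curvature[OF x])
    show "linear (\<lambda>v. riemann b x u v w)" for u w
      unfolding riemann_def by (rule levi_civita.linear_curvature[OF x])
    show "linear (\<lambda>w. riemann b x u v w)" for u v
      unfolding riemann_def by (rule levi_civita.linear_curvature[OF x])
    show "riemann b x u v w = - riemann b x v u w" for u v w
      unfolding riemann_def by (rule levi_civita.curvature_anti)
    show "riemann b x u v w + riemann b x v w u + riemann b x w u v = 0" for u v w
      by (rule first_bianchi[OF x])
    show "b x (riemann b x u v w) z = - b x (riemann b x u v z) w" for u v w z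
      unfolding riemann_def
      using levi_civita.curvature_parallel_form[OF bilinear_b smooth_b levi_civita(3) x]
        b_commute[OF x] by metis
    show "riemann b x u v (J x w) = J x (riemann b x u v w)" for u v w
      unfolding riemann_def
      by (rule levi_civita.curvature_parallel_endomorphism[OF linear_J smooth_J J_parallel x])
  qed
  \<comment> \<open>Parallelism of \<open>R\<close> for \<open>\<nabla> - S\<close>, solved for the
    Levi-Civita derivative.\<close>
  have SR: "cov_1_3 \<Gamma> (riemann b) x u v w z = S x u (riemann b x v w z) - riemann b x (S x u v) w z
      - riemann b x v (S x u w) z - riemann b x v w (S x u z)" for u v w z
    using R_parallel[OF x, of u v w z] by (simp add: cov_1_3_def C_def k.R_simps algebra_simps)
  interpret d: degenerate_structure \<epsilon> "b x" "J x" "riemann b x" "\<xi> x" "\<zeta> x"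
    using levi_civita.second_bianchi_identity[OF levi_civita(2)[OF x] x]
    by unfold_locales (simp_all add: assms dim lt SR flip: riemann_def)
  have Q: "curvature C x u v w = riemann b x u v w - d.Q u v w" for u v w
    by (simp add: curvature_tilde[OF x] d.Q_def lt)
  show ?thesis
  proof unfold_locales
    show "riemann b x u v (\<xi> x) = d.Q u v (\<xi> x)" for u v
      using tilde.curvature_parallel_vector[OF smooth_xi xi_zeta_parallel(1) x] by (simp add: Q)
    show "riemann b x u v (\<zeta> x) = d.Q u v (\<zeta> x)" for u v
      using tilde.curvature_parallel_vector[OF smooth_zeta xi_zeta_parallel(2) x] by (simp add: Q)
    have lin: "linear (\<lambda>u. riemann b y u v w)" "linear (\<lambda>v. riemann b y u v w)" "linear (\<lambda>w. riemann b y u v w)"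
      if "y \<in> U" for y u v w
      unfolding riemann_def by (rule levi_civita.linear_curvature[OF that])+
    have sm: "smooth_on U (\<lambda>y. riemann b y u v w)" for u v w
      unfolding riemann_def by (rule levi_civita.smooth_curvature)
    show "riemann b x u v (riemann b x a c e) - d.Q u v (riemann b x a c e)
        - riemann b x (riemann b x u v a - d.Q u v a) c e
        - riemann b x a (riemann b x u v c - d.Q u v c) e
        - riemann b x a c (riemann b x u v e - d.Q u v e) = 0" for u v a c e
      using tilde.curvature_parallel_tensor_1_3[OF lin sm R_parallel x, of u v a c e] by (simp add: Q)
  qed
qed

end

text \<open>Uniqueness for a linear equation by a maximum argument. If \<open>K\<close> bounds
  \<open>C\<close> and r is at most 1/(2K), the maximum m of the norm of \<open>V\<close> on the
  ball of radius r satisfies m \<le> K r m \<le> m/2.\<close>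

lemma parallel_section_locally_zero:
  fixes V :: "real^'n::finite \<Rightarrow> real^'n" and C :: "real^'n \<Rightarrow> 'n bil"
  assumes U: "open U" "x \<in> U"
    and bil: "\<And>y. y \<in> U \<Longrightarrow> bilinear (C y)" and cont: "\<And>u v. continuous_on U (\<lambda>y. C y u v)"
    and diff: "\<And>y. y \<in> U \<Longrightarrow> V differentiable (at y)"
    and par: "\<And>y u. y \<in> U \<Longrightarrow> dir_deriv V y u = - C y u (V y)"
    and "V x = 0"
  obtains r where "r > 0" "ball x r \<subseteq> U" "\<And>y. y \<in> ball x r \<Longrightarrow> V y = 0"
proof -
  obtain e where e: "e > 0" "cball x e \<subseteq> U" using U open_contains_cball by blast
  define N where "N y = (\<Sum>i\<in>UNIV. \<Sum>j\<in>UNIV. norm (C y (axis i 1) (axis j 1)))" for y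
  have "continuous_on (cball x e) N"
    unfolding N_def by (intro continuous_intros continuous_on_subset[OF cont e(2)])
  then have "compact (N ` cball x e)" by (rule compact_continuous_image) simp
  then obtain K where K: "\<And>y. y \<in> cball x e \<Longrightarrow> norm (N y) \<le> K" "K > 0"
    using compact_imp_bounded bounded_pos by (metis image_eqI)
  have Cb: "norm (C y u v) \<le> K * norm u * norm v" if y: "y \<in> cball x e" for y u v
  proof -
    have yU: "y \<in> U" using y e by blast
    have lin: "linear (C y u)" "linear (\<lambda>u. C y u v)" for u v
      using bil[OF yU] by (auto simp: bilinear_def)
    have "C y u v = (\<Sum>i\<in>UNIV. (u $ i) *\<^sub>R C y (axis i 1) v)" by (rule linear_sum_axis[OF lin(2)])
    also have "\<dots> = (\<Sum>i\<in>UNIV. (u $ i) *\<^sub>R (\<Sum>j\<in>UNIV. (v $ j) *\<^sub>R C y (axis i 1) (axis j 1)))"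
      by (subst linear_sum_axis[OF lin(1), of _ v]) simp
    also have "norm \<dots> \<le> (\<Sum>i\<in>UNIV. norm u * (\<Sum>j\<in>UNIV. norm v * norm (C y (axis i 1) (axis j 1))))"
      by (intro order_trans[OF norm_sum] sum_mono)
        (simp, intro mult_mono order_trans[OF norm_sum] sum_mono, simp_all add: component_le_norm_cart mult_right_mono sum_nonneg)
    also have "\<dots> = N y * norm u * norm v"
      by (simp add: N_def sum_distrib_left sum_distrib_right mult_ac)
    also have "\<dots> \<le> K * norm u * norm v"
      using K(1)[OF y] by (intro mult_right_mono) auto
    finally show ?thesis .
  qed
  define r where "r = min e (1 / (2 * K))"
  have r: "r > 0" "r \<le> e" "K * r \<le> 1 / 2" using e K(2) by (auto simp: r_def min_def field_simps)
  have sub: "cball x r \<subseteq> cball x e" using r by auto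
  have "V differentiable (at y)" if "y \<in> cball x r" for y
    using that sub e diff by blast
  then have "continuous_on (cball x r) (\<lambda>y. norm (V y))"
    by (intro continuous_on_norm differentiable_imp_continuous_on differentiable_at_imp_differentiable_on) auto
  then obtain p where p: "p \<in> cball x r" "\<And>y. y \<in> cball x r \<Longrightarrow> norm (V y) \<le> norm (V p)"
    using continuous_attains_sup[of "cball x r" "\<lambda>y. norm (V y)"] r by auto
  have "norm (V p - V x) \<le> K * norm (V p) * norm (p - x)"
  proof (rule differentiable_bound[where S = "cball x r" and f' = "\<lambda>y. dir_deriv V y"])
    fix y assume y: "y \<in> cball x r"
    then have yU: "y \<in> U" using sub e by blast
    show "(V has_derivative dir_deriv V y) (at y within cball x r)"
      using diff[OF yU] has_derivative_at_withinI
      by (auto simp: frechet_derivative_works dir_deriv_def[abs_def])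
    have "norm (dir_deriv V y u) \<le> K * norm (V p) * norm u" for u
    proof -
      have "norm (dir_deriv V y u) \<le> K * norm u * norm (V y)"
        using Cb[of y u "V y"] y sub by (auto simp: par[OF yU])
      also have "\<dots> \<le> K * norm u * norm (V p)"
        using p(2)[OF y] K(2) by (intro mult_left_mono) auto
      finally show ?thesis by (simp add: mult_ac)
    qed
    then show "onorm (dir_deriv V y) \<le> K * norm (V p)" by (rule onorm_le)
  qed (use p r in auto)
  also have "\<dots> \<le> K * norm (V p) * r"
    using p(1) K(2) by (intro mult_left_mono) (auto simp: dist_norm norm_minus_commute)
  also have "\<dots> \<le> (1 / 2) * norm (V p)"
    using mult_right_mono[OF r(3), of "norm (V p)"] by (simp add: mult_ac)
  finally have "V p = 0" using \<open>V x = 0\<close> by simp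
  then have "V y = 0" if "y \<in> ball x r" for y using p(2)[of y] that by auto
  then show thesis using that[of r] r(1) sub e ball_subset_cball by blast
qed

section \<open>Propagation along the manifold\<close>

lemma openin_chart_preimage:
  assumes "is_chart X c" "open W"
  shows "openin X {p \<in> fst c. snd c p \<in> W}"
proof -
  have o: "openin X (fst c)" and "continuous_map (subtopology X (fst c)) (top_of_set (snd c ` fst c)) (snd c)"
    using assms(1) by (auto simp: is_chart_def homeomorphic_imp_continuous_map)
  then have "continuous_map (subtopology X (fst c)) euclidean (snd c)"
    by (simp add: continuous_map_in_subtopology)
  then have "openin (subtopology X (fst c)) {p \<in> topspace (subtopology X (fst c)). snd c p \<in> W}"
    by (rule openin_continuous_map_preimage) (simp add: assms(2))
  moreover have "topspace (subtopology X (fst c)) = fst c"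
    using openin_subset[OF o] by auto
  ultimately have "openin (subtopology X (fst c)) {p \<in> fst c. snd c p \<in> W}"
    by (simp only:)
  then show ?thesis by (rule openin_trans_full[OF _ o])
qed

lemma transition_chart:
  assumes "is_chart X c" "p \<in> fst c"
  shows "transition c d (snd c p) = snd d p"
proof -
  have "topspace (subtopology X (fst c)) = fst c"
    using assms(1) openin_subset unfolding is_chart_def by auto
  then have "inj_on (snd c) (fst c)"
    using assms(1) homeomorphic_imp_injective_map unfolding is_chart_def by metis
  then show ?thesis using assms(2) by (simp add: transition_def)
qed

text \<open>The zero set is open by \<open>zero_open\<close>, its complement by continuity.
  \<open>compat\<close> makes both independent of the chart, so connectedness applies.\<close>

lemma section_zero_everywhere:
  fixes V :: "('a, 'n::finite, real^'n) field"
  assumes M: "smooth_manifold X \<A>" "connected_space X"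
    and compat: "\<And>c d x. c \<in> \<A> \<Longrightarrow> d \<in> \<A> \<Longrightarrow> x \<in> overlap c d \<Longrightarrow> V c x = 0 \<Longrightarrow> V d (transition c d x) = 0"
    and cont: "\<And>c. c \<in> \<A> \<Longrightarrow> continuous_on (chart_image c) (V c)"
    and zero_open: "\<And>c. c \<in> \<A> \<Longrightarrow> open {x \<in> chart_image c. V c x = 0}"
    and z: "c\<^sub>0 \<in> \<A>" "x\<^sub>0 \<in> chart_image c\<^sub>0" "V c\<^sub>0 x\<^sub>0 = 0"
    and c: "c \<in> \<A>" "x \<in> chart_image c"
  shows "V c x = 0"
proof -
  have ch: "is_chart X c" if "c \<in> \<A>" for c using M(1) that by (auto simp: smooth_manifold_def)
  have cover: "(\<Union>c\<in>\<A>. fst c) = topspace X" using M(1) by (simp add: smooth_manifold_def)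
  have indep: "V d (snd d p) = 0" if "c \<in> \<A>" "d \<in> \<A>" "p \<in> fst c" "p \<in> fst d" "V c (snd c p) = 0" for c d p
    using compat[of c d "snd c p"] that transition_chart[OF ch, of c p d] by (auto simp: overlap_def)
  define Z where "Z = (\<Union>c\<in>\<A>. {p \<in> fst c. snd c p \<in> {x \<in> chart_image c. V c x = 0}})"
  have "openin X {p \<in> fst c. snd c p \<in> {x \<in> chart_image c. V c x = 0}}" if "c \<in> \<A>" for c
    by (rule openin_chart_preimage[OF ch zero_open]) (fact that)+
  then have "openin X Z"
    unfolding Z_def by (intro openin_Union) blast
  moreover have "topspace X - Z = (\<Union>c\<in>\<A>. {p \<in> fst c. snd c p \<in> {x \<in> chart_image c. V c x \<noteq> 0}})"
  proof -
    have "p \<in> Z \<longleftrightarrow> (\<exists>c\<in>\<A>. p \<in> fst c \<and> V c (snd c p) = 0)" for p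
      unfolding Z_def chart_image_def by blast
    moreover have "p \<in> topspace X \<longleftrightarrow> (\<exists>c\<in>\<A>. p \<in> fst c)" for p
      unfolding cover[symmetric] by blast
    moreover have "p \<in> (\<Union>c\<in>\<A>. {p \<in> fst c. snd c p \<in> {x \<in> chart_image c. V c x \<noteq> 0}}) \<longleftrightarrow>
        (\<exists>c\<in>\<A>. p \<in> fst c \<and> V c (snd c p) \<noteq> 0)" for p
      unfolding chart_image_def by blast
    ultimately show ?thesis using indep unfolding set_eq_iff Diff_iff by meson
  qed
  moreover have "openin X (\<Union>c\<in>\<A>. {p \<in> fst c. snd c p \<in> {x \<in> chart_image c. V c x \<noteq> 0}})"
  proof (intro openin_Union)
    fix S assume "S \<in> (\<lambda>c. {p \<in> fst c. snd c p \<in> {x \<in> chart_image c. V c x \<noteq> 0}}) ` \<A>"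
    then obtain c where c: "c \<in> \<A>" "S = {p \<in> fst c. snd c p \<in> {x \<in> chart_image c. V c x \<noteq> 0}}" by auto
    have "open (chart_image c)" using ch[OF c(1)] by (simp add: is_chart_def chart_image_def)
    then have "open (chart_image c \<inter> V c -` (- {0}))"
      by (intro continuous_open_preimage cont c(1)) auto
    then have "open {x \<in> chart_image c. V c x \<noteq> 0}"
      by (rule back_subst[where P = "open"]) auto
    then show "openin X S" unfolding c(2) by (rule openin_chart_preimage[OF ch[OF c(1)]])
  qed
  moreover have "Z \<subseteq> topspace X" unfolding Z_def cover[symmetric] by auto
  ultimately have "closedin X Z" by (simp add: closedin_def)
  with \<open>openin X Z\<close> M(2) have "Z = {} \<or> Z = topspace X"
    by (auto simp: connected_space_clopen_in)
  moreover have "Z \<noteq> {}" using z by (auto simp: Z_def chart_image_def)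
  ultimately have Z: "Z = topspace X" by blast
  obtain p where p: "p \<in> fst c" "x = snd c p" using c by (auto simp: chart_image_def)
  then have "p \<in> Z" using Z c cover by auto
  then show ?thesis using indep c p unfolding Z_def by blast
qed

text \<open>Raising an index turns \<open>r\<close> into a sum of two rank one maps with images
  spanned by \<open>\<xi>\<close> and \<open>J \<xi>\<close>. Their traces are multiples of
  \<open>\<beta> \<xi> \<xi>\<close>.\<close>

lemma metric_trace_eq_0:
  assumes "hermitian_space \<epsilon> \<beta> J" "\<beta> \<xi> \<xi> = 0"
    and r: "\<And>v w. r v w = c * (\<beta> \<xi> v * \<beta> \<xi> w - \<epsilon> * (\<beta> \<xi> (J v) * \<beta> \<xi> (J w)))"
  shows "metric_trace \<beta> r = 0"
proof -
  interpret hermitian_space \<epsilon> \<beta> J by (rule assms(1))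
  have JJ: "\<beta> (J \<xi>) w = - \<beta> \<xi> (J w)" for w by (rule J_skew)
  define F where "F v = (c * \<beta> \<xi> v) *\<^sub>R \<xi> + (c * \<epsilon> * \<beta> \<xi> (J v)) *\<^sub>R J \<xi>" for v
  have "linear F"
    by (auto simp: F_def linear_iff g_simps J_simps algebra_simps)
  moreover have F: "\<beta> (F v) w = r v w" for v w
    by (simp add: F_def r JJ g_simps algebra_simps)
  moreover have "G = F" if "linear G \<and> (\<forall>v w. \<beta> (G v) w = r v w)" for G
    by (rule ext, rule g_eqI) (simp add: F that)
  ultimately have "(THE F. linear F \<and> (\<forall>v w. \<beta> (F v) w = r v w)) = F"
    by (intro the_equality) blast+
  then have "metric_trace \<beta> r = tr F" by (simp add: metric_trace_def)
  also have "\<dots> = 0"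
  proof -
    have "linear (\<lambda>v. c * \<beta> \<xi> v)" "linear (\<lambda>v. c * \<epsilon> * \<beta> \<xi> (J v))"
      by (auto simp: linear_iff g_simps J_simps algebra_simps)
    then show ?thesis
      by (simp add: F_def[abs_def] tr_add tr_rank_one J_J g_simps assms(2))
  qed
  finally show ?thesis .
qed

theorem proposition3p2:
  fixes X :: "'a topology" and \<A> :: "('a, 'n::finite) chart set" and \<epsilon> :: real
    and g :: "('a, 'n, 'n form2) field" and J :: "('a, 'n, 'n endo) field"
    and S :: "('a, 'n, 'n bil) field" and \<xi> \<zeta> :: "('a, 'n, real^'n) field"
  assumes "\<epsilon> \<in> {-1, 1}"
    and "eps_kaehler_manifold X \<A> \<epsilon> g J"
    and "connected_space X"
    and "CARD('n) \<ge> 4"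
    and "homogeneous_eps_kaehler_structure \<A> g J S"
    and "linear_type \<A> \<epsilon> g J \<xi> \<zeta> S"
    and "degenerate_direction \<A> g \<xi>"
  shows "\<exists>l::real.
      (\<forall>c\<in>\<A>. \<forall>x\<in>chart_image c. \<zeta> c x = l *\<^sub>R \<xi> c x) \<and>
      (let a = 1 / (real CARD('n) + 2); \<theta> = flat g \<xi> in
         \<forall>c\<in>\<A>. \<forall>x\<in>chart_image c. \<forall>u v.
           ricci (g c) x u v =
             - (1 / a) * l * (\<epsilon> + 2 * l) *
               (\<theta> c x u * \<theta> c x v - \<epsilon> * (\<theta> c x (J c x u) * \<theta> c x (J c x v)))) \<and>
      (\<forall>c\<in>\<A>. \<forall>x\<in>chart_image c. scalar_curvature (g c) x = 0)"
proof -
  have M: "smooth_manifold X \<A>" using assms(2) by (simp add: eps_kaehler_manifold_def)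
  have chart: "homogeneous_chart (chart_image c) (g c) \<epsilon> (J c) (S c) (\<xi> c) (\<zeta> c) (tilde_connection g S c)"
    if c: "c \<in> \<A>" for c
  proof unfold_locales
    show "open (chart_image c)"
      using M c by (auto simp: smooth_manifold_def is_chart_def chart_image_def)
    show "tilde_connection g S c = (\<lambda>y u v. levi_civita (g c) y u v - S c y u v)"
      by (simp add: fun_eq_iff tilde_connection_def)
  qed (use assms c in \<open>auto simp: eps_kaehler_manifold_def pseudo_riemannian_metric_def tensor_field_0_2_def
      tensor_field_1_1_def tensor_field_1_2_def homogeneous_eps_kaehler_structure_def linear_type_def
      vector_field_def linear_add linear_scale\<close>)
  have vf: "\<xi> d (transition c d x) = frechet_derivative (transition c d) (at x) (\<xi> c x)"
    "\<zeta> d (transition c d x) = frechet_derivative (transition c d) (at x) (\<zeta> c x)"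
    "linear (frechet_derivative (transition c d) (at x))"
    if "c \<in> \<A>" "d \<in> \<A>" "x \<in> overlap c d" for c d x
    using assms(6) M that
    by (auto simp: linear_type_def vector_field_def compatible_def smooth_manifold_def
        intro!: linear_frechet_derivative smooth_on_differentiable)
  \<comment> \<open>Combinations with constant coefficients are parallel as well. The pair 1, 0 will
    show that \<open>\<xi>\<close> has no zeros, the pair \<open>- l\<close>, 1 that the factor
    found at one point is valid everywhere.\<close>
  have combination_zero: "a *\<^sub>R \<xi> c x + k *\<^sub>R \<zeta> c x = 0"
    if z: "c\<^sub>0 \<in> \<A>" "x\<^sub>0 \<in> chart_image c\<^sub>0" "a *\<^sub>R \<xi> c\<^sub>0 x\<^sub>0 + k *\<^sub>R \<zeta> c\<^sub>0 x\<^sub>0 = 0"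
      and c: "c \<in> \<A>" "x \<in> chart_image c" for a k c\<^sub>0 x\<^sub>0 c x
  proof -
    define V where "V c x = a *\<^sub>R \<xi> c x + k *\<^sub>R \<zeta> c x" for c x
    have "V c x = 0"
    proof (rule section_zero_everywhere[OF M assms(3) _ _ _ z(1,2) _ c])
      show "V c\<^sub>0 x\<^sub>0 = 0" using z by (simp add: V_def)
      show "V d (transition c d x) = 0" if "c \<in> \<A>" "d \<in> \<A>" "x \<in> overlap c d" "V c x = 0" for c d x
      proof -
        have "V d (transition c d x) = frechet_derivative (transition c d) (at x) (V c x)"
          using vf[OF that(1-3)] by (simp add: V_def linear_add linear_scale)
        then show ?thesis using that(4) linear_0[OF vf(3)[OF that(1-3)]] by simp
      qed
    next
      fix c assume c: "c \<in> \<A>"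
      interpret homogeneous_chart "chart_image c" "g c" \<epsilon> "J c" "S c" "\<xi> c" "\<zeta> c" "tilde_connection g S c"
        by (rule chart[OF c])
      have sm: "smooth_on (chart_image c) (V c)"
        unfolding V_def[abs_def]
        by (intro smooth_on_add smooth_on_scaleR smooth_on_const open_U smooth_xi smooth_zeta)
      then show "continuous_on (chart_image c) (V c)" by (rule smooth_on_continuous)
      have par: "dir_deriv (V c) y u = - tilde_connection g S c y u (V c y)" if "y \<in> chart_image c" for y u
        unfolding V_def[abs_def]
        using that
        by (simp add: dir_deriv_add dir_deriv_cmul smooth_on_differentiable[OF _ that] smooth_on_scaleR
            smooth_on_const smooth_xi smooth_zeta open_U xi_zeta_parallel tilde.C_simps)
      show "open {x \<in> chart_image c. V c x = 0}"
        unfolding open_contains_ball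
      proof
        fix x assume "x \<in> {x \<in> chart_image c. V c x = 0}"
        then obtain r where "r > 0" "ball x r \<subseteq> chart_image c" "\<And>y. y \<in> ball x r \<Longrightarrow> V c y = 0"
          using parallel_section_locally_zero[OF open_U _ tilde.bilinear_C
              smooth_on_continuous[OF tilde.smooth_C] smooth_on_differentiable[OF sm] par, of x]
          by blast
        then show "\<exists>r>0. ball x r \<subseteq> {x \<in> chart_image c. V c x = 0}" by blast
      qed
    qed
    then show ?thesis by (simp add: V_def)
  qed
  obtain c\<^sub>0 x\<^sub>0 where z: "c\<^sub>0 \<in> \<A>" "x\<^sub>0 \<in> chart_image c\<^sub>0" "\<xi> c\<^sub>0 x\<^sub>0 \<noteq> 0"
    using assms(7) by (auto simp: degenerate_direction_def)
  have null: "g c x (\<xi> c x) (\<xi> c x) = 0" if "c \<in> \<A>" "x \<in> chart_image c" for c x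
    using assms(7) that by (auto simp: degenerate_direction_def)
  have nonzero: "\<xi> c x \<noteq> 0" if "c \<in> \<A>" "x \<in> chart_image c" for c x
    using combination_zero[where a = 1 and k = 0, OF that _ z(1,2)] z(3) by auto
  have local: "\<exists>l. \<zeta> c x = l *\<^sub>R \<xi> c x \<and> (\<forall>u v. ricci (g c) x u v =
      - (real CARD('n) + 2) * l * (\<epsilon> + 2 * l) * (g c x (\<xi> c x) u * g c x (\<xi> c x) v
        - \<epsilon> * (g c x (\<xi> c x) (J c x u) * g c x (\<xi> c x) (J c x v))))"
    if "c \<in> \<A>" "x \<in> chart_image c" for c x
    using homogeneous_model.ricci_formula[OF homogeneous_chart.pointwise_model[OF chart[OF that(1)] that(2)
          null[OF that] nonzero[OF that]]]
    by (simp add: ricci_def)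
  obtain l where l: "\<zeta> c\<^sub>0 x\<^sub>0 = l *\<^sub>R \<xi> c\<^sub>0 x\<^sub>0" using local[OF z(1,2)] by blast
  have zeta: "\<zeta> c x = l *\<^sub>R \<xi> c x" if "c \<in> \<A>" "x \<in> chart_image c" for c x
    using combination_zero[where a = "- l" and k = 1, OF z(1,2) _ that] l by simp
  have ricci: "ricci (g c) x u v =
      - (real CARD('n) + 2) * l * (\<epsilon> + 2 * l) * (g c x (\<xi> c x) u * g c x (\<xi> c x) v
        - \<epsilon> * (g c x (\<xi> c x) (J c x u) * g c x (\<xi> c x) (J c x v)))"
    if cx: "c \<in> \<A>" "x \<in> chart_image c" for c x u v
  proof -
    obtain k where k: "\<zeta> c x = k *\<^sub>R \<xi> c x" "ricci (g c) x u v =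
      - (real CARD('n) + 2) * k * (\<epsilon> + 2 * k) * (g c x (\<xi> c x) u * g c x (\<xi> c x) v
        - \<epsilon> * (g c x (\<xi> c x) (J c x u) * g c x (\<xi> c x) (J c x v)))"
      using local[OF cx] by blast
    \<comment> \<open>The factor found at this point is the global one, because \<open>\<xi>\<close>
      does not vanish here.\<close>
    then have "k = l" using zeta[OF cx] nonzero[OF cx] by simp
    then show ?thesis using k by simp
  qed
  have scalar: "scalar_curvature (g c) x = 0" if "c \<in> \<A>" "x \<in> chart_image c" for c x
    unfolding scalar_curvature_def
    by (rule metric_trace_eq_0[OF homogeneous_chart.hermitian[OF chart[OF that(1)] that(2)] null[OF that]])
      (rule ricci[OF that])
  have inv: "- (1 / (1 / (real CARD('n) + 2))) = - (real CARD('n) + 2)" by simp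
  show ?thesis
    unfolding flat_def Let_def inv using zeta ricci scalar by blast
qed

end
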